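(* Let $n\ge 1$, let $p_1,\dots,p_n\ge 2$ be pairwise coprime integers and $q_1,\dots,q_n$ integers with $p_1\cdots p_n\sum_{i=1}^n \frac{q_i}{p_i}=1$. Let $N\ge 1$ be an integer, let $\Phi(q;N)$ be the $N$-colored WRT function of the Seifert loop $X(p_1/q_1,\dots,p_n/q_n)$, and let $\tau(K;N)$ be its Witten--Reshetikhin--Turaev invariant at level $K$ and color $N$ (both given by explicit formulas in the context). Then for each $K\in\mathbb Z_{\ge 1}$, $$\lim_{t\to 0+}\Phi\bigl(e^{\frac{2\pi i}{K}}e^{-t};N\bigr)=\tau(K;N).$$
   Context: Notation: $P:=p_1\cdots p_n$; $s(q,p):=\frac{1}{4p}\sum_{\ell=1}^{p-1}\cot\bigl(\frac{\pi\ell}{p}\bigr)\cot\bigl(\frac{\pi\ell q}{p}\bigr)$ (Dedekind sum); $\Theta_0:=3-\frac1P+12\sum_{j=1}^n s(q_j,p_j)$; $B:=-\frac{1}{4\sqrt P}e^{\frac{3\pi i}{4}}$; $G_0(K):=\sqrt{\frac K2}\,\frac{1}{\sin(\pi/K)}$. WRT invariant of the Seifert loop (explicit formula): $$\tau(K;N)=\frac{B\,G_0(K)}{K}\,e^{-\frac{\pi i}{2K}(\Theta_0+(N^2-1)P)}\sum_{\substack{0\le k\le 2PK-1\\ K\nmid k}}e^{-\frac{\pi i}{2KP}k^2}\,\frac{e^{N\frac{\pi i k}{K}}-e^{-N\frac{\pi i k}{K}}}{e^{\frac{\pi i k}{K}}-e^{-\frac{\pi i k}{K}}}\,\frac{\prod_{j=1}^n\bigl(e^{\frac{\pi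 i k}{Kp_j}}-e^{-\frac{\pi i k}{Kp_j}}\bigr)}{\bigl(e^{\frac{\pi i k}{K}}-e^{-\frac{\pi i k}{K}}\bigr)^{n-2}}.$$ WRT function, for $|q|<1$: $$\Phi(q;N):=\frac{(-1)^n\,q^{-\frac14(\Theta_0+(N^2-1)P)}}{2(q^{1/2}-q^{-1/2})}\sum_{\ell=-\frac{N-1}{2}}^{\frac{N-1}{2}}\ \sum_{(\varepsilon_1,\dots,\varepsilon_n)\in\{\pm1\}^n}\varepsilon_1\cdots\varepsilon_n\sum_{m=0}^\infty\binom{m+n-3}{n-3}q^{\frac P4\left(2m+2\ell+n-2+\sum_{j=1}^n\frac{\varepsilon_j}{p_j}\right)^2},$$ where $\ell$ runs in steps of $1$. For $n=1$ and $n=2$ the symbol $\binom{m+n-3}{n-3}$ is understood to be $1$ if $m=0$ and $0$ if $m\ge1$. Fractional powers at $q=e^{2\pi i/K}e^{-t}$ are $q^{\alpha}=\exp\bigl(\alpha(\frac{2\pi i}{K}-t)\bigr)$.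
   Formalization: For n=1 the binomial symbol is taken as 1, -1, 0, 0, ... (coefficients of 1-y), since the stated convention makes Φ half of τ; for K=1, where the formula for τ contains 1/sin(π) times an empty sum and is undefined, τ(1;N) is set to (-1)^(N-1) N. *)

theory Defs
  imports "HOL-Analysis.Analysis"
begin

text \<open>
  The Seifert data consist of a number n of singular fibres and of families
  p, q indexed by \<open>{1..n}\<close>; values outside this index set are irrelevant.
\<close>

definition prod_p :: "nat \<Rightarrow> (nat \<Rightarrow> nat) \<Rightarrow> nat" where
  "prod_p n p = (\<Prod>j = 1..n. p j)"

definition dedekind_sum :: "int \<Rightarrow> nat \<Rightarrow> real" where
  "dedekind_sum q p =
     1 / (4 * real p) *
     (\<Sum>l = 1..p - 1. cot (pi * real l / real p) * cot (pi * real l * real_of_int q / real p))"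

definition Theta0 :: "nat \<Rightarrow> (nat \<Rightarrow> nat) \<Rightarrow> (nat \<Rightarrow> int) \<Rightarrow> real" where
  "Theta0 n p q =
     3 - 1 / real (prod_p n p) + 12 * (\<Sum>j = 1..n. dedekind_sum (q j) (p j))"

definition B_const :: "nat \<Rightarrow> (nat \<Rightarrow> nat) \<Rightarrow> complex" where
  "B_const n p = - (1 / (4 * complex_of_real (sqrt (real (prod_p n p))))) * exp (3 * pi * \<i> / 4)"

definition G0 :: "nat \<Rightarrow> real" where
  "G0 K = sqrt (real K / 2) * (1 / sin (pi / real K))"

definition esinh :: "complex \<Rightarrow> complex" where
  "esinh z = exp z - exp (- z)"

text \<open>
  The formula has no value at \<open>K = 1\<close>: there \<open>G0 K\<close> contains \<open>1 / sin pi\<close>, while the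
  sum over k is empty.  (The conventions \<open>1 / 0 = 0\<close> of HOL would give the
  value 0.)  The value at \<open>K = 1\<close> is fixed by the normalisation in which the invariant of an
  integral homology sphere at the root of unity 1 is 1; the colour N then contributes the
  quantum integer \<open>(q^(N/2) - q^(-N/2)) / (q^(1/2) - q^(-1/2))\<close> at \<open>q^(1/2) = exp (pi * \<i>) = -1\<close>,
  which is \<open>(-1)^(N-1) * N\<close>.  The exponent \<open>n - 2\<close> is negative for \<open>n = 1\<close>, hence
  the integer power.
\<close>

definition wrt_tau :: "nat \<Rightarrow> (nat \<Rightarrow> nat) \<Rightarrow> (nat \<Rightarrow> int) \<Rightarrow> nat \<Rightarrow> nat \<Rightarrow> complex" where
  "wrt_tau n p q K N =
     (if K = 1 then (- 1) ^ (N - 1) * of_nat N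
      else
       B_const n p * of_real (G0 K) / of_nat K *
       exp (- (pi * \<i> / (2 * of_nat K)) *
            of_real (Theta0 n p q + ((real N)\<^sup>2 - 1) * real (prod_p n p))) *
       (\<Sum>k \<in> {k \<in> {0..2 * prod_p n p * K - 1}. \<not> K dvd k}.
          exp (- (pi * \<i> / (2 * of_nat K * of_nat (prod_p n p))) * (of_nat k)\<^sup>2) *
          (esinh (of_nat N * (pi * \<i> * of_nat k / of_nat K)) /
           esinh (pi * \<i> * of_nat k / of_nat K)) *
          ((\<Prod>j = 1..n. esinh (pi * \<i> * of_nat k / (of_nat K * of_nat (p j)))) /
           esinh (pi * \<i> * of_nat k / of_nat K) powi (int n - 2))))"

text \<open>
  The binomial coefficient \<open>(m + n - 3 choose n - 3)\<close>, which is the coefficient of \<open>y^m\<close> in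
  \<open>(1 - y)^(2 - n)\<close>.  For \<open>n = 1\<close> and \<open>n = 2\<close>, where the symbol needs a
  convention, this coefficient is taken as the definition.  For \<open>n = 1\<close> this means that the
  coefficient of index 1 is -1; were it 0, the function
  \<open>wrt_Phi\<close> below would be half of what is required (by the symmetry
  \<open>l \<mapsto> - l\<close>, \<open>\<epsilon> \<mapsto> - \<epsilon>\<close> the terms for \<open>m = 0\<close> and \<open>m = 1\<close> contribute equally), and its radial
  limits would be half of \<open>wrt_tau\<close>.
\<close>

definition Phi_coeff :: "nat \<Rightarrow> nat \<Rightarrow> int" where
  "Phi_coeff n m =
     (if n = 1 then (if m = 0 then 1 else if m = 1 then - 1 else 0)
      else if n = 2 then (if m = 0 then 1 else 0)
      else int ((m + n - 3) choose (n - 3)))"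

text \<open>
  Because of the fractional powers, the WRT function is a function of a logarithm L of its
  argument, with \<open>Re L < 0\<close>; the power with exponent \<open>\<alpha>\<close> is \<open>exp (\<alpha> * L)\<close>.
  The index \<open>l = - (N - 1) / 2, \<dots>, (N - 1) / 2\<close> (in steps of 1) is
  written as \<open>i - (N - 1) / 2\<close> with \<open>i < N\<close>.
\<close>

definition wrt_Phi :: "nat \<Rightarrow> (nat \<Rightarrow> nat) \<Rightarrow> (nat \<Rightarrow> int) \<Rightarrow> nat \<Rightarrow> complex \<Rightarrow> complex" where
  "wrt_Phi n p q N L =
     (- 1) ^ n *
     exp (of_real (- (1 / 4) * (Theta0 n p q + ((real N)\<^sup>2 - 1) * real (prod_p n p))) * L) /
     (2 * (exp (1 / 2 * L) - exp (- (1 / 2) * L))) *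
     (\<Sum>i<N. \<Sum>\<epsilon> \<in> {1..n} \<rightarrow>\<^sub>E {- 1, 1 :: int}.
        let l = real i - (real N - 1) / 2 in
        of_int (\<Prod>j = 1..n. \<epsilon> j) *
        (\<Sum>m. of_int (Phi_coeff n m) *
           exp (of_real (real (prod_p n p) / 4 *
                 (2 * real m + 2 * l + real n - 2
                  + (\<Sum>j = 1..n. real_of_int (\<epsilon> j) / real (p j)))\<^sup>2) * L)))"

end

theory Submission
  imports Defs "HOL-Real_Asymp.Real_Asymp" "HOL-Number_Theory.Cong"
begin

text \<open>
  Write \<open>q = exp (2 pi i / K - t)\<close>. The exponents of the series are \<open>e\<^sup>2 / (4 P)\<close> with \<open>e\<close> an
  integer, so the phase \<open>exp (pi i e\<^sup>2 / (2 P K))\<close> is periodic in \<open>e\<close> with period \<open>2 P K\<close>, and by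
  the quadratic Gauss sum its finite Fourier coefficient at frequency \<open>k\<close> is a constant times
  \<open>exp (- pi i k\<^sup>2 / (2 P K))\<close>. For a single frequency one is left with a sum of
  binomial coefficients times \<open>z ^ m\<close>, where \<open>z = exp (2 pi i k / K)\<close>, damped by a Gaussian of width tending to
  infinity. If \<open>K\<close> does not divide \<open>k\<close>, its limit is the value of the
  generating function \<open>(1 - z) powi (2 - n)\<close>, and these values make up \<open>wrt_tau\<close>. If \<open>K\<close> divides \<open>k\<close>,
  then \<open>z = 1\<close>; summed over these \<open>k\<close> the coefficient does not depend on the signs
  \<open>\<epsilon>\<close>, and the alternating sum over the signs is only of order \<open>t\<close>.

  For \<open>K = 1\<close> only these terms remain and the prefactor has a simple pole at \<open>t = 0\<close>, so that the coefficient
  of \<open>t\<close> gives \<open>N\<close> up to a phase. The phase is determined by the residue of \<open>Theta0\<close>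
  modulo 4, that is, by congruences for Dedekind sums.
\<close>

section \<open>Gaussian-damped sums of binomial coefficients\<close>

text \<open>Since |z| = 1, the term-by-term bound for a sum over m has
  \<open>(1 - exp (- h)) ^ d\<close>, of order \<open>h ^ d\<close>, in the denominator. What pays
  for this loss is differencing: every difference operator applied to the Gaussian exp (- (h y)^2)
  gains a factor h. Such operators come from two sources. The signs \<epsilon> j give symmetric
  steps of length 1 / (2 p j), and the recursion for the binomial coefficients gives unit steps;
  \<open>diffs\<close> takes an arbitrary list of steps, so that one mean value argument serves
  both. A single frequency divisible by K cannot be discarded, because its phase depends on the
  signs and spoils the cancellation; only the sum over all of them has a common phase. For K >= 2 it
  is enough that this part vanishes in the limit. For K = 1 the denominator vanishes as well, and
  the exact second-order coefficient is needed: it comes from the second derivative - 2 of exp (-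
  y^2) at 0.\<close>

fun diffs :: "(real \<times> real) list \<Rightarrow> (real \<Rightarrow> 'a::comm_ring_1) \<Rightarrow> real \<Rightarrow> 'a" where
  "diffs [] F = F"
| "diffs ((a, b) # xs) F = diffs xs (\<lambda>y. F (y + a) - F (y + b))"

lemma diffs_diff: "diffs xs (\<lambda>y. F y - G y) x = diffs xs F x - diffs xs G x"
proof (induction xs arbitrary: F G)
  case (Cons ab xs)
  obtain a b where "ab = (a, b)" by force
  then show ?case
    using Cons[of "\<lambda>y. F (y + a) - F (y + b)" "\<lambda>y. G (y + a) - G (y + b)"]
    by (simp add: algebra_simps)
qed simp

lemma diffs_shift: "diffs xs (\<lambda>y. F (y + c)) x = diffs xs F (x + c)"
proof (induction xs arbitrary: F)
  case (Cons ab xs)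
  obtain a b where "ab = (a, b)" by force
  then show ?case
    using Cons[of "\<lambda>y. F (y + a) - F (y + b)"] by (simp add: algebra_simps)
qed simp

lemma diffs_Cons: "diffs ((a, b) # xs) F x = diffs xs F (x + a) - diffs xs F (x + b)"
  by (simp add: diffs_diff diffs_shift)

lemma diffs_cmult: "diffs xs (\<lambda>y. c * F y) x = c * diffs xs F x"
  by (induction xs arbitrary: x) (auto simp: diffs_Cons algebra_simps simp del: diffs.simps(2))

text \<open>The mean value theorem is applied once per operator. The derivatives enter as a whole
  family because the differences of such a family are again successive derivatives of each other,
  and it is this new family to which the induction hypothesis is applied.\<close>

lemma diffs_mean_value:
  assumes "\<And>j x. (F j has_real_derivative F (Suc j) x) (at x)"
  shows "\<exists>\<xi>. \<bar>\<xi> - x\<bar> \<le> (\<Sum>(a, b)\<leftarrow>xs. \<bar>a\<bar> + \<bar>b\<bar>) \<and>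
           diffs xs (F j) x = (\<Prod>(a, b)\<leftarrow>xs. a - b) * F (j + length xs) \<xi>"
  using assms
proof (induction xs arbitrary: F)
  case Nil
  then show ?case by (intro exI[of _ x]) auto
next
  case (Cons ab xs)
  obtain a b where ab: "ab = (a, b)" by force
  define F' where "F' = (\<lambda>j y. F j (y + a) - F j (y + b))"
  have "(F' j has_real_derivative F' (Suc j) x) (at x)" for j x
    unfolding F'_def
    by (intro DERIV_diff; subst DERIV_shift[symmetric]; rule Cons.prems)
  from Cons.IH[where F = F', OF this] obtain \<xi> where \<xi>: "\<bar>\<xi> - x\<bar> \<le> (\<Sum>(a, b)\<leftarrow>xs. \<bar>a\<bar> + \<bar>b\<bar>)"
    "diffs xs (F' j) x = (\<Prod>(a, b)\<leftarrow>xs. a - b) * F' (j + length xs) \<xi>" by blast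
  define i where "i = j + length xs"
  have "\<exists>\<eta>. \<bar>\<eta> - \<xi>\<bar> \<le> \<bar>a\<bar> + \<bar>b\<bar> \<and> F' i \<xi> = (a - b) * F (Suc i) \<eta>"
  proof -
    consider "a = b" | "a < b" | "b < a" by linarith
    then show ?thesis
    proof cases
      case 1
      then show ?thesis by (intro exI[of _ \<xi>]) (auto simp: F'_def)
    next
      case 2
      then obtain \<eta> where "\<eta> > \<xi> + a" "\<eta> < \<xi> + b"
          "F i (\<xi> + b) - F i (\<xi> + a) = (\<xi> + b - (\<xi> + a)) * F (Suc i) \<eta>"
        using MVT2[of "\<xi> + a" "\<xi> + b" "F i" "F (Suc i)"] Cons.prems by auto
      then show ?thesis by (intro exI[of _ \<eta>]) (auto simp: F'_def algebra_simps)
    next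
      case 3
      then obtain \<eta> where "\<eta> > \<xi> + b" "\<eta> < \<xi> + a"
          "F i (\<xi> + a) - F i (\<xi> + b) = (\<xi> + a - (\<xi> + b)) * F (Suc i) \<eta>"
        using MVT2[of "\<xi> + b" "\<xi> + a" "F i" "F (Suc i)"] Cons.prems by auto
      then show ?thesis by (intro exI[of _ \<eta>]) (auto simp: F'_def algebra_simps)
    qed
  qed
  then obtain \<eta> where \<eta>: "\<bar>\<eta> - \<xi>\<bar> \<le> \<bar>a\<bar> + \<bar>b\<bar>" "F' i \<xi> = (a - b) * F (Suc i) \<eta>" by blast
  have "\<bar>\<eta> - x\<bar> \<le> (\<Sum>(a, b)\<leftarrow>ab # xs. \<bar>a\<bar> + \<bar>b\<bar>)" using \<eta>(1) \<xi>(1) ab by simp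
  moreover have "diffs (ab # xs) (F j) x = (\<Prod>(a, b)\<leftarrow>ab # xs. a - b) * F (j + length (ab # xs)) \<eta>"
    using \<xi>(2) \<eta>(2) ab by (simp add: i_def F'_def)
  ultimately show ?case by blast
qed

section \<open>Derivatives of the Gaussian and their decay\<close>

fun gauss_deriv_poly :: "nat \<Rightarrow> real poly" where
  "gauss_deriv_poly 0 = 1"
| "gauss_deriv_poly (Suc j) = pderiv (gauss_deriv_poly j) - [:0, 2:] * gauss_deriv_poly j"

text \<open>The polynomial factor is (-1)^j times the Hermite polynomial of degree j.\<close>

definition gauss_deriv :: "nat \<Rightarrow> real \<Rightarrow> real" where
  "gauss_deriv j y = poly (gauss_deriv_poly j) y * exp (- y\<^sup>2)"

lemma gauss_deriv_0: "gauss_deriv 0 y = exp (- y\<^sup>2)"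
  by (simp add: gauss_deriv_def)

lemma gauss_deriv_2_at_0: "gauss_deriv 2 0 = - 2"
  by (simp add: gauss_deriv_def numeral_2_eq_2 pderiv_pCons)

lemma has_real_derivative_gauss_deriv:
  "(gauss_deriv j has_real_derivative gauss_deriv (Suc j) x) (at x)"
proof -
  have "((\<lambda>y. poly (gauss_deriv_poly j) y * exp (- y\<^sup>2)) has_real_derivative
      poly (pderiv (gauss_deriv_poly j)) x * exp (- x\<^sup>2)
      + exp (- x\<^sup>2) * (- (2 * x)) * poly (gauss_deriv_poly j) x) (at x)"
    by (rule DERIV_mult[OF poly_DERIV]) (auto intro!: derivative_eq_intros)
  then show ?thesis unfolding gauss_deriv_def by (simp add: algebra_simps)
qed

text \<open>The bound by exp (- y) is weak for negative y but holds on the whole line, and at the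
  points h * (x + m) it is geometric in m with ratio exp (- h).\<close>

lemma gauss_deriv_bound: "\<exists>C\<ge>0. \<forall>y. \<bar>gauss_deriv j y\<bar> \<le> C * exp (- y)"
proof -
  have pw: "\<bar>y\<bar> ^ k * exp (- y\<^sup>2) \<le> fact k * exp 1 * exp (- y)" for k and y :: real
  proof -
    have "\<bar>y\<bar> ^ k / fact k \<le> exp \<bar>y\<bar>"
    proof -
      have "(\<Sum>i\<in>{k}. \<bar>y\<bar> ^ i /\<^sub>R fact i) \<le> (\<Sum>i. \<bar>y\<bar> ^ i /\<^sub>R fact i)"
        by (intro sum_le_suminf summable_exp_generic) auto
      then show ?thesis by (simp add: exp_def divide_inverse mult.commute)
    qed
    then have "\<bar>y\<bar> ^ k \<le> fact k * exp \<bar>y\<bar>" by (simp add: field_simps)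
    then have "\<bar>y\<bar> ^ k * exp (- y\<^sup>2) \<le> fact k * exp \<bar>y\<bar> * exp (- y\<^sup>2)"
      by (intro mult_right_mono) auto
    also have "\<dots> = fact k * exp (\<bar>y\<bar> - y\<^sup>2)" by (simp add: exp_diff exp_minus field_simps)
    also have "\<dots> \<le> fact k * exp (1 - y)"
    proof -
      have "0 \<le> (\<bar>y\<bar> - 1)\<^sup>2" by simp
      then have "\<bar>y\<bar> - y\<^sup>2 \<le> 1 - y" by (simp add: power2_diff abs_if split: if_splits)
      then show ?thesis by simp
    qed
    finally show ?thesis by (simp add: exp_diff exp_minus field_simps)
  qed
  define p where "p = gauss_deriv_poly j"
  define C where "C = (\<Sum>k\<le>degree p. \<bar>coeff p k\<bar> * (fact k * exp 1))"
  have "\<bar>gauss_deriv j y\<bar> \<le> C * exp (- y)" for y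
  proof -
    have "\<bar>gauss_deriv j y\<bar> = \<bar>\<Sum>k\<le>degree p. coeff p k * y ^ k\<bar> * exp (- y\<^sup>2)"
      by (simp add: gauss_deriv_def p_def poly_altdef abs_mult)
    also have "\<dots> \<le> (\<Sum>k\<le>degree p. \<bar>coeff p k * y ^ k\<bar>) * exp (- y\<^sup>2)"
      by (intro mult_right_mono sum_abs) auto
    also have "\<dots> = (\<Sum>k\<le>degree p. \<bar>coeff p k\<bar> * (\<bar>y\<bar> ^ k * exp (- y\<^sup>2)))"
      by (simp add: sum_distrib_right abs_mult power_abs mult.assoc)
    also have "\<dots> \<le> (\<Sum>k\<le>degree p. \<bar>coeff p k\<bar> * (fact k * exp 1 * exp (- y)))"
      by (intro sum_mono mult_left_mono pw) auto
    also have "\<dots> = C * exp (- y)" by (simp add: C_def sum_distrib_right mult.assoc)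
    finally show ?thesis .
  qed
  moreover have "C \<ge> 0" unfolding C_def by (intro sum_nonneg) auto
  ultimately show ?thesis by blast
qed

text \<open>The j-th derivative in y of exp (- (h * y)^2).\<close>

definition scaled_gauss_deriv :: "nat \<Rightarrow> real \<Rightarrow> real \<Rightarrow> real" where
  "scaled_gauss_deriv j h y = h ^ j * gauss_deriv j (h * y)"

lemma has_real_derivative_scaled_gauss_deriv:
  "(scaled_gauss_deriv j h has_real_derivative scaled_gauss_deriv (Suc j) h x) (at x)"
proof -
  have "((\<lambda>y. gauss_deriv j (h * y)) has_real_derivative gauss_deriv (Suc j) (h * x) * h) (at x)"
    by (rule DERIV_chain2[OF has_real_derivative_gauss_deriv]) (auto intro!: derivative_eq_intros)
  from DERIV_cmult[OF this, of "h ^ j"] show ?thesis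
    by (simp add: scaled_gauss_deriv_def [abs_def] mult_ac)
qed

text \<open>Each operator contributes its step a - b and one more derivative, which is worth one
  power of h. Moving the intermediate point back to x costs a further derivative, hence the exponent
  \<open>Suc i\<close>. For h <= 1 the displacement of at most R changes exp (- (h * x)) by a factor
  of at most exp R.\<close>

lemma diffs_scaled_gauss_asymp:
  fixes xs j
  defines "i \<equiv> j + length xs"
  shows "\<exists>C\<ge>0. \<forall>h x. 0 < h \<longrightarrow> h \<le> 1 \<longrightarrow>
     \<bar>diffs xs (scaled_gauss_deriv j h) x - (\<Prod>(a, b)\<leftarrow>xs. a - b) * scaled_gauss_deriv i h x\<bar>
       \<le> C * h ^ Suc i * exp (- (h * x))"
proof -
  obtain C where C: "C \<ge> 0" "\<And>y. \<bar>gauss_deriv (Suc i) y\<bar> \<le> C * exp (- y)"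
    using gauss_deriv_bound by blast
  define R where "R = (\<Sum>(a, b)\<leftarrow>xs. \<bar>a\<bar> + \<bar>b\<bar>)"
  define D where "D = (\<Prod>(a, b)\<leftarrow>xs. a - b)"
  have R: "R \<ge> 0" unfolding R_def by (intro sum_list_nonneg) auto
  have "\<bar>diffs xs (scaled_gauss_deriv j h) x - D * scaled_gauss_deriv i h x\<bar>
       \<le> (\<bar>D\<bar> * (R * C * exp R)) * h ^ Suc i * exp (- (h * x))" if h: "0 < h" "h \<le> 1" for h x
  proof -
    obtain \<xi> where \<xi>: "\<bar>\<xi> - x\<bar> \<le> R" "diffs xs (scaled_gauss_deriv j h) x = D * scaled_gauss_deriv i h \<xi>"
      using diffs_mean_value[of "\<lambda>j. scaled_gauss_deriv j h" x xs j]
        has_real_derivative_scaled_gauss_deriv unfolding R_def D_def i_def by blast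
    have bd: "\<bar>scaled_gauss_deriv (Suc i) h y\<bar> \<le> h ^ Suc i * (C * exp R * exp (- (h * x)))"
      if "\<bar>y - x\<bar> \<le> R" for y
    proof -
      have "h * (x - y) \<le> h * R" using that h by (intro mult_left_mono) auto
      also have "\<dots> \<le> R" using h R by (simp add: mult_left_le_one_le)
      finally have "h * (x - y) \<le> R" .
      then have "exp (- (h * y)) \<le> exp (R - h * x)" by (simp add: algebra_simps)
      then have "\<bar>gauss_deriv (Suc i) (h * y)\<bar> \<le> C * exp (R - h * x)"
        using C by (meson mult_left_mono order_trans)
      then show ?thesis using h unfolding scaled_gauss_deriv_def
        by (simp add: abs_mult exp_diff exp_minus field_simps)
    qed
    have "\<bar>scaled_gauss_deriv i h \<xi> - scaled_gauss_deriv i h x\<bar>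
        \<le> h ^ Suc i * (C * exp R * exp (- (h * x))) * \<bar>\<xi> - x\<bar>"
    proof -
      have "norm (scaled_gauss_deriv i h \<xi> - scaled_gauss_deriv i h x)
        \<le> h ^ Suc i * (C * exp R * exp (- (h * x))) * norm (\<xi> - x)"
        using \<xi>(1) R bd
        by (intro field_differentiable_bound[of "{x - R..x + R}" _ "scaled_gauss_deriv (Suc i) h"])
          (auto intro!: has_field_derivative_at_within has_real_derivative_scaled_gauss_deriv)
      then show ?thesis by simp
    qed
    also have "\<dots> \<le> h ^ Suc i * (C * exp R * exp (- (h * x))) * R"
      using \<xi>(1) C(1) h by (intro mult_left_mono) auto
    finally have "\<bar>D\<bar> * \<bar>scaled_gauss_deriv i h \<xi> - scaled_gauss_deriv i h x\<bar>
        \<le> \<bar>D\<bar> * (h ^ Suc i * (C * exp R * exp (- (h * x))) * R)" by (intro mult_left_mono) auto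
    then show ?thesis by (simp add: \<xi>(2) abs_mult[symmetric] algebra_simps)
  qed
  moreover have "\<bar>D\<bar> * (R * C * exp R) \<ge> 0" using R C by simp
  ultimately show ?thesis unfolding D_def by blast
qed

lemma diffs_scaled_gauss_bound:
  "\<exists>C\<ge>0. \<forall>h x. 0 < h \<longrightarrow> h \<le> 1 \<longrightarrow>
     \<bar>diffs xs (scaled_gauss_deriv j h) x\<bar> \<le> C * h ^ (j + length xs) * exp (- (h * x))"
proof -
  define i where "i = j + length xs"
  define D where "D = (\<Prod>(a, b)\<leftarrow>xs. a - b)"
  obtain C where C: "C \<ge> 0" "\<And>y. \<bar>gauss_deriv i y\<bar> \<le> C * exp (- y)"
    using gauss_deriv_bound by blast
  obtain E where E: "E \<ge> 0" "\<And>h x. 0 < h \<Longrightarrow> h \<le> 1 \<Longrightarrow>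
     \<bar>diffs xs (scaled_gauss_deriv j h) x - D * scaled_gauss_deriv i h x\<bar>
       \<le> E * h ^ Suc i * exp (- (h * x))"
    using diffs_scaled_gauss_asymp[of xs j] unfolding i_def D_def by blast
  have "\<bar>diffs xs (scaled_gauss_deriv j h) x\<bar> \<le> (E + \<bar>D\<bar> * C) * h ^ i * exp (- (h * x))"
    if h: "0 < h" "h \<le> 1" for h x
  proof -
    have "E * h ^ Suc i * exp (- (h * x)) \<le> E * h ^ i * exp (- (h * x))"
      using h E by (intro mult_right_mono mult_left_mono) (auto intro: mult_left_le_one_le)
    moreover have "\<bar>D * scaled_gauss_deriv i h x\<bar> \<le> \<bar>D\<bar> * (h ^ i * (C * exp (- (h * x))))"
      using h C(2)[of "h * x"] unfolding scaled_gauss_deriv_def abs_mult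
      by (intro mult_left_mono) auto
    ultimately show ?thesis using E(2)[OF h, of x] by (simp add: algebra_simps)
  qed
  then show ?thesis using C E unfolding i_def by (intro exI[of _ "E + \<bar>D\<bar> * C"]) auto
qed

section \<open>Sums weighted by the coefficients of (1 - y)^(-d)\<close>

definition mchoose :: "nat \<Rightarrow> nat \<Rightarrow> nat" where
  "mchoose d m = (m + d - 1) choose m"

text \<open>Truncated subtraction decides the case d = 0: \<open>(m - 1) choose m\<close> is 1 for m
  = 0 and 0 otherwise, the coefficients of the constant series 1.\<close>

lemma mchoose_0: "mchoose 0 m = (if m = 0 then 1 else 0)"
  by (simp add: mchoose_def)

lemma mchoose_Suc_0: "mchoose d 0 = 1"
  by (simp add: mchoose_def)

lemma mchoose_Suc_Suc: "mchoose (Suc d) (Suc m) = mchoose d (Suc m) + mchoose (Suc d) m"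
  by (simp add: mchoose_def)

lemma sum_mchoose: "(\<Sum>i\<le>m. mchoose d i) = mchoose (Suc d) m"
  by (induction m) (auto simp: mchoose_Suc_Suc mchoose_Suc_0)

lemma mchoose_sums:
  fixes r :: real
  assumes "0 \<le> r" "r < 1"
  shows "(\<lambda>m. real (mchoose d m) * r ^ m) sums (1 / (1 - r) ^ d)"
proof (induction d)
  case 0
  then show ?case using sums_finite[of "{0}" "\<lambda>m. real (mchoose 0 m) * r ^ m"]
    by (simp add: mchoose_0)
next
  case (Suc d)
  have g: "(\<lambda>m. r ^ m) sums (1 / (1 - r))" using assms by (intro geometric_sums) auto
  have s1: "summable (\<lambda>m. norm (real (mchoose d m) * r ^ m))"
    using Suc assms by (simp add: sums_summable abs_mult power_abs)
  have s2: "summable (\<lambda>m. norm (r ^ m))"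
    using g assms by (simp add: sums_summable power_abs)
  have "(\<lambda>m. \<Sum>i\<le>m. real (mchoose d i) * r ^ i * r ^ (m - i)) sums
      ((\<Sum>m. real (mchoose d m) * r ^ m) * (\<Sum>m. r ^ m))"
    by (rule Cauchy_product_sums[OF s1 s2])
  moreover have "(\<Sum>i\<le>m. real (mchoose d i) * r ^ i * r ^ (m - i)) = real (mchoose (Suc d) m) * r ^ m" for m
  proof -
    have "(\<Sum>i\<le>m. real (mchoose d i) * r ^ i * r ^ (m - i)) = (\<Sum>i\<le>m. real (mchoose d i) * r ^ m)"
      by (intro sum.cong) (auto simp: mult.assoc power_add[symmetric])
    then show ?thesis by (simp add: sum_distrib_right[symmetric] sum_mchoose[symmetric])
  qed
  moreover have "(\<Sum>m. real (mchoose d m) * r ^ m) * (\<Sum>m. r ^ m) = 1 / (1 - r) ^ Suc d"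
    unfolding sums_unique[OF Suc, symmetric] sums_unique[OF g, symmetric] by simp
  ultimately show ?case by simp
qed

text \<open>The constant may depend on h. The class contains the derivatives of the scaled Gaussian
  and is closed under shifts, differences and multiples, so it carries absolute convergence through
  the algebra for fixed h; bounds uniform in h are stated separately.\<close>

definition damped :: "real \<Rightarrow> (real \<Rightarrow> real) \<Rightarrow> bool" where
  "damped h G \<longleftrightarrow> (\<exists>C\<ge>0. \<forall>y. \<bar>G y\<bar> \<le> C * exp (- (h * y)))"

lemma damped_shift: "damped h G \<Longrightarrow> damped h (\<lambda>y. G (y + a))"
  unfolding damped_def
proof (elim exE conjE)
  fix C :: real assume C: "C \<ge> 0" "\<forall>y. \<bar>G y\<bar> \<le> C * exp (- (h * y))"
  have "\<bar>G (y + a)\<bar> \<le> (C * exp (- (h * a))) * exp (- (h * y))" for y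
    using C(2)[rule_format, of "y + a"] by (simp add: exp_add[symmetric] algebra_simps)
  then show "\<exists>C\<ge>0. \<forall>y. \<bar>G (y + a)\<bar> \<le> C * exp (- (h * y))"
    using C(1) by (intro exI[of _ "C * exp (- (h * a))"]) auto
qed

lemma damped_diff: "damped h F \<Longrightarrow> damped h G \<Longrightarrow> damped h (\<lambda>y. F y - G y)"
  unfolding damped_def
proof (elim exE conjE)
  fix C D :: real
  assume C: "C \<ge> 0" "\<forall>y. \<bar>F y\<bar> \<le> C * exp (- (h * y))"
    and D: "D \<ge> 0" "\<forall>y. \<bar>G y\<bar> \<le> D * exp (- (h * y))"
  have "\<bar>F y - G y\<bar> \<le> (C + D) * exp (- (h * y))" for y
    using C(2)[rule_format, of y] D(2)[rule_format, of y] by (simp add: algebra_simps)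
  then show "\<exists>C\<ge>0. \<forall>y. \<bar>F y - G y\<bar> \<le> C * exp (- (h * y))"
    using C(1) D(1) by (intro exI[of _ "C + D"]) auto
qed

lemma damped_cmult: "damped h F \<Longrightarrow> damped h (\<lambda>y. c * F y)"
  unfolding damped_def
proof (elim exE conjE)
  fix C :: real
  assume C: "C \<ge> 0" "\<forall>y. \<bar>F y\<bar> \<le> C * exp (- (h * y))"
  then have "\<bar>c * F y\<bar> \<le> (\<bar>c\<bar> * C) * exp (- (h * y))" for y
    by (simp add: abs_mult mult.assoc mult_left_mono)
  then show "\<exists>C\<ge>0. \<forall>y. \<bar>c * F y\<bar> \<le> C * exp (- (h * y))"
    using C(1) by (intro exI[of _ "\<bar>c\<bar> * C"]) auto
qed

lemma damped_diffs: "damped h F \<Longrightarrow> damped h (diffs xs F)"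
proof (induction xs arbitrary: F)
  case Nil
  then show ?case by (simp add: damped_def)
next
  case (Cons ab xs)
  obtain a b where "ab = (a, b)" by force
  with Cons show ?case by (simp add: damped_diff damped_shift)
qed

lemma damped_scaled_gauss_deriv: "0 \<le> h \<Longrightarrow> damped h (scaled_gauss_deriv j h)"
proof -
  assume h: "0 \<le> h"
  obtain C where "C \<ge> 0" "\<And>y. \<bar>gauss_deriv j y\<bar> \<le> C * exp (- y)"
    using gauss_deriv_bound by blast
  then show ?thesis unfolding damped_def scaled_gauss_deriv_def
    using h by (intro exI[of _ "h ^ j * C"]) (auto simp: abs_mult mult.assoc intro!: mult_left_mono)
qed

text \<open>With E for the shift by 1, this is the operator (1 - z E)^(-d) applied to G and
  evaluated at x; the identities for it below are rules for this operator.\<close>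

definition mchoose_sum :: "nat \<Rightarrow> complex \<Rightarrow> (real \<Rightarrow> real) \<Rightarrow> real \<Rightarrow> complex" where
  "mchoose_sum d z G x = (\<Sum>m. of_nat (mchoose d m) * z ^ m * of_real (G (x + real m)))"

text \<open>Replacing G by its exponential bound turns the sum into the generating function of
  \<open>mchoose d\<close> at exp (- h). All cancellation among the powers of z is given up
  here.\<close>

lemma
  assumes h: "0 < h" and z: "norm z \<le> 1" and G: "\<And>y. \<bar>G y\<bar> \<le> C * exp (- (h * y))"
  shows summable_mchoose_sum:
      "summable (\<lambda>m. of_nat (mchoose d m) * z ^ m * of_real (G (x + real m)) :: complex)"
    and norm_mchoose_sum_le:
      "norm (mchoose_sum d z G x) \<le> C * exp (- (h * x)) / (1 - exp (- h)) ^ d"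
proof -
  have sums: "(\<lambda>m. C * exp (- (h * x)) * (real (mchoose d m) * exp (- h) ^ m)) sums
      (C * exp (- (h * x)) * (1 / (1 - exp (- h)) ^ d))"
    using h by (intro sums_mult mchoose_sums) auto
  have le: "norm (of_nat (mchoose d m) * z ^ m * of_real (G (x + real m)) :: complex)
      \<le> C * exp (- (h * x)) * (real (mchoose d m) * exp (- h) ^ m)" for m
  proof -
    have "norm (of_nat (mchoose d m) * z ^ m * of_real (G (x + real m)) :: complex)
      = real (mchoose d m) * (norm z ^ m * \<bar>G (x + real m)\<bar>)"
      by (simp add: norm_mult norm_power)
    also have "\<dots> \<le> real (mchoose d m) * (1 * (C * exp (- (h * (x + real m)))))"
      using z by (intro mult_left_mono mult_mono G power_le_one) auto
    also have "\<dots> = C * exp (- (h * x)) * (real (mchoose d m) * exp (- h) ^ m)"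
      by (simp add: exp_of_nat_mult[symmetric] exp_add[symmetric] algebra_simps)
    finally show ?thesis .
  qed
  show "summable (\<lambda>m. of_nat (mchoose d m) * z ^ m * of_real (G (x + real m)) :: complex)"
    using sums_summable[OF sums] le by (rule summable_comparison_test')
  have "norm (mchoose_sum d z G x) \<le> (\<Sum>m. C * exp (- (h * x)) * (real (mchoose d m) * exp (- h) ^ m))"
    unfolding mchoose_sum_def by (rule norm_suminf_le[OF le sums_summable[OF sums]])
  then show "norm (mchoose_sum d z G x) \<le> C * exp (- (h * x)) / (1 - exp (- h)) ^ d"
    using sums_unique[OF sums] by simp
qed

lemma summable_mchoose_sum_damped:
  assumes "0 < h" "norm z \<le> 1" "damped h G"
  shows "summable (\<lambda>m. of_nat (mchoose d m) * z ^ m * of_real (G (x + real m)) :: complex)"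
  using assms summable_mchoose_sum[of h z G] unfolding damped_def by blast

lemma mchoose_sum_diff:
  assumes "0 < h" "norm z \<le> 1" "damped h F" "damped h G"
  shows "mchoose_sum d z (\<lambda>y. F y - G y) x = mchoose_sum d z F x - mchoose_sum d z G x"
  unfolding mchoose_sum_def
  using suminf_diff[OF summable_mchoose_sum_damped[OF assms(1-3)] summable_mchoose_sum_damped[OF assms(1,2,4)]]
  by (simp add: algebra_simps)

lemma mchoose_sum_shift: "mchoose_sum d z (\<lambda>y. G (y + a)) x = mchoose_sum d z G (x + a)"
  by (simp add: mchoose_sum_def algebra_simps)

lemma mchoose_sum_0: "mchoose_sum 0 z G x = of_real (G x)"
proof -
  have "mchoose_sum 0 z G x = (\<Sum>m\<in>{0}. of_nat (mchoose 0 m) * z ^ m * of_real (G (x + real m)))"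
    unfolding mchoose_sum_def by (rule suminf_finite) (auto simp: mchoose_0)
  then show ?thesis by (simp add: mchoose_0)
qed

lemma mchoose_sum_Suc:
  assumes "0 < h" "norm z \<le> 1" "damped h G"
  shows "mchoose_sum (Suc d) z G x - z * mchoose_sum (Suc d) z G (x + 1) = mchoose_sum d z G x"
proof -
  define f where "f = (\<lambda>d m. of_nat (mchoose d m) * z ^ m * of_real (G (x + real m)) :: complex)"
  define f' where "f' = (\<lambda>m. of_nat (mchoose (Suc d) m) * z ^ m * of_real (G (x + 1 + real m)) :: complex)"
  have s: "summable (f d)" for d unfolding f_def by (rule summable_mchoose_sum_damped[OF assms])
  have s': "summable f'" unfolding f'_def by (rule summable_mchoose_sum_damped[OF assms])
  have eq: "f (Suc d) (Suc m) - z * f' m = f d (Suc m)" for m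
    by (simp add: f_def f'_def mchoose_Suc_Suc algebra_simps)
  have "suminf (f (Suc d)) - z * suminf f' = f (Suc d) 0 + ((\<Sum>m. f (Suc d) (Suc m)) - (\<Sum>m. z * f' m))"
    using suminf_split_head[OF s[of "Suc d"]] suminf_mult[OF s', of z] by simp
  also have "(\<Sum>m. f (Suc d) (Suc m)) - (\<Sum>m. z * f' m) = (\<Sum>m. f d (Suc m))"
    using suminf_diff[of "\<lambda>m. f (Suc d) (Suc m)" "\<lambda>m. z * f' m"] s s'
    by (simp add: eq summable_Suc_iff summable_mult)
  also have "f (Suc d) 0 + (\<Sum>m. f d (Suc m)) = suminf (f d)"
    using suminf_split_head[OF s[of d]] by (simp add: f_def mchoose_Suc_0)
  finally show ?thesis by (simp add: mchoose_sum_def f_def f'_def)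
qed

text \<open>This is 1 - z E = (1 - z) - z (E - 1), where E - 1 is the difference with steps (1, 0).
  For z different from 1 it can be solved for the sum of index \<open>Suc d\<close>; at z = 1 the
  left-hand side disappears and it becomes an inversion formula.\<close>

lemma mchoose_sum_Suc_diffs:
  assumes "0 < h" "norm z \<le> 1" "damped h G"
  shows "(1 - z) * mchoose_sum (Suc d) z G x =
    mchoose_sum d z G x + z * mchoose_sum (Suc d) z (diffs [(1, 0)] G) x"
proof -
  have "mchoose_sum (Suc d) z (diffs [(1, 0)] G) x =
      mchoose_sum (Suc d) z G (x + 1) - mchoose_sum (Suc d) z G x"
    using mchoose_sum_diff[OF assms(1,2) damped_shift[OF assms(3), of 1] assms(3)]
    by (simp add: mchoose_sum_shift)
  then show ?thesis unfolding mchoose_sum_Suc[OF assms, of d x, symmetric]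
    by (simp add: ring_distribs del: diffs.simps)
qed

lemma diffs_append: "diffs (xs @ ys) F = diffs ys (diffs xs F)"
proof (induction xs arbitrary: F)
  case (Cons ab xs)
  obtain a b where "ab = (a, b)" by force
  then show ?case using Cons by simp
qed simp

text \<open>The operator (1 - E)^(-d) cancels (E - 1)^d up to the sign (-1)^d, with no error
  term.\<close>

lemma mchoose_sum_1_diffs:
  assumes "0 < h" "damped h G"
  shows "mchoose_sum d 1 (diffs (replicate d (1, 0)) G) x = (- 1) ^ d * of_real (G x)"
  using assms(2)
proof (induction d arbitrary: G)
  case 0
  then show ?case by (simp add: mchoose_sum_0)
next
  case (Suc d)
  define F where "F = diffs (replicate d (1, 0)) G"
  have F: "damped h F" unfolding F_def by (intro damped_diffs Suc.prems)
  have "diffs (replicate (Suc d) (1, 0)) G = diffs [(1, 0)] F"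
    unfolding F_def by (subst diffs_append[symmetric]) (simp add: replicate_append_same)
  then show ?case using mchoose_sum_Suc_diffs[OF assms(1) _ F, of 1 d x] Suc.IH[OF Suc.prems]
    by (simp add: F_def add_eq_0_iff)
qed

lemma power_div_one_minus_exp_tendsto_0:
  assumes "d < j"
  shows "((\<lambda>h::real. h ^ j / (1 - exp (- h)) ^ d) \<longlongrightarrow> 0) (at_right 0)"
proof -
  have "((\<lambda>h::real. h / (1 - exp (- h))) \<longlongrightarrow> 1) (at_right 0)" by real_asymp
  then have "((\<lambda>h::real. (h / (1 - exp (- h))) ^ d * h ^ (j - d)) \<longlongrightarrow> 1 ^ d * 0 ^ (j - d)) (at_right 0)"
    by (intro tendsto_mult tendsto_power tendsto_ident_at)
  moreover have "(h / (1 - exp (- h))) ^ d * h ^ (j - d) = h ^ j / (1 - exp (- h)) ^ d" for h :: real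
    using assms by (simp add: power_divide power_add[symmetric])
  ultimately show ?thesis using assms by (simp add: power_0_left)
qed

lemma scaled_gauss_tendsto: "((\<lambda>h. scaled_gauss_deriv 0 h x) \<longlongrightarrow> 1) (at_right 0)"
proof -
  have "((\<lambda>h. exp (- (h * x)\<^sup>2)) \<longlongrightarrow> exp (- (0 * x)\<^sup>2)) (at_right 0)"
    by (intro tendsto_intros)
  then show ?thesis by (simp add: scaled_gauss_deriv_def gauss_deriv_0)
qed

lemma eventually_at_right_0_1: "eventually (\<lambda>h::real. 0 < h \<and> h \<le> 1) (at_right 0)"
  by (auto simp: eventually_at_right_field intro: exI[of _ 1])

lemma diffs_gauss_tendsto:
  "((\<lambda>h. diffs xs (scaled_gauss_deriv 0 h) x) \<longlongrightarrow> (if xs = [] then 1 else 0)) (at_right 0)"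
proof (induction xs arbitrary: x)
  case Nil
  then show ?case by (simp add: scaled_gauss_tendsto)
next
  case (Cons ab xs)
  obtain a b where "ab = (a, b)" by force
  then show ?case using tendsto_diff[OF Cons[of "x + a"] Cons[of "x + b"]]
    by (simp add: diffs_Cons del: diffs.simps)
qed

text \<open>
  Solving the recursion for \<^term>\<open>mchoose_sum (Suc d) z\<close> trades the sum for a sum of smaller
  index and a sum with one more difference operator; with more than \<open>d\<close> differences the sum is
  small in absolute value, which starts a downward induction on the number of differences.
\<close>

lemma mchoose_sum_gauss_tendsto:
  assumes z: "norm z = 1" "z \<noteq> 1"
  shows "((\<lambda>h. mchoose_sum d z (diffs (replicate j (1, 0)) (scaled_gauss_deriv 0 h)) x) \<longlongrightarrow>
           (if j = 0 then 1 / (1 - z) ^ d else 0)) (at_right 0)"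
proof (induction d arbitrary: j)
  case 0
  show ?case
    using tendsto_of_real[OF diffs_gauss_tendsto[of "replicate j (1, 0)" x], where 'a = complex]
    by (cases "j = 0") (simp_all add: mchoose_sum_0)
next
  case (Suc d)
  note damped = damped_diffs[OF damped_scaled_gauss_deriv]
  let ?f = "\<lambda>j h. mchoose_sum (Suc d) z (diffs (replicate j (1, 0)) (scaled_gauss_deriv 0 h)) x"
  have large: "(?f j \<longlongrightarrow> 0) (at_right 0)" if j: "Suc d < j" for j
  proof -
    obtain C where C: "C \<ge> 0" "\<And>h x. 0 < h \<Longrightarrow> h \<le> 1 \<Longrightarrow>
        \<bar>diffs (replicate j (1, 0)) (scaled_gauss_deriv 0 h) x\<bar> \<le> C * h ^ j * exp (- (h * x))"
      using diffs_scaled_gauss_bound[of "replicate j (1, 0)" 0] by auto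
    have bd: "norm (?f j h) \<le> C * exp (- (h * x)) * (h ^ j / (1 - exp (- h)) ^ Suc d)"
      if "0 < h" "h \<le> 1" for h
      using norm_mchoose_sum_le[OF that(1) _ C(2)[OF that], of z "Suc d" x] z
      by (simp add: mult_ac)
    have "((\<lambda>h. C * exp (- (h * x)) * (h ^ j / (1 - exp (- h)) ^ Suc d)) \<longlongrightarrow>
        C * exp (- (0 * x)) * 0) (at_right 0)"
      by (intro tendsto_intros power_div_one_minus_exp_tendsto_0 j)
    then have lim: "((\<lambda>h. C * exp (- (h * x)) * (h ^ j / (1 - exp (- h)) ^ Suc d)) \<longlongrightarrow> 0) (at_right 0)"
      by simp
    show ?thesis
    proof (rule Lim_null_comparison[OF _ lim])
      show "eventually (\<lambda>h. norm (?f j h) \<le> C * exp (- (h * x)) * (h ^ j / (1 - exp (- h)) ^ Suc d))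
          (at_right 0)"
        using eventually_at_right_0_1 by eventually_elim (use bd in blast)
    qed
  qed
  have down: "(?f j \<longlongrightarrow> (if j = 0 then 1 / (1 - z) ^ Suc d else 0)) (at_right 0)"
    if "(?f (Suc j) \<longlongrightarrow> 0) (at_right 0)" for j
  proof -
    have "((\<lambda>h. (mchoose_sum d z (diffs (replicate j (1, 0)) (scaled_gauss_deriv 0 h)) x + z * ?f (Suc j) h)
        / (1 - z)) \<longlongrightarrow> ((if j = 0 then 1 / (1 - z) ^ d else 0) + z * 0) / (1 - z)) (at_right 0)"
      using z by (intro tendsto_intros Suc that) auto
    moreover have "eventually (\<lambda>h. (mchoose_sum d z (diffs (replicate j (1, 0)) (scaled_gauss_deriv 0 h)) x
        + z * ?f (Suc j) h) / (1 - z) = ?f j h) (at_right 0)"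
      using eventually_at_right_0_1
    proof eventually_elim
      case (elim h)
      have "diffs [(1, 0)] (diffs (replicate j (1, 0)) (scaled_gauss_deriv 0 h)) =
          diffs (replicate (Suc j) (1, 0)) (scaled_gauss_deriv 0 h)"
        by (subst diffs_append[symmetric]) (simp add: replicate_append_same)
      then show ?case
        using mchoose_sum_Suc_diffs[of h z "diffs (replicate j (1, 0)) (scaled_gauss_deriv 0 h)" d x]
          elim damped z by (simp add: field_simps)
    qed
    ultimately have "(?f j \<longlongrightarrow> ((if j = 0 then 1 / (1 - z) ^ d else 0) + z * 0) / (1 - z)) (at_right 0)"
      by (rule Lim_transform_eventually)
    then show ?thesis by (simp add: mult.commute split: if_splits)
  qed
  have pos: "(?f j \<longlongrightarrow> 0) (at_right 0)" if "0 < j" for j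
  proof (cases "j \<le> Suc (Suc d)")
    case True
    then show ?thesis using that
    proof (induction rule: inc_induct)
      case base
      then show ?case by (intro large) auto
    next
      case (step k)
      then show ?case using down[of k] by auto
    qed
  qed (auto intro: large)
  show ?case
  proof (cases "j = 0")
    case True
    then show ?thesis using down[of 0, OF pos[of "Suc 0"]] by simp
  next
    case False
    then show ?thesis using pos by simp
  qed
qed

text \<open>Factoring (1 - y)^(2 - n) as (1 - y) (1 - y)^(-(n - 1)) leaves the index n - 1 >= 0 for
  \<open>mchoose\<close>, so that n = 1 and n = 2 with their special coefficients fall under the
  same formula as n >= 3.\<close>

lemma Phi_coeff_eq_mchoose:
  assumes "n \<ge> 1"
  shows "Phi_coeff n 0 = 1"
    and "Phi_coeff n (Suc m) = int (mchoose (n - 1) (Suc m)) - int (mchoose (n - 1) m)"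
proof -
  consider "n = 1" | "n = 2" | k where "n = k + 3"
    using assms by (metis One_nat_def Suc_1 add.commute le_Suc_ex not_less_eq_eq numeral_3_eq_3 le_antisym)
  note c = this
  show "Phi_coeff n 0 = 1" using c by cases (auto simp: Phi_coeff_def)
  show "Phi_coeff n (Suc m) = int (mchoose (n - 1) (Suc m)) - int (mchoose (n - 1) m)"
    using c
  proof cases
    case 3
    have "Phi_coeff n (Suc m) = int (mchoose (Suc k) (Suc m))"
      using 3 binomial_symmetric[of "Suc m" "Suc (m + k)"] by (simp add: Phi_coeff_def mchoose_def)
    then show ?thesis using 3 mchoose_Suc_Suc[of "Suc k" m] by (simp add: numeral_3_eq_3)
  qed (auto simp: Phi_coeff_def mchoose_def binomial_eq_0)
qed

definition Phi_sum :: "nat \<Rightarrow> complex \<Rightarrow> (real \<Rightarrow> real) \<Rightarrow> real \<Rightarrow> complex" where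
  "Phi_sum n z G x = (\<Sum>m. of_int (Phi_coeff n m) * z ^ m * of_real (G (x + real m)))"

lemma Phi_sum_sums:
  assumes "n \<ge> 1" "0 < h" "norm z \<le> 1" "damped h G"
  shows "(\<lambda>m. of_int (Phi_coeff n m) * z ^ m * of_real (G (x + real m))) sums
      (mchoose_sum (n - 1) z G x - z * mchoose_sum (n - 1) z G (x + 1))"
proof -
  define f where "f = (\<lambda>m. of_nat (mchoose (n - 1) m) * z ^ m * of_real (G (x + real m)) :: complex)"
  define f' where "f' = (\<lambda>m. of_nat (mchoose (n - 1) m) * z ^ m * of_real (G (x + 1 + real m)) :: complex)"
  have f: "f sums mchoose_sum (n - 1) z G x"
    unfolding f_def mchoose_sum_def
    by (intro summable_sums summable_mchoose_sum_damped[OF assms(2-4)])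
  have "f' sums mchoose_sum (n - 1) z G (x + 1)"
    unfolding f'_def mchoose_sum_def
    by (intro summable_sums summable_mchoose_sum_damped[OF assms(2-4)])
  then have "(\<lambda>m. f (Suc m) - z * f' m) sums
      (mchoose_sum (n - 1) z G x - f 0 - z * mchoose_sum (n - 1) z G (x + 1))"
    using f by (intro sums_diff sums_mult) (simp_all add: sums_Suc_iff)
  moreover have "f (Suc m) - z * f' m =
      of_int (Phi_coeff n (Suc m)) * z ^ Suc m * of_real (G (x + real (Suc m)))" for m
    by (simp add: f_def f'_def Phi_coeff_eq_mchoose(2)[OF assms(1)] algebra_simps)
  ultimately have "(\<lambda>m. of_int (Phi_coeff n (Suc m)) * z ^ Suc m * of_real (G (x + real (Suc m)))) sums
      (mchoose_sum (n - 1) z G x - f 0 - z * mchoose_sum (n - 1) z G (x + 1))" by simp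
  then show ?thesis
    by (subst (asm) sums_Suc_iff)
      (simp add: f_def Phi_coeff_eq_mchoose(1)[OF assms(1)] mchoose_Suc_0)
qed

text \<open>The limit is (1 - z)^(2 - n), kept as a quotient of natural powers so that n = 1 is
  covered.\<close>

lemma Phi_sum_gauss_tendsto:
  assumes "n \<ge> 1" "norm z = 1" "z \<noteq> 1"
  shows "((\<lambda>h. Phi_sum n z (scaled_gauss_deriv 0 h) x) \<longlongrightarrow> (1 - z) / (1 - z) ^ (n - 1)) (at_right 0)"
proof -
  let ?A = "\<lambda>x h. mchoose_sum (n - 1) z (scaled_gauss_deriv 0 h) x"
  have A: "(?A x \<longlongrightarrow> 1 / (1 - z) ^ (n - 1)) (at_right 0)" for x
    using mchoose_sum_gauss_tendsto[OF assms(2,3), of "n - 1" 0 x] by simp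
  have "((\<lambda>h. ?A x h - z * ?A (x + 1) h) \<longlongrightarrow> 1 / (1 - z) ^ (n - 1) - z * (1 / (1 - z) ^ (n - 1))) (at_right 0)"
    by (intro tendsto_intros A)
  then have lim: "((\<lambda>h. ?A x h - z * ?A (x + 1) h) \<longlongrightarrow> (1 - z) / (1 - z) ^ (n - 1)) (at_right 0)"
    by (simp add: diff_divide_distrib)
  show ?thesis
  proof (rule Lim_transform_eventually[OF lim])
    show "eventually (\<lambda>h. ?A x h - z * ?A (x + 1) h = Phi_sum n z (scaled_gauss_deriv 0 h) x) (at_right 0)"
      using eventually_at_right_0_1
    proof eventually_elim
      case (elim h)
      then show ?case unfolding Phi_sum_def
        using assms by (intro sums_unique Phi_sum_sums[of n h] damped_scaled_gauss_deriv) auto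
    qed
  qed
qed

text \<open>This moves the differences that come from the signs inside the summation over m, where
  they act on the Gaussian.\<close>

lemma mchoose_sum_diffs:
  assumes "0 < h" "norm z \<le> 1" "damped h G"
  shows "mchoose_sum d z (diffs xs G) x = diffs xs (mchoose_sum d z G) x"
  using assms(3)
proof (induction xs arbitrary: G x)
  case (Cons ab xs)
  obtain a b where ab: "ab = (a, b)" by force
  have "mchoose_sum d z (\<lambda>y. G (y + a) - G (y + b)) = (\<lambda>y. mchoose_sum d z G (y + a) - mchoose_sum d z G (y + b))"
    using mchoose_sum_diff[OF assms(1,2) damped_shift[OF Cons.prems, of a] damped_shift[OF Cons.prems, of b]]
    by (auto simp: mchoose_sum_shift)
  then show ?case using Cons.IH[of "\<lambda>y. G (y + a) - G (y + b)"] Cons.prems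
    by (simp add: ab damped_diff damped_shift)
qed simp

section \<open>Alternating sums over signs\<close>

lemma sum_signs_insert:
  assumes "i \<notin> A"
  shows "(\<Sum>\<epsilon>\<in>insert i A \<rightarrow>\<^sub>E {- 1, 1 :: int}. f \<epsilon>) =
    (\<Sum>\<epsilon>\<in>A \<rightarrow>\<^sub>E {- 1, 1}. f (\<epsilon>(i := 1)) + f (\<epsilon>(i := - 1)) :: 'a :: ab_group_add)"
proof -
  have "(\<Sum>\<epsilon>\<in>insert i A \<rightarrow>\<^sub>E {- 1, 1 :: int}. f \<epsilon>)
      = (\<Sum>(y, \<epsilon>)\<in>{- 1, 1} \<times> (A \<rightarrow>\<^sub>E {- 1, 1}). f (\<epsilon>(i := y)))"
    unfolding PiE_insert_eq
    by (subst sum.reindex[OF inj_combinator[OF assms]]) (simp add: case_prod_unfold)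
  also have "\<dots> = (\<Sum>y\<in>{- 1, 1}. \<Sum>\<epsilon>\<in>A \<rightarrow>\<^sub>E {- 1, 1}. f (\<epsilon>(i := y)))"
    by (simp add: sum.cartesian_product)
  finally show ?thesis by (simp add: sum.distrib add.commute)
qed

lemma sum_signs_Suc:
  "(\<Sum>\<epsilon>\<in>{1..Suc n} \<rightarrow>\<^sub>E {- 1, 1 :: int}. f (\<Prod>j = 1..Suc n. \<epsilon> j) (\<Sum>j = 1..Suc n. of_int (\<epsilon> j) * a j)) =
   (\<Sum>\<epsilon>\<in>{1..n} \<rightarrow>\<^sub>E {- 1, 1 :: int}.
     f (\<Prod>j = 1..n. \<epsilon> j) ((\<Sum>j = 1..n. of_int (\<epsilon> j) * a j) + a (Suc n)) +
     f (- (\<Prod>j = 1..n. \<epsilon> j)) ((\<Sum>j = 1..n. of_int (\<epsilon> j) * a j) - a (Suc n)) :: 'a :: ab_group_add)"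
  for a :: "nat \<Rightarrow> 'b :: comm_ring_1"
proof -
  have e: "{1..Suc n} = insert (Suc n) {1..n}" by auto
  have p: "(\<Prod>j = 1..n. (\<epsilon>(Suc n := y)) j) = (\<Prod>j = 1..n. \<epsilon> j)" for \<epsilon> and y :: int
    by (intro prod.cong) auto
  have s: "(\<Sum>j = 1..n. of_int ((\<epsilon>(Suc n := y)) j) * a j) = (\<Sum>j = 1..n. of_int (\<epsilon> j) * a j)"
    for \<epsilon> and y :: int
    by (intro sum.cong) auto
  show ?thesis unfolding e
    by (subst sum_signs_insert) (simp_all add: p s add.commute del: fun_upd_apply, simp add: add.commute)
qed

text \<open>With E^a for the shift by a, expanding the product of the operators E^(a j) - E^(- a j)
  gives one term for each choice of signs, weighted by the product of the signs.\<close>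

lemma sum_signs_diffs:
  "(\<Sum>\<epsilon>\<in>{1..n} \<rightarrow>\<^sub>E {- 1, 1 :: int}.
      of_int (\<Prod>j = 1..n. \<epsilon> j) * F (x + (\<Sum>j = 1..n. of_int (\<epsilon> j) * a j))) =
    diffs (map (\<lambda>j. (a j, - a j)) [1..<Suc n]) F x"
proof (induction n arbitrary: x)
  case 0
  show ?case by simp
next
  case (Suc n)
  let ?s = "\<lambda>x. \<Sum>\<epsilon>\<in>{1..n} \<rightarrow>\<^sub>E {- 1, 1 :: int}.
      of_int (\<Prod>j = 1..n. \<epsilon> j) * F (x + (\<Sum>j = 1..n. of_int (\<epsilon> j) * a j))"
  have e: "[1..<Suc (Suc n)] = [1..<Suc n] @ [Suc n]" by simp
  have c: "x + (s + t) = x + t + s" "x + (s - t) = x - t + s" for s t :: real by simp_all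
  have "(\<Sum>\<epsilon>\<in>{1..Suc n} \<rightarrow>\<^sub>E {- 1, 1 :: int}.
      of_int (\<Prod>j = 1..Suc n. \<epsilon> j) * F (x + (\<Sum>j = 1..Suc n. of_int (\<epsilon> j) * a j)))
      = ?s (x + a (Suc n)) - ?s (x - a (Suc n))"
    unfolding sum_signs_Suc[where f = "\<lambda>u v. of_int u * F (x + v)"] c
    by (simp only: sum.distrib of_int_minus mult_minus_left sum_negf add_uminus_conv_diff sum_subtractf)
  then show ?case unfolding Suc e diffs_append list.map map_append by simp
qed

text \<open>
  The \<open>n\<close> differences coming from the signs, together with the one contained in the
  coefficients, turn the Gaussian into a multiple of its \<open>(n+1)\<close>-st derivative up to a smaller
  error. The same derivative is the leading term of \<open>n - 1\<close> unit differences of the second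
  derivative, and these cancel the summation exactly.
\<close>

lemma signed_Phi_sum_1_asymp:
  assumes n: "n \<ge> 1"
  shows "((\<lambda>h. (\<Sum>\<epsilon>\<in>{1..n} \<rightarrow>\<^sub>E {- 1, 1 :: int}. of_int (\<Prod>j = 1..n. \<epsilon> j) *
            Phi_sum n 1 (scaled_gauss_deriv 0 h) (x + (\<Sum>j = 1..n. of_int (\<epsilon> j) * a j))) / of_real (h\<^sup>2))
          \<longlongrightarrow> of_real (- 2 * (- 1) ^ n * (\<Prod>j = 1..n. 2 * a j))) (at_right 0)"
    (is "((\<lambda>h. ?W h / _) \<longlongrightarrow> _) _")
proof -
  define ops where "ops = map (\<lambda>j. (a j, - a j)) [1..<Suc n]"
  define D where "D = (\<Prod>j = 1..n. 2 * a j)"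
  define H where "H = (\<lambda>h. diffs ((1, 0) # ops) (scaled_gauss_deriv 0 h))"
  define M where "M = (\<lambda>h. diffs (replicate (n - 1) (1, 0)) (scaled_gauss_deriv 2 h))"
  have D: "(\<Prod>(a, b)\<leftarrow>(1, 0) # ops. a - b) = D"
  proof -
    have "(\<Prod>(a, b)\<leftarrow>ops. a - b) = (\<Prod>j\<leftarrow>[1..<Suc n]. 2 * a j)"
      unfolding ops_def map_map by (intro arg_cong[of _ _ prod_list] map_cong) auto
    also have "\<dots> = D" unfolding D_def
      by (simp add: prod.distinct_set_conv_list atLeastLessThanSuc_atLeastAtMost del: upt_Suc
          flip: prod.distinct_set_conv_list)
    finally show ?thesis by simp
  qed
  have W: "?W h = - mchoose_sum (n - 1) 1 (H h) x" if h: "0 < h" for h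
  proof -
    define G where "G = diffs [(1, 0)] (scaled_gauss_deriv 0 h)"
    note damped = damped_scaled_gauss_deriv[of h 0]
    have "Phi_sum n 1 (scaled_gauss_deriv 0 h) y = - mchoose_sum (n - 1) 1 G y" for y
      using sums_unique[OF Phi_sum_sums[OF n h _ damped, of 1 y]] h
        mchoose_sum_diffs[OF h _ damped, of 1 "n - 1" "[(1, 0)]" y]
      by (simp add: Phi_sum_def G_def del: diffs.simps) (simp add: diffs_Cons)
    then have "?W h = - diffs ops (mchoose_sum (n - 1) 1 G) x"
      unfolding ops_def sum_signs_diffs[symmetric] by (simp add: sum_negf)
    also have "diffs ops (mchoose_sum (n - 1) 1 G) x = mchoose_sum (n - 1) 1 (diffs ops G) x"
      unfolding G_def using h
      by (intro mchoose_sum_diffs[symmetric, of h] damped_diffs damped) auto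
    also have "diffs ops G = H h" by (simp add: H_def G_def)
    finally show ?thesis .
  qed
  obtain C1 where C1: "C1 \<ge> 0" "\<And>h x. 0 < h \<Longrightarrow> h \<le> 1 \<Longrightarrow>
      \<bar>H h x - D * scaled_gauss_deriv (Suc n) h x\<bar> \<le> C1 * h ^ Suc (Suc n) * exp (- (h * x))"
    using diffs_scaled_gauss_asymp[of "(1, 0) # ops" 0] unfolding D H_def
    by (auto simp: ops_def simp del: diffs.simps upt_Suc)
  obtain C2 where C2: "C2 \<ge> 0" "\<And>h x. 0 < h \<Longrightarrow> h \<le> 1 \<Longrightarrow>
      \<bar>M h x - scaled_gauss_deriv (Suc n) h x\<bar> \<le> C2 * h ^ Suc (Suc n) * exp (- (h * x))"
    using diffs_scaled_gauss_asymp[of "replicate (n - 1) (1, 0)" 2] n unfolding M_def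
    by (auto simp del: diffs.simps simp: Suc_diff_Suc)
  define C where "C = C1 + \<bar>D\<bar> * C2"
  have E: "\<bar>H h y - D * M h y\<bar> \<le> (C * h ^ Suc (Suc n)) * exp (- (h * y))" if h: "0 < h" "h \<le> 1" for h y
  proof -
    define u v where "u = H h y - D * scaled_gauss_deriv (Suc n) h y"
      and "v = M h y - scaled_gauss_deriv (Suc n) h y"
    have "\<bar>D * v\<bar> \<le> \<bar>D\<bar> * (C2 * h ^ Suc (Suc n) * exp (- (h * y)))"
      unfolding abs_mult v_def by (intro mult_left_mono C2(2) h) auto
    moreover have "H h y - D * M h y = u - D * v" by (simp add: u_def v_def algebra_simps)
    moreover have "\<bar>u\<bar> \<le> C1 * h ^ Suc (Suc n) * exp (- (h * y))" unfolding u_def by (intro C1(2) h)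
    ultimately have "\<bar>H h y - D * M h y\<bar> \<le> C1 * h ^ Suc (Suc n) * exp (- (h * y))
        + \<bar>D\<bar> * (C2 * h ^ Suc (Suc n) * exp (- (h * y)))"
      using abs_triangle_ineq4[of u "D * v"] by linarith
    then show ?thesis by (simp add: C_def algebra_simps)
  qed
  \<comment> \<open>The error of order \<open>h ^ (n + 2)\<close> loses n - 1 powers of h to the
    summation and two to the division by \<open>h\<^sup>2\<close>; one power is left, and it sends
    the bound to 0.\<close>
  have main: "norm (?W h / of_real (h\<^sup>2) - of_real ((- 1) ^ n * D * gauss_deriv 2 (h * x)))
      \<le> C * exp (- (h * x)) * (h ^ n / (1 - exp (- h)) ^ (n - 1))" if h: "0 < h" "h \<le> 1" for h
  proof -
    have dH: "damped h (H h)" unfolding H_def using h by (intro damped_diffs damped_scaled_gauss_deriv) auto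
    have dS: "damped h (scaled_gauss_deriv 2 h)" using h by (intro damped_scaled_gauss_deriv) auto
    have dM: "damped h (M h)" unfolding M_def by (intro damped_diffs dS)
    have "mchoose_sum (n - 1) 1 (\<lambda>y. D * M h y) x =
        mchoose_sum (n - 1) 1 (diffs (replicate (n - 1) (1, 0)) (\<lambda>y. D * scaled_gauss_deriv 2 h y)) x"
      by (intro arg_cong[of _ _ "\<lambda>G. mchoose_sum (n - 1) 1 G x"]) (simp add: fun_eq_iff M_def diffs_cmult)
    also have "\<dots> = (- 1) ^ (n - 1) * of_real (D * scaled_gauss_deriv 2 h x)"
      by (rule mchoose_sum_1_diffs[OF h(1) damped_cmult[OF dS]])
    also have "\<dots> = - of_real ((- 1) ^ n * D * gauss_deriv 2 (h * x)) * of_real (h\<^sup>2)"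
      using n by (cases n) (auto simp: scaled_gauss_deriv_def)
    finally have "mchoose_sum (n - 1) 1 (\<lambda>y. H h y - D * M h y) x
        = mchoose_sum (n - 1) 1 (H h) x + of_real ((- 1) ^ n * D * gauss_deriv 2 (h * x)) * of_real (h\<^sup>2)"
      by (simp add: mchoose_sum_diff[OF h(1) _ dH damped_cmult[OF dM]])
    then have "?W h = - mchoose_sum (n - 1) 1 (\<lambda>y. H h y - D * M h y) x
        + of_real ((- 1) ^ n * D * gauss_deriv 2 (h * x)) * of_real (h\<^sup>2)"
      unfolding W[OF h(1)] by simp
    then have "?W h / of_real (h\<^sup>2) - of_real ((- 1) ^ n * D * gauss_deriv 2 (h * x)) =
        - mchoose_sum (n - 1) 1 (\<lambda>y. H h y - D * M h y) x / of_real (h\<^sup>2)"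
      using h by (simp only: add_divide_distrib) simp
    also have "norm \<dots> \<le> (C * h ^ Suc (Suc n)) * exp (- (h * x)) / (1 - exp (- h)) ^ (n - 1) / h\<^sup>2"
      using norm_mchoose_sum_le[OF h(1) _ E[OF h], of 1 "n - 1" x]
      unfolding norm_divide norm_minus_cancel norm_of_real abs_power2
      by (intro divide_right_mono) auto
    also have "\<dots> = C * exp (- (h * x)) * (h ^ n / (1 - exp (- h)) ^ (n - 1))"
      using h by (simp add: power2_eq_square field_simps)
    finally show ?thesis .
  qed
  have "((\<lambda>h. ?W h / of_real (h\<^sup>2) - of_real ((- 1) ^ n * D * gauss_deriv 2 (h * x))) \<longlongrightarrow> 0) (at_right 0)"
  proof (rule Lim_null_comparison)
    show "eventually (\<lambda>h. norm (?W h / of_real (h\<^sup>2) - of_real ((- 1) ^ n * D * gauss_deriv 2 (h * x)))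
      \<le> C * exp (- (h * x)) * (h ^ n / (1 - exp (- h)) ^ (n - 1))) (at_right 0)"
      using eventually_at_right_0_1 by eventually_elim (use main in auto)
    have "((\<lambda>h. C * exp (- (h * x)) * (h ^ n / (1 - exp (- h)) ^ (n - 1))) \<longlongrightarrow>
        C * exp (- (0 * x)) * 0) (at_right 0)"
      using n by (intro tendsto_intros power_div_one_minus_exp_tendsto_0) auto
    then show "((\<lambda>h. C * exp (- (h * x)) * (h ^ n / (1 - exp (- h)) ^ (n - 1))) \<longlongrightarrow> 0) (at_right 0)"
      by simp
  qed
  moreover have "((\<lambda>h. of_real ((- 1) ^ n * D * gauss_deriv 2 (h * x)) :: complex) \<longlongrightarrow>
      of_real ((- 1) ^ n * D * gauss_deriv 2 (0 * x))) (at_right 0)"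
    by (intro tendsto_intros isCont_tendsto_compose[OF DERIV_isCont[OF has_real_derivative_gauss_deriv]])
  ultimately have "((\<lambda>h. ?W h / of_real (h\<^sup>2)) \<longlongrightarrow> 0 + of_real ((- 1) ^ n * D * gauss_deriv 2 (0 * x))) (at_right 0)"
    using tendsto_add by fastforce
  then show ?thesis by (simp add: gauss_deriv_2_at_0 D_def mult_ac)
qed

section \<open>Quadratic Gauss sums of even modulus\<close>

lemma sin_ge_half:
  fixes x \<delta> :: real
  assumes "0 < \<delta>" "\<delta> \<le> 1" "\<delta> \<le> x" "x \<le> pi - \<delta>"
  shows "\<delta> / 2 \<le> sin x"
proof -
  have "\<bar>sin \<delta> - \<delta>\<bar> \<le> \<delta> ^ 3 / 6"
    using Maclaurin_sin_bound[of \<delta> 3] assms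
    by (simp add: eval_nat_numeral sin_coeff_def lessThan_Suc field_simps)
  moreover have "\<delta> ^ 3 \<le> \<delta>" using assms power_decreasing[of 1 3 \<delta>] by simp
  ultimately have "\<delta> / 2 \<le> sin \<delta>" using assms by linarith
  also have "sin \<delta> \<le> sin x"
  proof (cases "x \<le> pi / 2")
    case True
    then show ?thesis using assms by (intro sin_monotone_2pi_le) auto
  next
    case False
    then have "sin \<delta> \<le> sin (pi - x)" using assms by (intro sin_monotone_2pi_le) auto
    then show ?thesis by simp
  qed
  finally show ?thesis .
qed

text \<open>The inverse of cis (2 x) - 1 has the constant real part - 1 / 2. Hence only the
  cotangent varies in the summation by parts of \<open>norm_sum_cis_le\<close>, and the same formula
  produces the cotangents of the Dedekind sum in \<open>sawtooth_dft_eq_cot\<close>.\<close>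

lemma inverse_cis_minus_1:
  assumes "sin x \<noteq> 0"
  shows "(cis (2 * x) - 1) * (- 1 / 2 - \<i> / 2 * cot x) = 1"
proof -
  define c s where "c = complex_of_real (cos x)" and "s = complex_of_real (sin x)"
  have cs: "c * c + s * s = 1"
    unfolding c_def s_def of_real_mult[symmetric] of_real_add[symmetric] by simp
  have "cis (2 * x) - 1 = 2 * \<i> * s * (c + \<i> * s)"
    by (simp add: complex_eq_iff cos_double_sin sin_double power2_eq_square c_def s_def)
  moreover have s0: "s \<noteq> 0" using assms by (simp add: s_def)
  moreover have "- 1 / 2 - \<i> / 2 * cot x = - (s + \<i> * c) / (2 * s)"
    using assms by (simp add: cot_def c_def s_def field_simps)
  ultimately have "(cis (2 * x) - 1) * (- 1 / 2 - \<i> / 2 * cot x) = - \<i> * ((c + \<i> * s) * (s + \<i> * c))"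
    by (simp only:) (simp add: field_simps)
  also have "(c + \<i> * s) * (s + \<i> * c) = \<i> * (c * c + s * s)" by (simp add: algebra_simps)
  finally show ?thesis by (simp add: cs)
qed

lemma cot_antimono:
  fixes a b :: real
  assumes "0 < a" "a \<le> b" "b < pi"
  shows "cot b \<le> cot a"
proof -
  have s: "sin a > 0" "sin b > 0" using assms by (auto intro: sin_gt_zero)
  have "0 \<le> sin (b - a)" using assms by (intro sin_ge_zero) auto
  then have "cos b * sin a \<le> cos a * sin b" by (simp add: sin_diff mult.commute)
  then show ?thesis using s by (simp add: cot_def field_simps)
qed

text \<open>
  Summation by parts, as in the Kusmin-Landau inequality: a term is the difference
  of two consecutive terms times \<open>1 / (cis (2 * x) - 1)\<close>, whose variation telescopes.
\<close>

lemma norm_sum_cis_le: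
  fixes \<phi> :: "nat \<Rightarrow> real"
  defines "x \<equiv> \<lambda>k. (\<phi> (Suc k) - \<phi> k) / 2"
  assumes "Y \<le> Z" and \<delta>: "0 < \<delta>" "\<delta> \<le> 1"
    and bounds: "\<And>k. Y \<le> k \<Longrightarrow> k \<le> Z \<Longrightarrow> \<delta> \<le> x k \<and> x k \<le> pi - \<delta>"
    and mono: "\<And>k. Y \<le> k \<Longrightarrow> k < Z \<Longrightarrow> x k \<le> x (Suc k)"
  shows "norm (\<Sum>k = Y..<Z. cis (\<phi> k)) \<le> 1 + 4 / \<delta>"
proof -
  define r where "r = (\<lambda>k. - 1 / 2 - \<i> / 2 * complex_of_real (cot (x k)))"
  have "(\<Sum>k = Y..<Z. cis (\<phi> k)) =
      cis (\<phi> Z) * r Z - cis (\<phi> Y) * r Y + (\<Sum>k = Y..<Z. cis (\<phi> (Suc k)) * (r k - r (Suc k)))"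
    using \<open>Y \<le> Z\<close> bounds
  proof (induction Z rule: dec_induct)
    case (step Z)
    have "sin (x Z) \<ge> \<delta> / 2" using step.prems[of Z] step.hyps \<delta> by (intro sin_ge_half) auto
    then have "sin (x Z) \<noteq> 0" using \<delta> by auto
    from inverse_cis_minus_1[OF this] have "cis (\<phi> Z) = cis (\<phi> Z) * ((cis (2 * x Z) - 1) * r Z)"
      by (simp add: r_def cot_of_real)
    also have "\<dots> = cis (\<phi> Z + 2 * x Z) * r Z - cis (\<phi> Z) * r Z"
      by (simp add: algebra_simps flip: cis_mult)
    also have "\<phi> Z + 2 * x Z = \<phi> (Suc Z)" by (simp add: x_def field_simps)
    finally have "cis (\<phi> Z) = cis (\<phi> (Suc Z)) * r Z - cis (\<phi> Z) * r Z" .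
    then show ?case using step by (simp add: algebra_simps)
  qed auto
  also have "norm \<dots> \<le> norm (r Z) + norm (r Y) + (\<Sum>k = Y..<Z. norm (r k - r (Suc k)))"
  proof -
    have "norm (cis (\<phi> Z) * r Z - cis (\<phi> Y) * r Y + (\<Sum>k = Y..<Z. cis (\<phi> (Suc k)) * (r k - r (Suc k))))
        \<le> norm (cis (\<phi> Z) * r Z) + norm (cis (\<phi> Y) * r Y)
          + norm (\<Sum>k = Y..<Z. cis (\<phi> (Suc k)) * (r k - r (Suc k)))"
      by (intro norm_triangle_mono norm_triangle_ineq4 order_refl)
    also have "norm (\<Sum>k = Y..<Z. cis (\<phi> (Suc k)) * (r k - r (Suc k)))
        \<le> (\<Sum>k = Y..<Z. norm (cis (\<phi> (Suc k)) * (r k - r (Suc k))))" by (rule norm_sum)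
    finally show ?thesis by (simp add: norm_mult)
  qed
  also have "(\<Sum>k = Y..<Z. norm (r k - r (Suc k))) = (\<Sum>k = Y..<Z. (cot (x k) - cot (x (Suc k))) / 2)"
  proof (intro sum.cong refl)
    fix k assume k: "k \<in> {Y..<Z}"
    have "cot (x (Suc k)) \<le> cot (x k)"
      using k bounds[of k] bounds[of "Suc k"] mono[of k] \<delta> by (intro cot_antimono) auto
    moreover have "r k - r (Suc k) = - \<i> / 2 * complex_of_real (cot (x k) - cot (x (Suc k)))"
      by (simp add: r_def algebra_simps)
    ultimately show "norm (r k - r (Suc k)) = (cot (x k) - cot (x (Suc k))) / 2"
      by (simp only: norm_mult norm_of_real) (simp add: norm_divide)
  qed
  also have "\<dots> = (cot (x Y) - cot (x Z)) / 2"
    using sum_Suc_diff'[OF \<open>Y \<le> Z\<close>, of "\<lambda>k. - cot (x k) / 2"] by (simp add: field_simps)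
  finally have *: "norm (\<Sum>k = Y..<Z. cis (\<phi> k)) \<le> norm (r Z) + norm (r Y) + (cot (x Y) - cot (x Z)) / 2" .
  have c: "\<bar>cot (x k)\<bar> \<le> 2 / \<delta>" if "Y \<le> k" "k \<le> Z" for k
  proof -
    have s: "sin (x k) \<ge> \<delta> / 2" using bounds[OF that] \<delta> by (intro sin_ge_half) auto
    then have "\<bar>cot (x k)\<bar> \<le> 1 / sin (x k)"
      using \<delta> abs_cos_le_one[of "x k"] by (auto simp: cot_def abs_mult divide_right_mono)
    also have "\<dots> \<le> 1 / (\<delta> / 2)" using s \<delta> by (intro divide_left_mono) auto
    finally show ?thesis by simp
  qed
  have r: "norm (r k) \<le> 1 / 2 + 1 / \<delta>" if "Y \<le> k" "k \<le> Z" for k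
  proof -
    have "norm (r k) \<le> norm (- 1 / 2 :: complex) + norm (\<i> / 2 * complex_of_real (cot (x k)))"
      unfolding r_def by (rule norm_triangle_ineq4)
    then show ?thesis using c[OF that] by (simp add: norm_mult norm_divide)
  qed
  show ?thesis using * r[of Y] r[of Z] c[of Y] c[of Z] \<open>Y \<le> Z\<close> by (simp add: field_simps)
qed

section \<open>Gauss sums and multiplication of the modulus by a square\<close>

definition gauss_sum :: "nat \<Rightarrow> complex" where
  "gauss_sum M = (\<Sum>k<M. cis (pi * (real k)\<^sup>2 / real M))"

lemma cis_add_2pi_nat: "cis (x + 2 * pi * real n) = cis x"
  by (simp flip: cis_mult)

lemma sum_lessThan_product:
  "(\<Sum>k<a * b. f k) = (\<Sum>i<a. \<Sum>j<b. f (i + a * j) :: 'a :: comm_monoid_add)"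
  for a b :: nat
proof (cases "a = 0")
  case False
  have "(\<Sum>i<a. \<Sum>j<b. f (i + a * j)) = (\<Sum>(i, j)\<in>{..<a} \<times> {..<b}. f (i + a * j))"
    by (rule sum.cartesian_product)
  also have "\<dots> = (\<Sum>k<a * b. f k)"
  proof (rule sum.reindex_bij_witness[of _ "\<lambda>k. (k mod a, k div a)" "\<lambda>(i, j). i + a * j"])
    fix k assume "k \<in> {..<a * b}"
    then show "(k mod a, k div a) \<in> {..<a} \<times> {..<b}"
      using False by (auto simp: less_mult_imp_div_less mult.commute)
  next
    fix p assume p: "p \<in> {..<a} \<times> {..<b}"
    obtain i j where ij: "p = (i, j)" "i < a" "j < b" using p by auto
    have "i + a * j < a * Suc j" using ij by simp
    also have "a * Suc j \<le> a * b" using ij by (intro mult_le_mono2) auto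
    finally show "(case p of (i, j) \<Rightarrow> i + a * j) \<in> {..<a * b}" using ij by simp
  qed (use False in auto)
  finally show ?thesis ..
qed simp

lemma cis_2pi_int: "cis (2 * pi * of_int m) = 1"
  by (simp add: cis_multiple_2pi)

lemma sum_cis_int_multiples:
  assumes "k > 0"
  shows "(\<Sum>r<k. cis (2 * pi * of_int l * real r / real k)) = (if int k dvd l then of_nat k else 0)"
proof (cases "int k dvd l")
  case True
  then obtain m where "l = int k * m" by auto
  then have "2 * pi * of_int l * real r / real k = 2 * pi * of_int (m * int r)" for r
    using assms by (simp add: field_simps)
  then show ?thesis using True by (simp only: cis_2pi_int) simp
next
  case False
  define w where "w = cis (2 * pi * of_int l / real k)"
  have "w \<noteq> 1"
  proof
    assume "w = 1"
    then have "cos (2 * pi * of_int l / real k) = 1" by (simp add: w_def complex_eq_iff)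
    then obtain n :: int where "2 * pi * of_int l / real k = real_of_int n * 2 * pi"
      using cos_one_2pi_int by blast
    then have "real_of_int l = real_of_int n * real k" using assms by (simp add: field_simps)
    then have "l = n * int k" by (metis of_int_eq_iff of_int_mult of_int_of_nat_eq)
    with False show False by simp
  qed
  moreover have "w ^ k = 1"
  proof -
    have "w ^ k = cis (real k * (2 * pi * of_int l / real k))" unfolding w_def by (rule Complex.DeMoivre)
    also have "real k * (2 * pi * of_int l / real k) = 2 * pi * of_int l" using assms by simp
    finally show ?thesis by (simp only: cis_2pi_int)
  qed
  ultimately have "(\<Sum>r<k. w ^ r) = 0" by (simp add: geometric_sum)
  then show ?thesis using False by (simp add: w_def Complex.DeMoivre mult_ac)
qed

lemma sum_cis_multiples:
  fixes j :: nat assumes "T > 0"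
  shows "(\<Sum>s<T. cis (2 * pi * real j * real s / real T)) = (if T dvd j then of_nat T else 0)"
  using sum_cis_int_multiples[OF assms, of "int j"] by (simp add: int_dvd_int_iff)

text \<open>For k = i + M * T * s the phase is linear in s up to multiples of 2 pi, because M is
  even. The sum over s therefore vanishes unless T divides i, and the terms i = T * j form the Gauss
  sum of modulus M.\<close>

lemma gauss_sum_mult_square:
  assumes "even M" "M > 0" "T > 0"
  shows "gauss_sum (M * T\<^sup>2) = of_nat T * gauss_sum M"
proof -
  obtain m where m: "M = 2 * m" using assms by auto
  have eq: "cis (pi * (real (i + M * T * s))\<^sup>2 / real (M * T\<^sup>2)) =
      cis (pi * (real i)\<^sup>2 / real (M * T\<^sup>2)) * cis (2 * pi * real i * real s / real T)" for i s
  proof -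
    have "pi * (real (i + M * T * s))\<^sup>2 / real (M * T\<^sup>2) =
        (pi * (real i)\<^sup>2 / real (M * T\<^sup>2) + 2 * pi * real i * real s / real T) + 2 * pi * real (m * s\<^sup>2)"
      using assms by (simp add: m power2_eq_square field_simps)
    then show ?thesis by (simp only: cis_add_2pi_nat cis_mult)
  qed
  have "gauss_sum (M * T\<^sup>2) = (\<Sum>k<M * T * T. cis (pi * (real k)\<^sup>2 / real (M * T\<^sup>2)))"
    by (simp add: gauss_sum_def power2_eq_square mult.assoc)
  also have "\<dots> = (\<Sum>i<M * T. cis (pi * (real i)\<^sup>2 / real (M * T\<^sup>2)) * (if T dvd i then of_nat T else 0))"
    unfolding sum_lessThan_product eq sum_distrib_left[symmetric] sum_cis_multiples[OF assms(3)] ..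
  also have "\<dots> = (\<Sum>i<T * M. if T dvd i then cis (pi * (real i)\<^sup>2 / real (M * T\<^sup>2)) * of_nat T else 0)"
    by (intro sum.cong) (auto simp: mult.commute)
  also have "\<dots> = (\<Sum>j<M. cis (pi * (real (T * j))\<^sup>2 / real (M * T\<^sup>2)) * of_nat T)"
  proof -
    have "(\<Sum>i<T. if T dvd i + T * j then cis (pi * (real (i + T * j))\<^sup>2 / real (M * T\<^sup>2)) * of_nat T else 0)
      = cis (pi * (real (T * j))\<^sup>2 / real (M * T\<^sup>2)) * of_nat T" for j
    proof -
      have "(\<Sum>i<T. if T dvd i + T * j then cis (pi * (real (i + T * j))\<^sup>2 / real (M * T\<^sup>2)) * of_nat T else 0)
        = (\<Sum>i<T. if i = 0 then cis (pi * (real (T * j))\<^sup>2 / real (M * T\<^sup>2)) * of_nat T else 0)"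
        by (intro sum.cong refl) (auto simp: dvd_add_left_iff dest: dvd_imp_le)
      then show ?thesis using assms by simp
    qed
    then show ?thesis unfolding sum_lessThan_product by (subst sum.swap) simp
  qed
  also have "\<dots> = of_nat T * gauss_sum M"
    unfolding gauss_sum_def sum_distrib_left
    using assms by (intro sum.cong refl) (auto simp: power_mult_distrib field_simps)
  finally show ?thesis .
qed


section \<open>Comparison with the Fresnel integral\<close>

lemma norm_cis_diff_le: "norm (cis a - cis b) \<le> \<bar>a - b\<bar>"
proof -
  have "cis a - cis b = cis b * (exp (\<i> * of_real (a - b)) - 1)"
    by (simp add: right_diff_distrib cis_mult flip: cis_conv_exp of_real_diff)
  then have "norm (cis a - cis b) = 2 * \<bar>sin ((a - b) / 2)\<bar>"
    by (simp only: norm_mult norm_cis dist_exp_i_1 mult_1)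
  then show ?thesis using abs_sin_x_le_abs_x[of "(a - b) / 2"] by simp
qed

text \<open>On each of the Y cells of width 1 / s the phase pi y^2 varies by at most 2 pi Y / s^2,
  so a cell contributes at most 2 pi Y / s^3 to the error.\<close>

lemma norm_fresnel_riemann_sum_le:
  assumes "s > 0"
  shows "norm ((\<Sum>k<Y. cis (pi * (real k / s)\<^sup>2)) / of_real s - integral {0..real Y / s} (\<lambda>y. cis (pi * y\<^sup>2)))
     \<le> 2 * pi * (real Y)\<^sup>2 / s ^ 3"
proof -
  let ?f = "\<lambda>y. cis (pi * y\<^sup>2)"
  have int: "?f integrable_on {a..b}" for a b
    by (intro integrable_continuous_interval continuous_intros)
  have "norm ((\<Sum>k<Z. ?f (real k / s)) / of_real s - integral {0..real Z / s} ?f)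
     \<le> real Z * (2 * pi * real Y / s ^ 3)" if "Z \<le> Y" for Z
    using that
  proof (induction Z)
    case (Suc Z)
    let ?a = "real Z / s" and ?b = "real (Suc Z) / s"
    have ab: "0 \<le> ?a" "?a \<le> ?b" "?b - ?a = 1 / s" using assms by (auto simp: field_simps)
    have split: "integral {0..?b} ?f = integral {0..?a} ?f + integral {?a..?b} ?f"
      by (rule Henstock_Kurzweil_Integration.integral_combine[OF ab(1,2) int, symmetric])
    have "norm (integral (cbox ?a ?b) (\<lambda>y. ?f ?a - ?f y)) \<le> (2 * pi * real Y / s ^ 2) * measure lborel (cbox ?a ?b)"
    proof (rule integrable_bound)
      show "0 \<le> 2 * pi * real Y / s ^ 2" using assms by simp
      show "(\<lambda>y. ?f ?a - ?f y) integrable_on cbox ?a ?b"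
        by (intro integrable_diff) (auto simp: int)
      fix y assume y: "y \<in> cbox ?a ?b"
      have "norm (?f ?a - ?f y) \<le> \<bar>pi * ?a\<^sup>2 - pi * y\<^sup>2\<bar>" by (rule norm_cis_diff_le)
      also have "\<dots> = pi * ((y - ?a) * (y + ?a))"
      proof -
        have "0 \<le> pi * ((y - ?a) * (y + ?a))" using y ab by simp
        moreover have "pi * ?a\<^sup>2 - pi * y\<^sup>2 = - (pi * ((y - ?a) * (y + ?a)))"
          by (simp only: power2_eq_square algebra_simps)
        ultimately show ?thesis by linarith
      qed
      also have "\<dots> \<le> pi * ((1 / s) * (real Y / s + real Y / s))"
      proof -
        have "?b \<le> real Y / s" and "?a \<le> real Y / s" using Suc.prems assms by (auto intro!: divide_right_mono)
        moreover have "0 \<le> y" using y ab by auto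
        ultimately show ?thesis using y ab assms by (intro mult_left_mono mult_mono add_mono) auto
      qed
      finally show "norm (?f ?a - ?f y) \<le> 2 * pi * real Y / s ^ 2"
        by (simp add: power2_eq_square field_simps)
    qed
    also have "\<dots> = 2 * pi * real Y / s ^ 3" using ab assms by (simp add: power2_eq_square power3_eq_cube)
    also have "integral (cbox ?a ?b) (\<lambda>y. ?f ?a - ?f y) = ?f ?a / of_real s - integral {?a..?b} ?f"
      using ab by (subst integral_diff) (auto simp: int scaleR_conv_of_real field_simps)
    finally have step: "norm (?f ?a / of_real s - integral {?a..?b} ?f) \<le> 2 * pi * real Y / s ^ 3" .
    have "(\<Sum>k<Suc Z. ?f (real k / s)) / of_real s - integral {0..?b} ?f =
      ((\<Sum>k<Z. ?f (real k / s)) / of_real s - integral {0..?a} ?f) + (?f ?a / of_real s - integral {?a..?b} ?f)"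
      unfolding split by (simp add: add_divide_distrib del: of_nat_Suc)
    also have "norm \<dots> \<le> real Z * (2 * pi * real Y / s ^ 3) + 2 * pi * real Y / s ^ 3"
      using Suc step by (intro norm_triangle_mono) auto
    finally show ?case by (simp add: algebra_simps add_divide_distrib)
  qed simp
  from this[of Y] show ?thesis by (simp add: power2_eq_square mult_ac)
qed

text \<open>The reflection of k to c - k preserves the terms because c is even, so the two ends of
  the range have equal sums. The end k = 0 has no mirror image below c, whence the - 1; the index c
  - Y belongs neither to the middle range nor to the reflected end.\<close>

lemma gauss_sum_split:
  assumes "even c" "0 < Y" "2 * Y \<le> c"
  shows "gauss_sum c = 2 * (\<Sum>k<Y. cis (pi * (real k)\<^sup>2 / real c)) - 1
    + (\<Sum>k = Y..<c - Y. cis (pi * (real k)\<^sup>2 / real c)) + cis (pi * (real (c - Y))\<^sup>2 / real c)"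
proof -
  let ?f = "\<lambda>k::nat. cis (pi * (real k)\<^sup>2 / real c)"
  obtain m where m: "c = 2 * m" using assms by auto
  have sym: "?f (c - k) = ?f k" if "k \<le> c" for k
  proof -
    have "pi * (real (c - k))\<^sup>2 / real c + 2 * pi * real k = pi * (real k)\<^sup>2 / real c + 2 * pi * real m"
      using that assms by (simp add: of_nat_diff m power2_eq_square field_simps)
    then show ?thesis by (metis cis_add_2pi_nat)
  qed
  have "gauss_sum c = sum ?f ({..<Y} \<union> {Y..<c - Y} \<union> {c - Y} \<union> {Suc (c - Y)..<c})"
    unfolding gauss_sum_def using assms by (intro sum.cong) auto
  also have "\<dots> = sum ?f {..<Y} + sum ?f {Y..<c - Y} + ?f (c - Y) + sum ?f {Suc (c - Y)..<c}"
  proof -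
    have "sum ?f ({..<Y} \<union> {Y..<c - Y} \<union> {c - Y} \<union> {Suc (c - Y)..<c})
        = sum ?f ({..<Y} \<union> {Y..<c - Y} \<union> {c - Y}) + sum ?f {Suc (c - Y)..<c}"
      using assms by (intro sum.union_disjoint) auto
    also have "sum ?f ({..<Y} \<union> {Y..<c - Y} \<union> {c - Y}) = sum ?f ({..<Y} \<union> {Y..<c - Y}) + sum ?f {c - Y}"
      using assms by (intro sum.union_disjoint) auto
    also have "sum ?f ({..<Y} \<union> {Y..<c - Y}) = sum ?f {..<Y} + sum ?f {Y..<c - Y}"
      using assms by (intro sum.union_disjoint) auto
    finally show ?thesis by simp
  qed
  also have "sum ?f {Suc (c - Y)..<c} = sum ?f {1..<Y}"
    using assms by (intro sum.reindex_bij_witness[of _ "\<lambda>k. c - k" "\<lambda>k. c - k"])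
      (auto simp: sym simp del: of_nat_diff)
  also have "sum ?f {1..<Y} = sum ?f {..<Y} - 1"
    using assms sum.atLeast_Suc_lessThan[of 0 Y ?f] by (simp add: lessThan_atLeast0)
  finally show ?thesis by simp
qed

text \<open>Half the phase increment at k is pi (2 k + 1) / (2 c). It increases with k, and on the
  middle range it keeps the distance Y / c from 0 and from pi, so \<open>norm_sum_cis_le\<close>
  applies with \<delta> = Y / c.\<close>

lemma norm_gauss_sum_middle_le:
  assumes "0 < Y" "2 * Y \<le> c"
  shows "norm (\<Sum>k = Y..<c - Y. cis (pi * (real k)\<^sup>2 / real c)) \<le> 1 + 4 * real c / real Y"
proof -
  define \<phi> where "\<phi> = (\<lambda>k. pi * (real k)\<^sup>2 / real c)"
  have c: "c > 0" using assms by simp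
  have x: "(\<phi> (Suc k) - \<phi> k) / 2 = pi * (2 * real k + 1) / (2 * real c)" for k
    using c by (simp add: \<phi>_def power2_eq_square field_simps)
  have "norm (\<Sum>k = Y..<c - Y. cis (\<phi> k)) \<le> 1 + 4 / (real Y / real c)"
  proof (rule norm_sum_cis_le)
    fix k assume k: "Y \<le> k" "k \<le> c - Y"
    have "real Y / real c \<le> pi * (2 * real k + 1) / (2 * real c)"
    proof -
      have "2 * real Y \<le> pi * (2 * real k + 1)"
        using k pi_gt3 by (intro order_trans[OF _ mult_mono[of 1 pi "2 * real Y"]]) auto
      then show ?thesis using c by (simp add: field_simps)
    qed
    moreover have "pi * (2 * real k + 1) / (2 * real c) \<le> pi - real Y / real c"
    proof -
      have "2 * real k + 1 \<le> 2 * real c - real Y" using k assms by linarith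
      then have "pi * (2 * real k + 1) \<le> pi * (2 * real c - real Y)" by (intro mult_left_mono) auto
      moreover have "2 * real Y \<le> pi * real Y" using pi_gt3 by (intro mult_right_mono) auto
      ultimately have "pi * (2 * real k + 1) \<le> (pi - real Y / real c) * (2 * real c)"
        using c by (simp add: algebra_simps)
      then show ?thesis using c by (subst pos_divide_le_eq) auto
    qed
    ultimately show "real Y / real c \<le> (\<phi> (Suc k) - \<phi> k) / 2 \<and> (\<phi> (Suc k) - \<phi> k) / 2 \<le> pi - real Y / real c"
      unfolding x by blast
  next
    fix k
    show "(\<phi> (Suc k) - \<phi> k) / 2 \<le> (\<phi> (Suc (Suc k)) - \<phi> (Suc k)) / 2"
      unfolding x by (intro divide_right_mono mult_left_mono) auto
  qed (use assms c in auto)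
  then show ?thesis by (simp add: \<phi>_def)
qed


text \<open>
  By \<open>gauss_sum_mult_square\<close> the quotient \<open>gauss_sum M / sqrt M\<close> does not change when \<open>M\<close> is
  multiplied by a square, and for large moduli it is close to a Fresnel integral that does not
  depend on \<open>M\<close>; so it takes the same value as for \<open>M = 2\<close>.
\<close>

lemma gauss_sum_near_fresnel:
  assumes "even M" "M > 0" "X \<ge> 1"
  shows "norm (gauss_sum M / of_real (sqrt M) - 2 * integral {0..X} (\<lambda>y. cis (pi * y\<^sup>2))) \<le> 4 / X"
proof (rule field_le_epsilon)
  fix e :: real assume e: "e > 0"
  let ?f = "\<lambda>y. cis (pi * y\<^sup>2)"
  \<comment> \<open>\<open>D / s\<close> collects the errors that vanish as T grows: 2 pi (X + 1)^2
    / s from each of the two copies of the Riemann sum, 2 / s from the two integrals J beyond X, 1 /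
    s from the middle part and 2 / s from u - 1. The bound 2 X + 2 on T ensures 2 Y <= c.\<close>
  define D where "D = 4 * pi * (X + 1)\<^sup>2 + 5"
  obtain T :: nat where T: "real T \<ge> max (D / e) (2 * X + 2)"
    using real_arch_simple by blast
  then have T0: "T > 0" using assms by (cases "T = 0") auto
  define c where "c = M * T\<^sup>2"
  define s where "s = sqrt M * real T"
  \<comment> \<open>With s = sqrt c the first Y terms are sampled on [0, X] at distance 1 / s, up to
    rounding; the remaining error 4 / X comes from the middle part.\<close>
  define Y where "Y = nat \<lceil>X * s\<rceil>"
  have sM: "sqrt M \<ge> 1" using assms by simp
  have s: "s \<ge> real T" unfolding s_def using sM by (simp add: mult_le_cancel_right1)
  have s0: "s > 0" using s T0 by linarith
  have s1: "s \<ge> 1" using s T0 by linarith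
  have sD: "D / s \<le> e"
  proof -
    have "D / e \<le> s" using T s by linarith
    then show ?thesis using s0 e by (simp add: field_simps)
  qed
  have s2: "s\<^sup>2 = real c" by (simp add: s_def c_def power_mult_distrib)
  have YX: "X * s \<le> real Y" "real Y \<le> X * s + 1"
  proof -
    have "0 \<le> X * s" using assms s0 by simp
    then have "real Y = of_int \<lceil>X * s\<rceil>" by (simp add: Y_def of_nat_nat)
    then show "X * s \<le> real Y" "real Y \<le> X * s + 1" by linarith+
  qed
  have Y0: "Y > 0" using YX assms s0 by (metis less_numeral_extra(3) mult_pos_pos not_gr0 of_nat_0 order_less_le_trans zero_less_one)
  have YX1: "real Y \<le> (X + 1) * s" using YX s1 by (simp add: algebra_simps)
  have Yc: "2 * Y \<le> c"
  proof -
    have "real (2 * Y) \<le> (2 * X + 2) * s" using YX1 by (simp add: algebra_simps)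
    also have "\<dots> \<le> s * s" using T s s0 by (intro mult_right_mono) auto
    also have "\<dots> = real c" by (simp add: s2 flip: power2_eq_square)
    finally show ?thesis by (simp only: of_nat_le_iff)
  qed
  have ev: "even c" using assms by (simp add: c_def)
  define S where "S = (\<Sum>k<Y. ?f (real k / s))"
  define R where "R = (\<Sum>k = Y..<c - Y. cis (pi * (real k)\<^sup>2 / real c))"
  define I where "I = integral {0..X} ?f"
  define J where "J = integral {X..real Y / s} ?f"
  define u where "u = cis (pi * (real (c - Y))\<^sup>2 / real c)"
  have "gauss_sum M / of_real (sqrt M) = gauss_sum c / of_real s"
    using gauss_sum_mult_square[OF assms(1,2) T0] T0 assms by (simp add: c_def s_def)
  also have "gauss_sum c = 2 * S - 1 + R + u"
    unfolding S_def R_def u_def using gauss_sum_split[OF ev Y0 Yc] by (simp add: power_divide s2)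
  finally have g: "gauss_sum M / of_real (sqrt M) = (2 * S - 1 + R + u) / of_real s" .
  have int: "?f integrable_on {a..b}" for a b
    by (intro integrable_continuous_interval continuous_intros)
  have XY: "X \<le> real Y / s" "real Y / s - X \<le> 1 / s"
  proof -
    show "X \<le> real Y / s" using YX s0 by (simp add: pos_le_divide_eq)
    have "real Y / s \<le> (X * s + 1) / s" using YX s0 by (intro divide_right_mono) auto
    then show "real Y / s - X \<le> 1 / s" using s0 by (simp add: add_divide_distrib)
  qed
  have "integral {0..real Y / s} ?f = I + J" unfolding I_def J_def
    using XY assms by (intro Henstock_Kurzweil_Integration.integral_combine[OF _ _ int, symmetric]) auto
  then have 1: "norm (S / of_real s - (I + J)) \<le> 2 * pi * (X + 1)\<^sup>2 / s"
  proof -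
    have "2 * pi * (real Y)\<^sup>2 / s ^ 3 \<le> 2 * pi * ((X + 1) * s)\<^sup>2 / s ^ 3"
      using YX1 s0 by (intro divide_right_mono mult_left_mono power_mono) auto
    also have "\<dots> = 2 * pi * (X + 1)\<^sup>2 / s"
      using s0 by (simp add: power2_eq_square power3_eq_cube field_simps)
    finally show ?thesis
      using norm_fresnel_riemann_sum_le[OF s0, of Y] \<open>integral {0..real Y / s} ?f = I + J\<close>
      by (simp add: S_def)
  qed
  have 2: "norm J \<le> 1 / s"
  proof -
    have "norm (integral (cbox X (real Y / s)) ?f) \<le> 1 * measure lborel (cbox X (real Y / s))"
      by (intro integrable_bound) (auto simp: int)
    then show ?thesis using XY by (simp add: J_def)
  qed
  have 3: "norm (R / of_real s) \<le> 1 / s + 4 / X"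
  proof -
    have "norm R \<le> 1 + 4 * real c / real Y" unfolding R_def by (rule norm_gauss_sum_middle_le[OF Y0 Yc])
    also have "\<dots> \<le> 1 + 4 * (s * s) / (X * s)"
      using YX assms s0 s2 by (intro add_left_mono divide_mono) (auto simp: power2_eq_square)
    also have "\<dots> = 1 + 4 * s / X" using s0 by simp
    finally have "norm R / s \<le> (1 + 4 * s / X) / s" using s0 by (intro divide_right_mono) auto
    then show ?thesis using s0 by (simp add: norm_divide add_divide_distrib)
  qed
  have 4: "norm ((u - 1) / of_real s) \<le> 2 / s"
    using norm_triangle_ineq4[of u 1] s0 by (simp add: norm_divide divide_right_mono u_def)
  have "gauss_sum M / of_real (sqrt M) - 2 * I =
      (S / of_real s - (I + J)) + (S / of_real s - (I + J)) + (J + J) + (R / of_real s + (u - 1) / of_real s)"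
    unfolding g by (simp add: add_divide_distrib diff_divide_distrib)
  also have "norm \<dots> \<le> 2 * pi * (X + 1)\<^sup>2 / s + 2 * pi * (X + 1)\<^sup>2 / s + (1 / s + 1 / s) + (1 / s + 4 / X + 2 / s)"
    by (intro norm_triangle_mono 1 2 3 4)
  also have "\<dots> = D / s + 4 / X" by (simp add: D_def add_divide_distrib)
  also have "\<dots> \<le> 4 / X + e" using sD by simp
  finally show "norm (gauss_sum M / of_real (sqrt M) - 2 * I) \<le> 4 / X + e" .
qed

lemma gauss_sum_even:
  assumes "even M" "M > 0"
  shows "gauss_sum M = of_real (sqrt M) * cis (pi / 4)"
proof -
  define a where "a = gauss_sum M / of_real (sqrt M)"
  define b where "b = gauss_sum 2 / of_real (sqrt 2)"
  have "norm (a - b) \<le> 0"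
  proof (rule field_le_epsilon)
    fix e :: real assume e: "e > 0"
    define X where "X = max 1 (8 / e)"
    define I where "I = integral {0..X} (\<lambda>y. cis (pi * y\<^sup>2))"
    have "norm (a - 2 * I) \<le> 4 / X" "norm (b - 2 * I) \<le> 4 / X"
      unfolding a_def b_def I_def
      using gauss_sum_near_fresnel[of M X] gauss_sum_near_fresnel[of 2 X] assms by (auto simp: X_def)
    then have "norm (a - b) \<le> 8 / X"
      using norm_triangle_ineq4[of "a - 2 * I" "b - 2 * I"] by simp
    also have "8 / X \<le> e" using e by (auto simp: X_def max_def field_simps)
    finally show "norm (a - b) \<le> 0 + e" by simp
  qed
  then have "a = b" by simp
  also have "b = cis (pi / 4)"
  proof -
    have "gauss_sum 2 = 1 + \<i>" by (simp add: gauss_sum_def numeral_2_eq_2)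
    moreover have "1 + \<i> = of_real (sqrt 2) * cis (pi / 4)"
      by (simp add: complex_eq_iff cos_45 sin_45)
    ultimately show ?thesis by (simp add: b_def)
  qed
  finally show ?thesis using assms by (simp add: a_def field_simps)
qed

section \<open>Dedekind sums\<close>

text \<open>
  \<open>sawtooth_dft k l\<close> is a finite Fourier transform of the centred residues; if \<open>k\<close> does not
  divide \<open>l\<close>, its value is \<open>- \<i> cot (pi l / k) - 1\<close>, which makes the Dedekind sum an instance of
  Parseval's identity.
\<close>

definition sawtooth_dft :: "nat \<Rightarrow> int \<Rightarrow> complex" where
  "sawtooth_dft k l =
     2 / of_nat k * (\<Sum>r<k. (of_nat r - (of_nat k - 1) / 2) * cis (2 * pi * of_int l * real r / real k))"

lemma sum_of_nat_mult_power:
  fixes w :: complex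
  shows "(w - 1) * (\<Sum>r<k. of_nat r * w ^ r) = of_nat k * w ^ k - w * (\<Sum>r<k. w ^ r)"
  by (induction k) (auto simp: algebra_simps)

lemma sawtooth_dft_eq_cot:
  assumes "k > 0" "\<not> int k dvd l"
  shows "sawtooth_dft k l = - \<i> * of_real (cot (pi * of_int l / real k)) - 1"
proof -
  define x where "x = pi * of_int l / real k"
  define w where "w = cis (2 * x)"
  have wr: "cis (2 * pi * of_int l * real r / real k) = w ^ r" for r
    by (simp add: w_def x_def Complex.DeMoivre mult_ac)
  have s0: "(\<Sum>r<k. w ^ r) = 0"
    using sum_cis_int_multiples[OF assms(1), of l] assms(2) by (simp add: wr)
  have wk: "w ^ k = 1"
  proof -
    have "w ^ k = cis (real k * (2 * x))" unfolding w_def by (rule Complex.DeMoivre)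
    also have "real k * (2 * x) = 2 * pi * of_int l" using assms by (simp add: x_def)
    finally show ?thesis by (simp only: cis_2pi_int)
  qed
  have w1: "w \<noteq> 1" using s0 assms by auto
  have "(w - 1) * (\<Sum>r<k. of_nat r * w ^ r) = of_nat k"
    unfolding sum_of_nat_mult_power s0 wk by simp
  then have "(\<Sum>r<k. of_nat r * w ^ r) = of_nat k / (w - 1)" using w1 by (simp add: field_simps)
  moreover have "(\<Sum>r<k. (of_nat r - c) * w ^ r) = (\<Sum>r<k. of_nat r * w ^ r) - c * (\<Sum>r<k. w ^ r)" for c
    by (simp add: left_diff_distrib sum_subtractf sum_distrib_left)
  ultimately have "sawtooth_dft k l = 2 / (w - 1)"
    using assms s0 unfolding sawtooth_dft_def wr by simp
  also have "\<dots> = - \<i> * of_real (cot x) - 1"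
  proof -
    have "sin x \<noteq> 0"
    proof
      assume "sin x = 0"
      then have "w = 1" by (simp add: w_def complex_eq_iff cos_double_sin sin_double)
      with w1 show False by simp
    qed
    then have E: "(w - 1) * (- 1 / 2 - \<i> / 2 * complex_of_real (cot x)) = 1"
      unfolding w_def by (rule inverse_cis_minus_1)
    have "(- \<i> * of_real (cot x) - 1) * (w - 1) = 2 * ((w - 1) * (- 1 / 2 - \<i> / 2 * complex_of_real (cot x)))"
      by (simp add: field_simps)
    then show ?thesis unfolding E using w1 by (simp add: nonzero_divide_eq_eq)
  qed
  finally show ?thesis by (simp add: x_def)
qed

text \<open>This is the effect of the centring, (k - 1) / 2 being the mean of the residues.
  Extending the cotangent sum to l = 0 in \<open>dedekind_sum_eq\<close> therefore adds exactly
  1.\<close>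

lemma sawtooth_dft_multiple: "int k dvd l \<Longrightarrow> sawtooth_dft k l = 0"
proof (cases "k = 0")
  case False
  assume "int k dvd l"
  then obtain m where "l = int k * m" by auto
  then have "2 * pi * of_int l * real r / real k = 2 * pi * of_int (m * int r)" for r
    using False by (simp add: field_simps)
  then have "sawtooth_dft k l = 2 / of_nat k * (\<Sum>r<k. of_nat r - (of_nat k - 1) / 2)"
    unfolding sawtooth_dft_def by (simp only: cis_2pi_int mult_1_right)
  also have "(\<Sum>r<k. of_nat r - (of_nat k - 1) / 2 :: complex) = 0"
  proof -
    have "(\<Sum>r<k. of_nat r :: complex) = of_nat k * (of_nat k - 1) / 2"
      by (induction k) (auto simp: field_simps)
    then show ?thesis by (simp add: sum_subtractf)
  qed
  finally show ?thesis by simp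
qed (simp add: sawtooth_dft_def)

text \<open>Summation over all frequencies inverts the transform at r = 0, where the centred residue
  is - (k - 1) / 2; a factor h coprime to k only permutes the frequencies.\<close>

lemma sum_sawtooth_dft:
  assumes "k > 0" "coprime h (int k)"
  shows "(\<Sum>l<k. sawtooth_dft k (h * int l)) = 1 - of_nat k"
proof -
  have "(\<Sum>l<k. sawtooth_dft k (h * int l)) = 2 / of_nat k * (\<Sum>r<k. (of_nat r - (of_nat k - 1) / 2) *
      (\<Sum>l<k. cis (2 * pi * of_int (h * int r) * real l / real k)))"
    unfolding sawtooth_dft_def sum_distrib_left by (subst sum.swap) (simp add: mult_ac)
  also have "\<dots> = 2 / of_nat k * (\<Sum>r<k. if r = 0 then (of_nat r - (of_nat k - 1) / 2) * of_nat k else 0)"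
  proof (intro arg_cong2[of _ _ _ _ "(*)"] sum.cong refl)
    fix r assume r: "r \<in> {..<k}"
    have "int k dvd h * int r \<longleftrightarrow> int k dvd int r"
      using assms(2) by (simp add: coprime_commute coprime_dvd_mult_right_iff)
    also have "\<dots> \<longleftrightarrow> r = 0" using r by (auto simp: int_dvd_int_iff dest: dvd_imp_le)
    finally show "(of_nat r - (of_nat k - 1) / 2) * (\<Sum>l<k. cis (2 * pi * of_int (h * int r) * real l / real k))
        = (if r = 0 then (of_nat r - (of_nat k - 1) / 2) * of_nat k else 0)"
      by (cases "r = 0") (simp_all add: sum_cis_int_multiples[OF assms(1)] del: of_int_mult)
  qed
  also have "\<dots> = 1 - of_nat k" using assms by (simp add: diff_divide_distrib)
  finally show ?thesis .
qed

text \<open>Orthogonality of the characters keeps the pairs with r congruent to h * s, and r is then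
  the least residue of h * s.\<close>

lemma sum_sawtooth_dft_mult_cnj:
  assumes "k > 0"
  shows "(\<Sum>l<k. sawtooth_dft k (int l) * cnj (sawtooth_dft k (h * int l))) =
    4 / of_nat k * (\<Sum>s<k. (of_int ((h * int s) mod int k) - (of_nat k - 1) / 2) * (of_nat s - (of_nat k - 1) / 2))"
proof -
  define c where "c = (of_nat k - 1 :: complex) / 2"
  have c: "cnj c = c" by (simp add: c_def)
  have swap: "(\<Sum>l<k. \<Sum>r<k. \<Sum>s<k. g l r s) = (\<Sum>s<k. \<Sum>r<k. \<Sum>l<k. g l r s)"
    for g :: "nat \<Rightarrow> nat \<Rightarrow> nat \<Rightarrow> complex"
  proof -
    have "(\<Sum>l<k. \<Sum>r<k. \<Sum>s<k. g l r s) = (\<Sum>l<k. \<Sum>s<k. \<Sum>r<k. g l r s)"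
      by (intro sum.cong refl sum.swap)
    also have "\<dots> = (\<Sum>s<k. \<Sum>l<k. \<Sum>r<k. g l r s)" by (rule sum.swap)
    also have "\<dots> = (\<Sum>s<k. \<Sum>r<k. \<Sum>l<k. g l r s)" by (intro sum.cong refl sum.swap)
    finally show ?thesis .
  qed
  have "(\<Sum>l<k. sawtooth_dft k (int l) * cnj (sawtooth_dft k (h * int l))) =
     (\<Sum>l<k. \<Sum>r<k. \<Sum>s<k. 4 / of_nat k ^ 2 * ((of_nat r - c) * (of_nat s - c)) *
       cis (2 * pi * of_int (int r - h * int s) * real l / real k))"
  proof (intro sum.cong refl)
    fix l
    have dist: "X * ((\<Sum>r<k. a r * e r) * (\<Sum>s<k. a s * e' s)) = (\<Sum>r<k. \<Sum>s<k. X * (a r * a s) * (e r * e' s))"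
      for X :: complex and a e e'
      by (simp add: sum_product sum_distrib_left mult_ac)
    have "sawtooth_dft k (int l) * cnj (sawtooth_dft k (h * int l)) =
      4 / of_nat k ^ 2 * ((\<Sum>r<k. (of_nat r - c) * cis (2 * pi * of_int (int l) * real r / real k)) *
       (\<Sum>s<k. (of_nat s - c) * cis (- (2 * pi * of_int (h * int l) * real s / real k))))"
      unfolding sawtooth_dft_def c_def[symmetric]
      by (simp add: cis_cnj c power2_eq_square)
    also have "\<dots> = (\<Sum>r<k. \<Sum>s<k. 4 / of_nat k ^ 2 * ((of_nat r - c) * (of_nat s - c)) *
       (cis (2 * pi * of_int (int l) * real r / real k) * cis (- (2 * pi * of_int (h * int l) * real s / real k))))"
      by (rule dist)
    also have "\<dots> = (\<Sum>r<k. \<Sum>s<k. 4 / of_nat k ^ 2 * ((of_nat r - c) * (of_nat s - c)) *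
       cis (2 * pi * of_int (int r - h * int s) * real l / real k))"
      unfolding cis_mult using assms
      by (intro sum.cong refl arg_cong2[of _ _ _ _ "(*)"] arg_cong[of _ _ cis]) (simp add: field_simps)
    finally show "sawtooth_dft k (int l) * cnj (sawtooth_dft k (h * int l)) = \<dots>" .
  qed
  also have "\<dots> = (\<Sum>s<k. \<Sum>r<k. 4 / of_nat k ^ 2 * ((of_nat r - c) * (of_nat s - c)) *
       (\<Sum>l<k. cis (2 * pi * of_int (int r - h * int s) * real l / real k)))"
    unfolding sum_distrib_left by (rule swap)
  also have "\<dots> = (\<Sum>s<k. 4 / of_nat k * ((of_int ((h * int s) mod int k) - c) * (of_nat s - c)))"
  proof (intro sum.cong refl)
    fix s
    define t where "t = nat ((h * int s) mod int k)"
    have t: "int t = (h * int s) mod int k" "t < k"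
      using assms by (auto simp: t_def nat_less_iff)
    have d: "int k dvd int r - h * int s \<longleftrightarrow> r = t" if "r < k" for r
    proof -
      have "int k dvd int r - h * int s \<longleftrightarrow> int r mod int k = (h * int s) mod int k"
        by (simp add: mod_eq_dvd_iff)
      also have "\<dots> \<longleftrightarrow> int r = int t" using that t by simp
      finally show ?thesis by simp
    qed
    have "(\<Sum>r<k. 4 / of_nat k ^ 2 * ((of_nat r - c) * (of_nat s - c)) *
       (\<Sum>l<k. cis (2 * pi * of_int (int r - h * int s) * real l / real k)))
      = (\<Sum>r<k. if r = t then 4 / of_nat k ^ 2 * ((of_nat r - c) * (of_nat s - c)) * of_nat k else 0)"
      unfolding sum_cis_int_multiples[OF assms] by (intro sum.cong refl) (simp add: d)
    also have "\<dots> = 4 / of_nat k * ((of_nat t - c) * (of_nat s - c))"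
      using t assms by (simp add: power2_eq_square)
    also have "(of_nat t :: complex) = of_int ((h * int s) mod int k)" by (simp flip: t(1))
    finally show "(\<Sum>r<k. 4 / of_nat k ^ 2 * ((of_nat r - c) * (of_nat s - c)) *
       (\<Sum>l<k. cis (2 * pi * of_int (int r - h * int s) * real l / real k))) =
       4 / of_nat k * ((of_int ((h * int s) mod int k) - c) * (of_nat s - c))" .
  qed
  finally show ?thesis by (simp add: c_def sum_distrib_left)
qed

lemma sum_mult_mod_permute:
  fixes f :: "int \<Rightarrow> 'a :: comm_monoid_add"
  assumes "k > 0" "[q * h = 1] (mod int k)"
  shows "(\<Sum>s<k. g (int s) ((q * int s) mod int k)) = (\<Sum>u<k. g ((h * int u) mod int k) (int u) :: 'a)"
proof (rule sum.reindex_bij_witness[of _ "\<lambda>u. nat ((h * int u) mod int k)" "\<lambda>s. nat ((q * int s) mod int k)"])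
  have inv: "(a * ((b * x) mod int k)) mod int k = x mod int k" if "[a * b = 1] (mod int k)" for a b x
  proof -
    have "[a * ((b * x) mod int k) = a * (b * x)] (mod int k)"
      by (intro cong_scalar_left) (simp add: cong_def)
    also have "a * (b * x) = (a * b) * x" by simp
    also have "[(a * b) * x = 1 * x] (mod int k)" by (intro cong_scalar_right that)
    finally show ?thesis by (simp add: cong_def)
  qed
  have qh: "[q * h = 1] (mod int k)" and hq: "[h * q = 1] (mod int k)"
    using assms by (simp_all add: mult.commute)
  fix s assume s: "s \<in> {..<k}"
  show "nat ((q * int s) mod int k) \<in> {..<k}" "nat ((h * int s) mod int k) \<in> {..<k}"
    using assms by (auto simp: nat_less_iff)
  show "nat ((h * int (nat ((q * int s) mod int k))) mod int k) = s"
    "nat ((q * int (nat ((h * int s) mod int k))) mod int k) = s"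
    using inv[OF hq, of "int s"] inv[OF qh, of "int s"] s assms by simp_all
  show "g ((h * int (nat ((q * int s) mod int k))) mod int k) (int (nat ((q * int s) mod int k)))
      = g (int s) ((q * int s) mod int k)"
    using inv[OF hq, of "int s"] s assms by simp
qed

text \<open>Since \<open>D + 1\<close> is - \<i> times a cotangent, each product of cotangents is
  \<open>D + 1\<close> at l times the conjugate of \<open>D + 1\<close> at q * l. Expanding leaves
  the Parseval sum and two linear sums that are known. The result is expressed by the inverse h of q
  because, for Seifert data, this inverse is the explicit cofactor \<open>A j\<close>.\<close>

lemma dedekind_sum_eq:
  assumes k: "k > 0" and qh: "[q * h = 1] (mod int k)"
  shows "12 * real k * dedekind_sum q k =
    12 / real k * (\<Sum>u<k. real u * of_int ((h * int u) mod int k)) - 3 * real k * (real k - 1)"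
proof -
  define D where "D = sawtooth_dft k"
  have q: "coprime q (int k)" using qh by (meson cong_imp_coprime cong_sym coprime_1_left coprime_mult_left_iff)
  have cots: "of_real (cot (pi * real l / real k) * cot (pi * real l * of_int q / real k)) =
      (D (int l) + 1) * cnj (D (q * int l) + 1)" if l: "l \<in> {1..k - 1}" for l
  proof -
    have "\<not> int k dvd int l" using l by (auto simp: int_dvd_int_iff dest: dvd_imp_le)
    moreover from this have "\<not> int k dvd q * int l"
      using q by (simp add: coprime_commute coprime_dvd_mult_right_iff)
    ultimately show ?thesis using k
      by (simp add: D_def sawtooth_dft_eq_cot mult.assoc mult.commute[of "of_int q"] complex_eq_iff)
  qed
  define V where "V = (\<Sum>l = 1..k - 1. cot (pi * real l / real k) * cot (pi * real l * of_int q / real k))"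
  define W where "W = (\<Sum>u<k. real u * of_int ((h * int u) mod int k))"
  define c where "c = (real k - 1) / 2"
  have sum1: "(\<Sum>s<k. real s) = real k * c"
    by (simp add: c_def) (induction k, auto simp: field_simps)
  have sumq: "(\<Sum>s<k. of_int ((q * int s) mod int k)) = real k * c"
    using sum_mult_mod_permute[OF k qh, of "\<lambda>_ y. real_of_int y"] sum1 by simp
  have sumqs: "(\<Sum>s<k. of_int ((q * int s) mod int k) * real s) = W"
    using sum_mult_mod_permute[OF k qh, of "\<lambda>x y. real_of_int (y * x)"] by (simp add: W_def)
  have "of_real V = (\<Sum>l\<in>{1..k - 1}. (D (int l) + 1) * cnj (D (q * int l) + 1))"
    unfolding V_def of_real_sum by (intro sum.cong refl cots)
  also have "\<dots> = (\<Sum>l<k. (D (int l) + 1) * cnj (D (q * int l) + 1)) - 1"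
  proof -
    have "{..<k} = insert 0 {1..k - 1}" using k by auto
    then show ?thesis by (simp add: D_def sawtooth_dft_multiple)
  qed
  also have "\<dots> = (\<Sum>l<k. D (int l) * cnj (D (q * int l))) + (\<Sum>l<k. D (1 * int l))
      + cnj (\<Sum>l<k. D (q * int l)) + of_nat k - 1"
    by (simp add: algebra_simps sum.distrib)
  also have "\<dots> = (\<Sum>l<k. D (int l) * cnj (D (q * int l))) + 1 - of_nat k"
    unfolding D_def using sum_sawtooth_dft[OF k, of 1] sum_sawtooth_dft[OF k q] by simp
  also have "\<dots> = of_real (4 / real k * (\<Sum>s<k. (of_int ((q * int s) mod int k) - c) * (real s - c)) + 1 - real k)"
    unfolding D_def sum_sawtooth_dft_mult_cnj[OF k] c_def by simp
  also have "(\<Sum>s<k. (of_int ((q * int s) mod int k) - c) * (real s - c)) = W - real k * c * c"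
    using sum1 sumq sumqs
    by (simp add: algebra_simps sum.distrib sum_subtractf flip: sum_distrib_left)
  finally have "V = 4 / real k * (W - real k * c * c) + 1 - real k" by (simp only: of_real_eq_iff)
  then have "V = 4 / real k * W - real k * (real k - 1)"
    using k by (simp add: c_def field_simps)
  then show ?thesis using k unfolding dedekind_sum_def V_def[symmetric] W_def[symmetric]
    by (simp add: field_simps)
qed

section \<open>Congruences for Dedekind sums\<close>

lemma six_sum_squares_lessThan: "6 * (\<Sum>r<k. (int r)\<^sup>2) = int k * (int k - 1) * (2 * int k - 1)"
  by (induction k) (auto simp: algebra_simps power2_eq_square)

lemma two_sum_lessThan: "2 * (\<Sum>r<k. int r) = int k * (int k - 1)"
  by (induction k) (auto simp: algebra_simps)

text \<open>Multiplication by h permutes the residues modulo k, so \<rho> r = h * r - k * f r has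
  the same sum and the same sum of squares as r. The first equality gives \<open>F0\<close>, the
  second a relation between h * \<open>F1\<close> and \<open>F2\<close>. As it determines only h *
  \<open>F1\<close>, the congruence concerns h * S; with h = \<open>A j\<close> this is the summand
  of P times \<open>Theta0\<close>.\<close>

lemma dedekind_sum_cong:
  assumes k: "k > 0" and qh: "[q * h = 1] (mod int k)"
  obtains S :: int where
    "12 * real k * dedekind_sum q k = of_int S"
    "4 * int k dvd h * S - ((h\<^sup>2 + 1) * ((int k - 1) * (2 * int k - 1)) - 3 * int k * (int k - 1) * (2 * h - 1))"
    "odd k \<Longrightarrow> 4 dvd S - (int k - 1)"
proof -
  define f where "f = (\<lambda>r. (h * int r) div int k)"
  define \<rho> where "\<rho> = (\<lambda>r. (h * int r) mod int k)"
  define F0 F1 F2 where "F0 = (\<Sum>r<k. f r)" and "F1 = (\<Sum>r<k. int r * f r)" and "F2 = (\<Sum>r<k. (f r)\<^sup>2)"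
  define s1 s2 where "s1 = (\<Sum>r<k. int r)" and "s2 = (\<Sum>r<k. (int r)\<^sup>2)"
  define m where "m = int k"
  have \<rho>: "\<rho> r = h * int r - m * f r" for r
    by (simp add: \<rho>_def f_def m_def minus_div_mult_eq_mod[symmetric] mult.commute)
  have s: "6 * s2 = m * (m - 1) * (2 * m - 1)" "2 * s1 = m * (m - 1)"
    by (simp_all add: s1_def s2_def six_sum_squares_lessThan two_sum_lessThan m_def)
  have m: "m > 0" using k by (simp add: m_def)
  have perm: "(\<Sum>s<k. g ((q * int s) mod int k)) = (\<Sum>u<k. g (int u))" for g :: "int \<Rightarrow> int"
    using sum_mult_mod_permute[OF k qh, of "\<lambda>_. g"] .
  have perm': "(\<Sum>r<k. g (\<rho> r)) = (\<Sum>u<k. g (int u))" for g :: "int \<Rightarrow> int"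
    unfolding \<rho>_def using sum_mult_mod_permute[OF k qh, of "\<lambda>x _. g x"] by simp
  have "s1 = h * s1 - m * F0"
    using perm'[of "\<lambda>x. x"] by (simp add: \<rho> s1_def F0_def sum_subtractf sum_distrib_left)
  then have "m * (2 * F0) = (h - 1) * (2 * s1)" by (simp add: algebra_simps)
  then have "m * (2 * F0) = m * ((h - 1) * (m - 1))" unfolding s(2) by (simp only: mult_ac)
  then have F0: "2 * F0 = (h - 1) * (m - 1)" using m by simp
  have "s2 = h\<^sup>2 * s2 - 2 * h * m * F1 + m\<^sup>2 * F2"
  proof -
    have "s2 = (\<Sum>r<k. (h * int r - m * f r)\<^sup>2)" using perm'[of "\<lambda>x. x\<^sup>2"] by (simp add: \<rho> s2_def)
    also have "\<dots> = (\<Sum>r<k. h\<^sup>2 * (int r)\<^sup>2 - 2 * h * m * (int r * f r) + m\<^sup>2 * (f r)\<^sup>2)"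
      by (intro sum.cong refl) (simp add: power2_eq_square algebra_simps)
    also have "\<dots> = h\<^sup>2 * s2 - 2 * h * m * F1 + m\<^sup>2 * F2"
      by (simp only: s2_def F1_def F2_def sum.distrib sum_subtractf sum_distrib_left)
    finally show ?thesis .
  qed
  then have "m * (12 * h * F1) = (h\<^sup>2 - 1) * (6 * s2) + m * (6 * m * F2)"
    by (simp add: algebra_simps power2_eq_square)
  then have "m * (12 * h * F1) = m * ((h\<^sup>2 - 1) * ((m - 1) * (2 * m - 1)) + 6 * m * F2)"
    unfolding s(1) by (simp add: algebra_simps)
  then have F1: "12 * h * F1 = (h\<^sup>2 - 1) * ((m - 1) * (2 * m - 1)) + 6 * m * F2" using m by simp
  \<comment> \<open>Each (f r)^2 - f r is even. This determines 6 * m * \<open>F2\<close> modulo 12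
    * m, which is the source of the modulus 4 * k.\<close>
  have "even (F2 - F0)"
    unfolding F2_def F0_def sum_subtractf[symmetric] by (intro dvd_sum) (auto simp: power2_eq_square)
  then obtain j where "F2 - F0 = 2 * j" by (elim evenE)
  then have j: "F2 = F0 + 2 * j" by simp
  define S where "S = 2 * h * ((m - 1) * (2 * m - 1)) - 12 * F1 - 3 * m * (m - 1)"
  show thesis
  proof (rule that[of S])
    have "(\<Sum>u<k. int u * \<rho> u) = h * s2 - m * F1"
      by (simp add: \<rho> s2_def F1_def sum_subtractf sum_distrib_left power2_eq_square algebra_simps)
    then have "12 * (\<Sum>u<k. int u * \<rho> u) = 2 * h * (6 * s2) - 12 * m * F1" by (simp add: algebra_simps)
    also have "\<dots> = m * (S + 3 * m * (m - 1))" unfolding s(1) S_def by (simp add: algebra_simps)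
    finally have "12 * (\<Sum>u<k. int u * \<rho> u) = m * (S + 3 * m * (m - 1))" .
    then have "real_of_int (12 * (\<Sum>u<k. int u * \<rho> u)) = real_of_int (m * (S + 3 * m * (m - 1)))" by (simp only:)
    then show "12 * real k * dedekind_sum q k = of_int S"
      unfolding dedekind_sum_eq[OF k qh] using k by (simp add: \<rho>_def m_def field_simps)
    have "h * S - ((h\<^sup>2 + 1) * ((m - 1) * (2 * m - 1)) - 3 * m * (m - 1) * (2 * h - 1)) = 4 * m * (- 3 * j)"
    proof -
      define X where "X = (m - 1) * (2 * m - 1)"
      have "h * S - ((h\<^sup>2 + 1) * X - 3 * m * (m - 1) * (2 * h - 1)) =
          2 * h\<^sup>2 * X - 12 * h * F1 - 3 * h * m * (m - 1) - ((h\<^sup>2 + 1) * X - 3 * m * (m - 1) * (2 * h - 1))"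
        unfolding S_def X_def[symmetric] by (simp add: algebra_simps power2_eq_square)
      also have "\<dots> = 3 * m * (m - 1) * (h - 1) - 3 * m * (2 * F0) - 12 * m * j"
        unfolding F1 j X_def[symmetric] by (simp add: algebra_simps power2_eq_square)
      finally show ?thesis unfolding F0 by (simp add: X_def algebra_simps)
    qed
    then show "4 * int k dvd h * S - ((h\<^sup>2 + 1) * ((int k - 1) * (2 * int k - 1)) - 3 * int k * (int k - 1) * (2 * h - 1))"
      unfolding m_def by (simp only: dvd_triv_left)
    assume "odd k"
    then obtain i where "m = 2 * i + 1" by (auto simp: m_def elim!: oddE)
    then have "S - (m - 1) = 4 * (h * i * (4 * i + 1) - 3 * F1 - 3 * i * i - 2 * i)"
      unfolding S_def by (simp add: algebra_simps)
    then show "4 dvd S - (int k - 1)" unfolding m_def by simp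
  qed
qed

section \<open>The congruence for the framing exponent\<close>

text \<open>The quotient of the full product by \<open>p j\<close>, written without division so that
  it obeys a recursion under \<open>insert\<close>.\<close>

definition cofactor :: "nat set \<Rightarrow> (nat \<Rightarrow> int) \<Rightarrow> nat \<Rightarrow> int" where
  "cofactor I p j = (\<Prod>i\<in>I - {j}. p i)"

lemma cofactor_mult: "finite I \<Longrightarrow> j \<in> I \<Longrightarrow> p j * cofactor I p j = (\<Prod>i\<in>I. p i)"
  unfolding cofactor_def by (simp add: prod.remove)

lemma dvd_cofactor: "finite I \<Longrightarrow> i \<in> I \<Longrightarrow> i \<noteq> j \<Longrightarrow> p i dvd cofactor I p j"
  unfolding cofactor_def by (intro dvd_prodI) auto

lemma cofactor_insert:
  assumes "finite I" "i \<notin> I"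
  shows "cofactor (insert i I) p i = (\<Prod>i\<in>I. p i)"
    and "j \<in> I \<Longrightarrow> cofactor (insert i I) p j = p i * cofactor I p j"
proof -
  show "cofactor (insert i I) p i = (\<Prod>i\<in>I. p i)" using assms by (simp add: cofactor_def)
  assume "j \<in> I"
  then have "insert i I - {j} = insert i (I - {j})" using assms by auto
  then show "cofactor (insert i I) p j = p i * cofactor I p j"
    using assms by (simp add: cofactor_def)
qed

lemma sum_cofactor_insert:
  assumes "finite I" "i \<notin> I"
  shows "(\<Sum>j\<in>insert i I. cofactor (insert i I) p j) = (\<Prod>j\<in>I. p j) + p i * (\<Sum>j\<in>I. cofactor I p j)"
  using assms by (simp add: cofactor_insert sum_distrib_left cong: sum.cong)

text \<open>For odd P and p the product (P - 1) (p - 1) is divisible by 4, so P + p may be replaced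
  by 1 + P p each time a factor p is adjoined.\<close>

lemma sum_cofactor_odd:
  assumes "finite I" "\<And>j. j \<in> I \<Longrightarrow> odd (p j)"
  shows "4 dvd (\<Sum>j\<in>I. cofactor I p j) - (1 + (int (card I) - 1) * (\<Prod>j\<in>I. p j))"
  using assms
proof (induction I rule: finite_induct)
  case (insert i I)
  define P where "P = (\<Prod>j\<in>I. p j)"
  have "odd P" unfolding P_def using insert by (auto simp: even_prod_iff)
  moreover have "odd (p i)" using insert by auto
  ultimately obtain u v where uv: "P = 2 * u + 1" "p i = 2 * v + 1" by (auto elim!: oddE)
  obtain t where "(\<Sum>j\<in>I. cofactor I p j) - (1 + (int (card I) - 1) * P) = 4 * t"
    using insert by (auto simp: P_def elim!: dvdE)
  then have t: "(\<Sum>j\<in>I. cofactor I p j) = 1 + (int (card I) - 1) * P + 4 * t" by simp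
  have "(\<Sum>j\<in>insert i I. cofactor (insert i I) p j) -
      (1 + (int (card (insert i I)) - 1) * (\<Prod>j\<in>insert i I. p j)) = 4 * (p i * t - u * v)"
    unfolding sum_cofactor_insert[OF insert(1,2)] t using insert(1,2)
    by (simp add: P_def[symmetric] uv algebra_simps)
  then show ?case by simp
qed simp

lemma sum_cofactor_mult:
  assumes "finite I"
  shows "(\<Sum>j\<in>I. cofactor I p j * (p j - 1)) = int (card I) * (\<Prod>j\<in>I. p j) - (\<Sum>j\<in>I. cofactor I p j)"
proof -
  have "(\<Sum>j\<in>I. cofactor I p j * (p j - 1)) = (\<Sum>j\<in>I. (\<Prod>j\<in>I. p j) - cofactor I p j)"
    using cofactor_mult[OF assms, of _ p] by (intro sum.cong refl) (simp add: algebra_simps)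
  then show ?thesis by (simp add: sum_subtractf)
qed

lemma prod_dvd_of_coprime:
  fixes p :: "nat \<Rightarrow> int"
  assumes "finite I" "\<And>i j. i \<in> I \<Longrightarrow> j \<in> I \<Longrightarrow> i \<noteq> j \<Longrightarrow> coprime (p i) (p j)"
    "\<And>i. i \<in> I \<Longrightarrow> p i dvd y"
  shows "(\<Prod>i\<in>I. p i) dvd y"
  using assms
proof (induction I rule: finite_induct)
  case (insert i I)
  have "coprime (p i) (\<Prod>i\<in>I. p i)" using insert by (intro prod_coprime_right) auto
  then show ?case using insert by (auto intro: divides_mult)
qed simp

text \<open>The dividend is P times \<open>Theta0\<close>, minus P^2, minus the square of \<nu> P +
  \<Sum> A j; this is P times the left-hand side of \<open>Theta0_cong\<close> for N = 0.
  Divisibility is checked for coprime moduli. If all \<open>p j\<close> are odd, these are 4 and the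
  \<open>p j\<close>; otherwise exactly one \<open>p i\<close> is even, and 4 has to be treated
  together with it as the modulus 4 * \<open>p i\<close>.\<close>

lemma Theta_numerator_dvd:
  fixes p S :: "nat \<Rightarrow> int"
  assumes I: "finite I" and pos: "\<And>j. j \<in> I \<Longrightarrow> p j > 0"
    and cop: "\<And>i j. i \<in> I \<Longrightarrow> j \<in> I \<Longrightarrow> i \<noteq> j \<Longrightarrow> coprime (p i) (p j)"
  defines "A \<equiv> cofactor I p" and "P \<equiv> (\<Prod>j\<in>I. p j)" and "\<nu> \<equiv> int (card I) - 1"
  assumes S: "\<And>j. j \<in> I \<Longrightarrow> 4 * p j dvd A j * S j -
      (((A j)\<^sup>2 + 1) * ((p j - 1) * (2 * p j - 1)) - 3 * p j * (p j - 1) * (2 * A j - 1))"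
    and S_odd: "\<And>j. j \<in> I \<Longrightarrow> odd (p j) \<Longrightarrow> 4 dvd S j - (p j - 1)"
  shows "4 * P dvd 3 * P - 1 + (\<Sum>j\<in>I. A j * S j) - P\<^sup>2 * (1 + \<nu>\<^sup>2)
      - 2 * \<nu> * P * (\<Sum>j\<in>I. A j) - (\<Sum>j\<in>I. A j)\<^sup>2" (is "_ dvd ?Y")
proof -
  have odd_sum: "\<exists>t. (\<Sum>j\<in>J. c j * S j) = (\<Sum>j\<in>J. c j * (p j - 1)) + 4 * t"
    if "J \<subseteq> I" "\<And>j. j \<in> J \<Longrightarrow> odd (p j)" for J c
  proof -
    have "4 dvd (\<Sum>j\<in>J. c j * (S j - (p j - 1)))"
      using that S_odd by (intro dvd_sum dvd_mult) auto
    then obtain t where "(\<Sum>j\<in>J. c j * (S j - (p j - 1))) = 4 * t" by (elim dvdE)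
    then show ?thesis by (intro exI[of _ t]) (simp add: right_diff_distrib sum_subtractf)
  qed
  \<comment> \<open>Modulo \<open>p i\<close> both P and the cofactors \<open>A j\<close> with j
    different from i vanish. What remains is \<open>A i * S i - 1 - (A i)\<^sup>2\<close>, and the
    hypothesis on \<open>S i\<close> makes it 0.\<close>
  have local: "p i dvd ?Y" if i: "i \<in> I" for i
  proof -
    have other: "p i dvd (\<Sum>j\<in>I - {i}. A j * c j)" for c
      using i I unfolding A_def by (intro dvd_sum dvd_mult2 dvd_cofactor) auto
    obtain a where a: "(\<Sum>j\<in>I - {i}. A j * S j) = p i * a" using other[of S] by (elim dvdE)
    obtain b where "(\<Sum>j\<in>I - {i}. A j * 1) = p i * b" using other[of "\<lambda>_. 1"] by (elim dvdE)
    then have b: "(\<Sum>j\<in>I. A j) = A i + p i * b" using i I by (simp add: sum.remove)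
    obtain d where "A i * S i - (((A i)\<^sup>2 + 1) * ((p i - 1) * (2 * p i - 1)) - 3 * p i * (p i - 1) * (2 * A i - 1))
        = 4 * p i * d" using S[OF i] by (elim dvdE)
    then have d: "A i * S i = ((A i)\<^sup>2 + 1) * ((p i - 1) * (2 * p i - 1)) - 3 * p i * (p i - 1) * (2 * A i - 1)
        + 4 * p i * d" by simp
    have S': "(\<Sum>j\<in>I. A j * S j) = A i * S i + p i * a" using i I a by (simp add: sum.remove)
    have P: "P = p i * A i" using cofactor_mult[OF I i, of p] by (simp add: A_def P_def)
    have "?Y = p i * (3 * A i + ((A i)\<^sup>2 + 1) * (2 * p i - 3) - 3 * (p i - 1) * (2 * A i - 1) + 4 * d + a
        - p i * (A i)\<^sup>2 * (1 + \<nu>\<^sup>2) - 2 * \<nu> * A i * (A i + p i * b) - 2 * A i * b - p i * b\<^sup>2)"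
      unfolding S' d b P by (simp add: power2_eq_square algebra_simps)
    then show ?thesis by simp
  qed
  show ?thesis
  proof (cases "\<forall>j\<in>I. odd (p j)")
    case True
    obtain s where s: "(\<Sum>j\<in>I. A j * S j) = (\<Sum>j\<in>I. A j * (p j - 1)) + 4 * s"
      using odd_sum[of I A] True by auto
    have Ap: "(\<Sum>j\<in>I. A j * (p j - 1)) = (\<nu> + 1) * P - (\<Sum>j\<in>I. A j)"
      using sum_cofactor_mult[OF I, of p] by (simp add: A_def P_def \<nu>_def)
    obtain t where "(\<Sum>j\<in>I. A j) - (1 + \<nu> * P) = 4 * t"
      using sum_cofactor_odd[OF I, of p] True by (auto simp: A_def P_def \<nu>_def elim!: dvdE)
    then have t: "(\<Sum>j\<in>I. A j) = 1 + \<nu> * P + 4 * t" by simp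
    have "odd P" unfolding P_def using True I by (auto simp: even_prod_iff)
    then obtain u where u: "P = 2 * u + 1" by (elim oddE)
    \<comment> \<open>After the substitutions the dividend is a polynomial in \<nu>, s, t and u,
      from which 4 splits off by expansion. In the other case 4 * \<open>p i\<close> splits off in
      the same way.\<close>
    have "?Y = 4 * (s + - \<nu> - 3 * t + u - \<nu> * \<nu> - 4 * \<nu> * t - 2 * \<nu> * u - 4 * t * t - u * u
        - 4 * \<nu> * \<nu> * u - 8 * \<nu> * t * u - 4 * \<nu> * \<nu> * u * u)"
      unfolding s Ap t u by (simp add: power2_eq_square algebra_simps)
    then have "4 dvd ?Y" by simp
    moreover have "P dvd ?Y" unfolding P_def
      using local cop by (intro prod_dvd_of_coprime I) (auto simp: P_def)
    moreover have "coprime 4 P"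
      using \<open>odd P\<close> coprime_power_left_iff[of 2 2 P] by simp
    ultimately show ?thesis by (rule divides_mult)
  next
    case False
    then obtain i where i: "i \<in> I" "even (p i)" by auto
    define J where "J = I - {i}"
    have J: "finite J" "i \<notin> J" "I = insert i J" using I i by (auto simp: J_def)
    have oddJ: "odd (p j)" if "j \<in> J" for j
    proof
      assume "even (p j)"
      with i cop[of i j] that J(2) J(3) show False
        by (metis coprime_common_divisor insertCI odd_one)
    qed
    \<comment> \<open>\<open>B\<close> consists of the cofactors among the odd factors only, so that
      \<open>sum_cofactor_odd\<close> applies to it. Multiplication by \<open>p i\<close> lifts its
      congruence modulo 4 to one modulo 4 * \<open>p i\<close> for the cofactors
      \<open>A j\<close>.\<close>
    define B where "B = cofactor J p"
    have AB: "A j = p i * B j" if "j \<in> J" for j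
      unfolding A_def B_def J(3) using cofactor_insert(2)[OF J(1,2) that, of p] .
    have Ai: "A i = (\<Prod>j\<in>J. p j)" unfolding A_def J(3) using cofactor_insert(1)[OF J(1,2)] .
    have P: "P = p i * A i" using cofactor_mult[OF I i(1), of p] by (simp add: A_def P_def)
    have oddA: "odd (A i)" unfolding Ai using oddJ J by (auto simp: even_prod_iff)
    have card: "\<nu> = int (card J)" using J by (simp add: \<nu>_def)
    obtain t where "(\<Sum>j\<in>J. B j) - (1 + (\<nu> - 1) * A i) = 4 * t"
      using sum_cofactor_odd[OF J(1), of p] oddJ by (auto simp: B_def Ai card elim!: dvdE)
    then have t: "(\<Sum>j\<in>J. B j) = 1 + (\<nu> - 1) * A i + 4 * t" by simp
    have sumA: "(\<Sum>j\<in>I. A j) = A i + p i * (\<Sum>j\<in>J. B j)"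
      unfolding J(3) using J(1,2) AB by (simp add: sum_distrib_left)
    obtain s where s: "(\<Sum>j\<in>J. B j * S j) = (\<Sum>j\<in>J. B j * (p j - 1)) + 4 * s"
      using odd_sum[of J B] oddJ J(3) by auto
    have Bp: "(\<Sum>j\<in>J. B j * (p j - 1)) = \<nu> * A i - (\<Sum>j\<in>J. B j)"
      using sum_cofactor_mult[OF J(1), of p] by (simp add: B_def Ai card)
    have sumAS: "(\<Sum>j\<in>I. A j * S j) = A i * S i + p i * (\<Sum>j\<in>J. B j * S j)"
      unfolding J(3) using J(1,2) AB by (simp add: sum_distrib_left mult.assoc)
    obtain d where "A i * S i - (((A i)\<^sup>2 + 1) * ((p i - 1) * (2 * p i - 1)) - 3 * p i * (p i - 1) * (2 * A i - 1))
        = 4 * p i * d" using S[OF i(1)] by (elim dvdE)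
    then have d: "A i * S i = ((A i)\<^sup>2 + 1) * ((p i - 1) * (2 * p i - 1)) - 3 * p i * (p i - 1) * (2 * A i - 1)
        + 4 * p i * d" by simp
    obtain u where u: "A i = 2 * u + 1" using oddA by (elim oddE)
    obtain b where b: "p i = 2 * b" using i by (elim evenE)
    have Y: "?Y = 4 * p i * (d + s - \<nu> - 3 * t + 3 * u - 4 * b * u - 4 * \<nu> * u - 4 * t * u - u * u
        - 2 * b * \<nu> * \<nu> - 8 * b * \<nu> * t + 4 * b * \<nu> * u - 8 * b * t * t + 8 * b * t * u
        - 4 * \<nu> * u * u - 8 * b * \<nu> * \<nu> * u - 16 * b * \<nu> * t * u + 8 * b * \<nu> * u * u
        - 8 * b * \<nu> * \<nu> * u * u)" (is "_ = _ * ?Q")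
      unfolding sumAS s Bp sumA t d P unfolding u b by (simp add: power2_eq_square algebra_simps)
    then have "4 * p i dvd ?Y" by simp
    moreover have "A i dvd ?Y" unfolding Ai
      using local cop J by (intro prod_dvd_of_coprime) auto
    moreover have "coprime (4 * p i) (A i)"
    proof -
      have "coprime (p i) (A i)" unfolding Ai using cop J by (intro prod_coprime_right) auto
      moreover have "coprime 4 (A i)" using oddA coprime_power_left_iff[of 2 2 "A i"] by simp
      ultimately show ?thesis by simp
    qed
    ultimately have "4 * p i * A i dvd ?Y" by (rule divides_mult)
    then show ?thesis unfolding P by (simp add: mult.assoc)
  qed
qed

section \<open>Seifert data\<close>

lemma sum_residues_permute:
  fixes f :: "int \<Rightarrow> 'a :: comm_monoid_add" and u v :: "int \<Rightarrow> int"
  assumes "M > 0" and f: "\<And>x y. [x = y] (mod int M) \<Longrightarrow> f x = f y"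
    and u: "\<And>x y. [x = y] (mod int M) \<Longrightarrow> [u x = u y] (mod int M)"
    and v: "\<And>x y. [x = y] (mod int M) \<Longrightarrow> [v x = v y] (mod int M)"
    and inv: "\<And>x. [u (v x) = x] (mod int M)" "\<And>x. [v (u x) = x] (mod int M)"
  shows "(\<Sum>k<M. f (u (int k))) = (\<Sum>k<M. f (int k))"
proof (rule sum.reindex_bij_witness[of _ "\<lambda>k. nat (v (int k) mod int M)" "\<lambda>k. nat (u (int k) mod int M)"])
  fix k assume k: "k \<in> {..<M}"
  show "nat (u (int k) mod int M) \<in> {..<M}" "nat (v (int k) mod int M) \<in> {..<M}"
    using assms(1) by (auto simp: nat_less_iff)
  have "[v (u (int k) mod int M) = v (u (int k))] (mod int M)"
       "[u (v (int k) mod int M) = u (v (int k))] (mod int M)"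
    using v[of "u (int k) mod int M" "u (int k)"] u[of "v (int k) mod int M" "v (int k)"]
    by (simp_all add: cong_def)
  then have "[v (u (int k) mod int M) = int k] (mod int M)" "[u (v (int k) mod int M) = int k] (mod int M)"
    using inv cong_trans by blast+
  then show "nat (v (int (nat (u (int k) mod int M))) mod int M) = k"
    "nat (u (int (nat (v (int k) mod int M))) mod int M) = k"
    using k assms(1) by (auto simp: cong_def)
  show "f (int (nat (u (int k) mod int M))) = f (u (int k))"
    using assms(1) by (intro f) (auto simp: cong_def)
qed

lemma cis_add_2pi_int: "cis (x + 2 * pi * of_int m) = cis x"
  by (simp add: cis_2pi_int flip: cis_mult)

text \<open>Completing the square, - k^2 + 2 k e = e^2 - (k - e)^2; shifting the summation index by
  e leaves the conjugate of the Gauss sum.\<close>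

lemma cis_square_eq_sum:
  assumes M: "even M" "M > 0"
  shows "cis (pi * (of_int e)\<^sup>2 / real M) = cis (pi / 4) / of_real (sqrt M) *
    (\<Sum>k<M. cis (- pi * (real k)\<^sup>2 / real M) * cis (2 * pi * real k * of_int e / real M))"
proof -
  define f where "f = (\<lambda>x::int. cis (- pi * (of_int x)\<^sup>2 / real M))"
  obtain m where m: "M = 2 * m" using M by auto
  have f: "f x = f y" if "[x = y] (mod int M)" for x y
  proof -
    have "int M dvd x - y" using that by (simp add: cong_iff_dvd_diff)
    then obtain j where "x - y = int M * j" by (elim dvdE)
    then have j: "x = y + int M * j" by simp
    have "- pi * (of_int x)\<^sup>2 / real M =
        - pi * (of_int y)\<^sup>2 / real M + 2 * pi * of_int (- y * j - int m * j\<^sup>2)"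
      using M unfolding j m by (simp add: power2_eq_square field_simps)
    then show ?thesis unfolding f_def by (simp only: cis_add_2pi_int)
  qed
  have "(\<Sum>k<M. cis (- pi * (real k)\<^sup>2 / real M) * cis (2 * pi * real k * of_int e / real M)) =
      (\<Sum>k<M. cis (pi * (of_int e)\<^sup>2 / real M) * f (int k - e))"
    unfolding f_def cis_mult using M
    by (intro sum.cong refl arg_cong[of _ _ cis]) (simp add: power2_eq_square field_simps)
  also have "\<dots> = cis (pi * (of_int e)\<^sup>2 / real M) * (\<Sum>k<M. f (int k - e))"
    by (simp add: sum_distrib_left)
  also have "(\<Sum>k<M. f (int k - e)) = (\<Sum>k<M. f (int k))"
    by (rule sum_residues_permute[of _ _ _ "\<lambda>x. x + e"]) (use M f in \<open>auto intro: cong_add cong_diff\<close>)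
  also have "\<dots> = cnj (gauss_sum M)" by (simp add: gauss_sum_def f_def cis_cnj)
  also have "\<dots> = of_real (sqrt M) * cis (- (pi / 4))"
    using gauss_sum_even[OF M] by (simp add: cis_cnj)
  finally show ?thesis using M by (simp add: cis_mult)
qed

text \<open>Every sign vector is connected to the all-ones vector by single flips, so independence
  of the signs can be checked one index at a time.\<close>

lemma signs_flip_invariant:
  fixes n :: nat
  assumes "\<And>\<epsilon> j. \<epsilon> \<in> {1..n} \<rightarrow>\<^sub>E {- 1, 1} \<Longrightarrow> j \<in> {1..n} \<Longrightarrow> u (\<epsilon>(j := - \<epsilon> j)) = u \<epsilon>"
    and "\<epsilon> \<in> {1..n} \<rightarrow>\<^sub>E {- 1, 1 :: int}"
  shows "u \<epsilon> = u (\<lambda>j\<in>{1..n}. 1)"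
  using assms(2)
proof (induction "card {j \<in> {1..n}. \<epsilon> j = - 1}" arbitrary: \<epsilon>)
  case 0
  have "finite {j \<in> {1..n}. \<epsilon> j = - 1}" by (rule finite_subset[of _ "{1..n}"]) auto
  then have "{j \<in> {1..n}. \<epsilon> j = - 1} = {}" using 0(1) by (metis card_0_eq)
  then have "\<epsilon> j = 1" if "j \<in> {1..n}" for j using that 0(2) by (auto simp: PiE_iff)
  then have "\<epsilon> = (\<lambda>j\<in>{1..n}. 1)" using 0 by (auto simp: PiE_iff fun_eq_iff extensional_def)
  then show ?case by simp
next
  case (Suc k)
  then have "{j \<in> {1..n}. \<epsilon> j = - 1} \<noteq> {}" by (metis card.empty nat.distinct(1))
  then obtain j where j: "j \<in> {1..n}" "\<epsilon> j = - 1" by auto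
  define \<delta> where "\<delta> = \<epsilon>(j := - \<epsilon> j)"
  have "\<delta> \<in> {1..n} \<rightarrow>\<^sub>E {- 1, 1}" using Suc.prems j by (auto simp: \<delta>_def PiE_iff extensional_def)
  moreover have "{i \<in> {1..n}. \<delta> i = - 1} = {i \<in> {1..n}. \<epsilon> i = - 1} - {j}"
    using j by (auto simp: \<delta>_def)
  then have "k = card {i \<in> {1..n}. \<delta> i = - 1}" using Suc.hyps(2) j by simp
  ultimately have "u \<delta> = u (\<lambda>j\<in>{1..n}. 1)" using Suc.hyps(1) by blast
  moreover have "u \<delta> = u \<epsilon>" unfolding \<delta>_def using Suc.prems j assms(1) by blast
  ultimately show ?case by simp
qed

locale seifert =
  fixes n :: nat and p :: "nat \<Rightarrow> nat" and q :: "nat \<Rightarrow> int"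
  assumes n: "n \<ge> 1"
    and p: "\<And>j. j \<in> {1..n} \<Longrightarrow> p j \<ge> 2"
    and cop: "\<And>i j. i \<in> {1..n} \<Longrightarrow> j \<in> {1..n} \<Longrightarrow> i \<noteq> j \<Longrightarrow> coprime (p i) (p j)"
    and pq: "real (prod_p n p) * (\<Sum>i = 1..n. real_of_int (q i) / real (p i)) = 1"
begin

abbreviation signs :: "(nat \<Rightarrow> int) set" where "signs \<equiv> {1..n} \<rightarrow>\<^sub>E {- 1, 1}"

abbreviation P :: nat where "P \<equiv> prod_p n p"

definition A :: "nat \<Rightarrow> int" where "A = cofactor {1..n} (\<lambda>j. int (p j))"

lemma P_pos: "P > 0"
  unfolding prod_p_def using p by (intro prod_pos) fastforce

lemma P_eq_prod: "int P = (\<Prod>j = 1..n. int (p j))"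
  by (simp add: prod_p_def)

lemma mult_A: "j \<in> {1..n} \<Longrightarrow> int (p j) * A j = int P"
  unfolding A_def P_eq_prod by (rule cofactor_mult) auto

lemma of_int_A: "j \<in> {1..n} \<Longrightarrow> real_of_int (A j) = real P / real (p j)"
proof -
  assume j: "j \<in> {1..n}"
  have "real_of_int (int (p j) * A j) = real_of_int (int P)" unfolding mult_A[OF j] ..
  then show ?thesis using p[OF j] by (simp add: field_simps)
qed

lemma dvd_A: "i \<in> {1..n} \<Longrightarrow> i \<noteq> j \<Longrightarrow> int (p i) dvd A j"
  unfolding A_def by (rule dvd_cofactor) auto

lemma sum_q_A: "(\<Sum>i = 1..n. q i * A i) = 1"
proof -
  have "real_of_int (\<Sum>i = 1..n. q i * A i) = real P * (\<Sum>i = 1..n. real_of_int (q i) / real (p i))"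
    unfolding sum_distrib_left of_int_sum by (intro sum.cong refl) (simp add: of_int_A)
  also have "\<dots> = real_of_int 1" using pq by simp
  finally show ?thesis by (simp only: of_int_eq_iff)
qed

text \<open>Reducing \<open>sum_q_A\<close> modulo \<open>p j\<close> shows that \<open>A j\<close>
  is the inverse of \<open>q j\<close>; it plays the role of h in
  \<open>dedekind_sum_cong\<close>.\<close>

lemma q_mult_A: assumes "j \<in> {1..n}" obtains w where "q j * A j = 1 + int (p j) * w"
proof -
  have "int (p j) dvd (\<Sum>i\<in>{1..n} - {j}. q i * A i)"
    using assms by (intro dvd_sum dvd_mult dvd_A) auto
  then obtain w where "(\<Sum>i\<in>{1..n} - {j}. q i * A i) = int (p j) * w" by (elim dvdE)
  then have "q j * A j = 1 + int (p j) * (- w)"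
    using sum_q_A sum.remove[of "{1..n}" j "\<lambda>i. q i * A i"] assms by simp
  then show ?thesis by (rule that)
qed

text \<open>The exponents of the series are \<open>(phase_num c \<epsilon>)\<^sup>2 / (4 * P)\<close>.\<close>

definition phase_num :: "int \<Rightarrow> (nat \<Rightarrow> int) \<Rightarrow> int" where
  "phase_num c \<epsilon> = int P * c + (\<Sum>j = 1..n. \<epsilon> j * A j)"

lemma phase_num_flip:
  assumes "j \<in> {1..n}"
  shows "phase_num c (\<epsilon>(j := - \<epsilon> j)) = phase_num c \<epsilon> - 2 * \<epsilon> j * A j"
proof -
  have "(\<Sum>i\<in>{1..n} - {j}. (\<epsilon>(j := - \<epsilon> j)) i * A i) = (\<Sum>i\<in>{1..n} - {j}. \<epsilon> i * A i)"
    by (intro sum.cong) auto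
  then show ?thesis
    using assms unfolding phase_num_def by (simp add: sum.remove)
qed

lemma phase_num_local:
  assumes "j \<in> {1..n}" obtains b where "phase_num c \<epsilon> = \<epsilon> j * A j + int (p j) * b"
proof -
  have "int (p j) dvd (\<Sum>i\<in>{1..n} - {j}. \<epsilon> i * A i)"
    using assms by (intro dvd_sum dvd_mult dvd_A) auto
  then obtain b where "(\<Sum>i\<in>{1..n} - {j}. \<epsilon> i * A i) = int (p j) * b" by (elim dvdE)
  then have "phase_num c \<epsilon> = \<epsilon> j * A j + int (p j) * (A j * c + b)"
    using assms unfolding phase_num_def mult_A[OF assms, symmetric]
    by (simp add: sum.remove algebra_simps)
  then show ?thesis by (rule that)
qed

text \<open>Write e for \<open>phase_num c \<epsilon>\<close>. A flip at j replaces e by e - 2 *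
  \<open>\<epsilon> j * A j\<close>, and e differs from \<open>\<epsilon> j * A j\<close> by a
  multiple of \<open>p j\<close>. So e^2 changes by a multiple of 4 * \<open>A j\<close> *
  \<open>p j\<close> = 4 P, the period of the phase.\<close>

lemma cis_phase_num_signs:
  assumes "\<epsilon> \<in> signs"
  shows "cis (pi * (of_int (phase_num c \<epsilon>))\<^sup>2 / (2 * real P)) =
    cis (pi * (of_int (phase_num c (\<lambda>j\<in>{1..n}. 1)))\<^sup>2 / (2 * real P))"
proof (rule signs_flip_invariant[OF _ assms])
  fix \<epsilon> j assume \<epsilon>: "\<epsilon> \<in> signs" and j: "j \<in> {1..n}"
  obtain b where b: "phase_num c \<epsilon> = \<epsilon> j * A j + int (p j) * b" using phase_num_local[OF j] .
  have "(phase_num c (\<epsilon>(j := - \<epsilon> j)))\<^sup>2 = (phase_num c \<epsilon>)\<^sup>2 + 4 * int P * (- \<epsilon> j * b)"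
    unfolding phase_num_flip[OF j] b mult_A[OF j, symmetric]
    by (simp add: power2_eq_square algebra_simps)
  then have eq: "(real_of_int (phase_num c (\<epsilon>(j := - \<epsilon> j))))\<^sup>2 =
      (real_of_int (phase_num c \<epsilon>))\<^sup>2 + 4 * real P * of_int (- \<epsilon> j * b)"
    by (simp only: of_int_power[symmetric] of_int_add of_int_mult of_int_numeral of_int_of_nat_eq)
  then have "pi * (of_int (phase_num c (\<epsilon>(j := - \<epsilon> j))))\<^sup>2 / (2 * real P) =
      pi * (of_int (phase_num c \<epsilon>))\<^sup>2 / (2 * real P) + 2 * pi * of_int (- \<epsilon> j * b)"
    unfolding eq using P_pos by (simp add: field_simps)
  then show "cis (pi * (of_int (phase_num c (\<epsilon>(j := - \<epsilon> j))))\<^sup>2 / (2 * real P)) =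
      cis (pi * (of_int (phase_num c \<epsilon>))\<^sup>2 / (2 * real P))"
    by (simp only: cis_add_2pi_int)
qed

lemma cis_phase_num_shift:
  "cis (pi * (of_int (phase_num (c + 2 * d) \<epsilon>))\<^sup>2 / (2 * real P)) =
    cis (pi * (of_int (phase_num c \<epsilon>))\<^sup>2 / (2 * real P))"
proof -
  have e: "phase_num (c + 2 * d) \<epsilon> = phase_num c \<epsilon> + 2 * int P * d"
    by (simp add: phase_num_def algebra_simps)
  have "pi * (of_int (phase_num (c + 2 * d) \<epsilon>))\<^sup>2 / (2 * real P) =
      pi * (of_int (phase_num c \<epsilon>))\<^sup>2 / (2 * real P) + 2 * pi * of_int (phase_num c \<epsilon> * d + int P * d\<^sup>2)"
    unfolding e using P_pos by (simp add: power2_eq_square field_simps)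
  then show ?thesis by (simp only: cis_add_2pi_int)
qed

text \<open>
  The factor by which the frequencies divisible by \<open>K\<close> enter. The substitution
  \<open>r \<mapsto> (1 - 2 * q j * A j) * r\<close> preserves the quadratic term and flips the sign of index \<open>j\<close>.
\<close>

definition resonant :: "nat \<Rightarrow> int \<Rightarrow> complex" where
  "resonant K e = (\<Sum>r<2 * P. cis (pi * (2 * real r * of_int e - real K * (real r)\<^sup>2) / (2 * real P)))"

lemma resonant_signs:
  assumes "\<epsilon> \<in> signs"
  shows "resonant K (phase_num c \<epsilon>) = resonant K (phase_num c (\<lambda>j\<in>{1..n}. 1))"
proof (rule signs_flip_invariant[OF _ assms])
  fix \<epsilon> j assume \<epsilon>: "\<epsilon> \<in> signs" and j: "j \<in> {1..n}"
  obtain b where b: "phase_num c \<epsilon> = \<epsilon> j * A j + int (p j) * b" using phase_num_local[OF j] .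
  obtain w where w: "q j * A j = 1 + int (p j) * w" using q_mult_A[OF j] .
  define e e' where "e = phase_num c \<epsilon>" and "e' = phase_num c (\<epsilon>(j := - \<epsilon> j))"
  \<comment> \<open>\<sigma> is - 1 modulo \<open>p j\<close> and 1 modulo \<open>A j\<close>. Its
    square is 1 modulo 4 P, not just modulo 2 P, as the quadratic phase with denominator 2 P and
    factor pi requires.\<close>
  define \<sigma> where "\<sigma> = 1 - 2 * (q j * A j)"
  have "\<sigma> * \<sigma> = 1 + 4 * (q j * A j) * (q j * A j - 1)" by (simp add: \<sigma>_def algebra_simps)
  also have "q j * A j - 1 = int (p j) * w" using w by simp
  finally have \<sigma>2: "\<sigma> * \<sigma> = 1 + 4 * int P * (q j * w)"
    unfolding mult_A[OF j, symmetric] by (simp only: mult_ac)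
  have "\<sigma> * e = e - 2 * \<epsilon> j * A j * (q j * A j) - 2 * q j * (int (p j) * A j) * b"
    unfolding \<sigma>_def e_def b by (simp add: algebra_simps)
  also have "\<dots> = e' + 2 * (int (p j) * A j) * (- (\<epsilon> j * w + q j * b))"
    unfolding w unfolding e_def e'_def phase_num_flip[OF j] by (simp add: algebra_simps)
  finally have \<sigma>e: "\<sigma> * e = e' + 2 * int P * (- (\<epsilon> j * w + q j * b))"
    unfolding mult_A[OF j] .
  define f where "f = (\<lambda>x::int. cis (pi * (2 * of_int x * of_int e - real K * (of_int x)\<^sup>2) / (2 * real P)))"
  have f: "f x = f y" if "[x = y] (mod int (2 * P))" for x y
  proof -
    have "int (2 * P) dvd x - y" using that by (simp only: cong_iff_dvd_diff)
    then obtain i where "x - y = int (2 * P) * i" by (elim dvdE)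
    then have i: "x = y + int (2 * P) * i" by simp
    have "pi * (2 * of_int x * of_int e - real K * (of_int x)\<^sup>2) / (2 * real P) =
        pi * (2 * of_int y * of_int e - real K * (of_int y)\<^sup>2) / (2 * real P)
        + 2 * pi * of_int (i * e - int K * y * i - int K * int P * i\<^sup>2)"
      using P_pos unfolding i by (simp add: power2_eq_square field_simps)
    then show ?thesis unfolding f_def by (simp only: cis_add_2pi_int)
  qed
  have "[\<sigma> * \<sigma> = 1] (mod int (2 * P))"
    unfolding \<sigma>2 by (simp add: cong_iff_dvd_diff)
  then have inv: "[\<sigma> * (\<sigma> * x) = x] (mod int (2 * P))" for x
    using cong_scalar_right[of "\<sigma> * \<sigma>" 1 _ x] by (simp add: mult.assoc)
  have "resonant K e' = (\<Sum>r<2 * P. f (\<sigma> * int r))"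
    unfolding resonant_def f_def
  proof (intro sum.cong refl)
    fix r
    have *: "2 * real_of_int (\<sigma> * int r) * of_int e - real K * (of_int (\<sigma> * int r))\<^sup>2 =
        2 * (real_of_int (\<sigma> * e) * real r) - real K * (of_int (\<sigma> * \<sigma>) * (real r)\<^sup>2)"
      by (simp add: power2_eq_square algebra_simps)
    have **: "2 * (real_of_int (\<sigma> * e) * real r) - real K * (of_int (\<sigma> * \<sigma>) * (real r)\<^sup>2) =
      2 * (of_int e' + 2 * real P * of_int (- (\<epsilon> j * w + q j * b))) * real r
      - real K * ((1 + 4 * real P * of_int (q j * w)) * (real r)\<^sup>2)"
      unfolding \<sigma>2 \<sigma>e by simp
    have "pi * (2 * of_int (\<sigma> * int r) * of_int e - real K * (of_int (\<sigma> * int r))\<^sup>2) / (2 * real P) =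
      pi * (2 * real r * of_int e' - real K * (real r)\<^sup>2) / (2 * real P)
       + 2 * pi * of_int (- (\<epsilon> j * w + q j * b) * int r - int K * (q j * w) * (int r)\<^sup>2)"
      unfolding * ** using P_pos by (simp add: power2_eq_square field_simps)
    then show "cis (pi * (2 * real r * of_int e' - real K * (real r)\<^sup>2) / (2 * real P)) =
      cis (pi * (2 * of_int (\<sigma> * int r) * of_int e - real K * (of_int (\<sigma> * int r))\<^sup>2) / (2 * real P))"
      by (simp only: cis_add_2pi_int)
  qed
  also have "\<dots> = (\<Sum>r<2 * P. f (int r))"
    using P_pos by (intro sum_residues_permute[of _ _ _ "\<lambda>x. \<sigma> * x"] f inv cong_scalar_left) auto
  also have "\<dots> = resonant K e" by (simp add: resonant_def f_def)
  finally show "resonant K e' = resonant K e" .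
qed

end

section \<open>Decomposition of the series into frequencies\<close>

lemma Phi_sum_sums_Phi_sum:
  assumes "n \<ge> 1" "0 < h" "norm z \<le> 1" "damped h G"
  shows "(\<lambda>m. of_int (Phi_coeff n m) * z ^ m * of_real (G (x + real m))) sums Phi_sum n z G x"
  unfolding Phi_sum_def using Phi_sum_sums[OF assms, of x] by (intro summable_sums) (rule sums_summable)

context seifert
begin

abbreviation gauss :: "real \<Rightarrow> real \<Rightarrow> real" where "gauss h \<equiv> scaled_gauss_deriv 0 h"

definition shift :: "(nat \<Rightarrow> int) \<Rightarrow> real" where
  "shift \<epsilon> = (\<Sum>j = 1..n. of_int (\<epsilon> j) * (1 / (2 * real (p j))))"

definition centre :: "nat \<Rightarrow> nat \<Rightarrow> real" where
  "centre N i = real i - (real N - 1) / 2 + (real n - 2) / 2"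

text \<open>Twice \<open>centre\<close>, as an integer, so that congruences can be applied to the
  phase.\<close>

definition centre_num :: "nat \<Rightarrow> nat \<Rightarrow> int" where
  "centre_num N i = 2 * int i + int n - int N - 1"

lemma phase_num_eq:
  "real_of_int (phase_num (centre_num N i + 2 * int m) \<epsilon>) = 2 * real P * (centre N i + shift \<epsilon> + real m)"
proof -
  have s: "2 * real P * shift \<epsilon> = (\<Sum>j = 1..n. real_of_int (\<epsilon> j * A j))"
    unfolding shift_def sum_distrib_left by (intro sum.cong refl) (simp add: of_int_A)
  have c: "2 * centre N i = 2 * real i + real n - real N - 1"
    by (simp add: centre_def field_simps)
  have "2 * real P * (centre N i + shift \<epsilon> + real m) =
      real P * (2 * centre N i) + 2 * real P * shift \<epsilon> + 2 * real P * real m"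
    by (simp add: algebra_simps)
  then show ?thesis
    unfolding s c phase_num_def centre_num_def by (simp add: algebra_simps)
qed

definition Phi_series :: "nat \<Rightarrow> nat \<Rightarrow> real \<Rightarrow> complex" where
  "Phi_series N K h = (\<Sum>i<N. \<Sum>\<epsilon>\<in>signs. of_int (\<Prod>j = 1..n. \<epsilon> j) *
     (\<Sum>m. of_int (Phi_coeff n m) *
       (cis (pi * (of_int (phase_num (centre_num N i + 2 * int m) \<epsilon>))\<^sup>2 / (2 * real P * real K)) *
        of_real (gauss h (centre N i + shift \<epsilon> + real m)))))"

text \<open>With 2 y for the bracket that is squared, the exponent is P y^2 (2 pi i / K - t). The
  imaginary part is the periodic phase, and the real part is a Gaussian of scale h = sqrt (P
  t).\<close>

lemma exp_eq_cis_gauss: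
  assumes "t \<ge> 0" "K > 0"
  shows "exp (of_real (real P / 4 * (2 * real m + 2 * (real i - (real N - 1) / 2) + real n - 2
            + (\<Sum>j = 1..n. real_of_int (\<epsilon> j) / real (p j)))\<^sup>2) * (2 * pi * \<i> / of_nat K - of_real t)) =
    cis (pi * (of_int (phase_num (centre_num N i + 2 * int m) \<epsilon>))\<^sup>2 / (2 * real P * real K)) *
      of_real (gauss (sqrt (real P * t)) (centre N i + shift \<epsilon> + real m))"
proof -
  define y where "y = centre N i + shift \<epsilon> + real m"
  have "2 * real m + 2 * (real i - (real N - 1) / 2) + real n - 2
            + (\<Sum>j = 1..n. real_of_int (\<epsilon> j) / real (p j)) = 2 * y"
  proof -
    have "2 * shift \<epsilon> = (\<Sum>j = 1..n. real_of_int (\<epsilon> j) / real (p j))"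
      unfolding shift_def sum_distrib_left by (intro sum.cong refl) simp
    then show ?thesis unfolding y_def centre_def by (simp add: field_simps)
  qed
  then have *: "real P / 4 * (2 * real m + 2 * (real i - (real N - 1) / 2) + real n - 2
            + (\<Sum>j = 1..n. real_of_int (\<epsilon> j) / real (p j)))\<^sup>2 = real P * y\<^sup>2"
    by (simp only:) (simp add: power2_eq_square)
  have c: "pi * (of_int (phase_num (centre_num N i + 2 * int m) \<epsilon>))\<^sup>2 / (2 * real P * real K)
      = 2 * pi * real P * y\<^sup>2 / real K"
    unfolding phase_num_eq y_def[symmetric] using P_pos assms(2) by (simp add: power2_eq_square field_simps)
  have g: "gauss (sqrt (real P * t)) y = exp (- (real P * t * y\<^sup>2))"
    using assms by (simp add: scaled_gauss_deriv_def gauss_deriv_0 power_mult_distrib)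
  have "complex_of_real (real P * y\<^sup>2) * (2 * pi * \<i> / of_nat K - of_real t) =
      \<i> * of_real (2 * pi * real P * y\<^sup>2 / real K) + of_real (- (real P * t * y\<^sup>2))"
    by (simp add: field_simps)
  then show ?thesis unfolding * y_def[symmetric] c g
    by (simp only: exp_add cis_conv_exp exp_of_real)
qed

lemma wrt_Phi_eq:
  assumes "t \<ge> 0" "K > 0"
  defines "L \<equiv> 2 * pi * \<i> / of_nat K - of_real t"
  shows "wrt_Phi n p q N L = (- 1) ^ n *
     exp (of_real (- (1 / 4) * (Theta0 n p q + ((real N)\<^sup>2 - 1) * real P)) * L) /
     (2 * (exp (1 / 2 * L) - exp (- (1 / 2) * L))) * Phi_series N K (sqrt (real P * t))"
  unfolding wrt_Phi_def Phi_series_def Let_def L_def exp_eq_cis_gauss[OF assms(1,2)] ..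

definition signed_sum :: "nat \<Rightarrow> nat \<Rightarrow> real \<Rightarrow> complex" where
  "signed_sum N i h = (\<Sum>\<epsilon>\<in>signs. of_int (\<Prod>j = 1..n. \<epsilon> j) * Phi_sum n 1 (gauss h) (centre N i + shift \<epsilon>))"

lemma signed_sum_asymp:
  "((\<lambda>h. signed_sum N i h / of_real (h\<^sup>2)) \<longlongrightarrow> of_real (- 2 * (- 1) ^ n / real P)) (at_right 0)"
proof -
  have "(\<Prod>j = 1..n. 2 * (1 / (2 * real (p j)))) = 1 / real P"
    by (simp add: prod_p_def prod_dividef)
  then show ?thesis
    using signed_Phi_sum_1_asymp[OF n, of "centre N i" "\<lambda>j. 1 / (2 * real (p j))"]
    unfolding signed_sum_def shift_def by simp
qed

lemma signed_sum_tendsto_0: "((\<lambda>h. signed_sum N i h) \<longlongrightarrow> 0) (at_right 0)"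
proof -
  have "((\<lambda>h. signed_sum N i h / of_real (h\<^sup>2) * of_real (h\<^sup>2)) \<longlongrightarrow>
      of_real (- 2 * (- 1) ^ n / real P) * of_real (0\<^sup>2)) (at_right 0)"
    by (intro tendsto_mult signed_sum_asymp tendsto_of_real tendsto_power tendsto_ident_at)
  then have "((\<lambda>h. signed_sum N i h / of_real (h\<^sup>2) * of_real (h\<^sup>2)) \<longlongrightarrow> 0) (at_right 0)" by simp
  then show ?thesis
  proof (rule Lim_transform_eventually)
    show "eventually (\<lambda>h. signed_sum N i h / of_real (h\<^sup>2) * of_real (h\<^sup>2) = signed_sum N i h) (at_right 0)"
      using eventually_at_right_0_1 by eventually_elim auto
  qed
qed

text \<open>For K = 1 all terms have the same phase: raising i or m changes the argument of
  \<open>phase_num\<close> by an even integer, and flips of signs do not matter either. Hence no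
  Fourier expansion is used here.\<close>

lemma Phi_series_1:
  assumes "h > 0"
  shows "Phi_series N 1 h =
    cis (pi * (of_int (phase_num (centre_num N 0) (\<lambda>j\<in>{1..n}. 1)))\<^sup>2 / (2 * real P)) *
      (\<Sum>i<N. signed_sum N i h)"
proof -
  define C where "C = cis (pi * (of_int (phase_num (centre_num N 0) (\<lambda>j\<in>{1..n}. 1)))\<^sup>2 / (2 * real P))"
  have C: "cis (pi * (of_int (phase_num (centre_num N i + 2 * int m) \<epsilon>))\<^sup>2 / (2 * real P * real 1)) = C"
    if "\<epsilon> \<in> signs" for i m \<epsilon>
  proof -
    have "centre_num N i + 2 * int m = centre_num N 0 + 2 * (int i + int m)" by (simp add: centre_num_def)
    then show ?thesis unfolding C_def
      by (simp only: cis_phase_num_shift cis_phase_num_signs[OF that] of_nat_1 mult_1_right)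
  qed
  have "(\<Sum>m. of_int (Phi_coeff n m) *
       (cis (pi * (of_int (phase_num (centre_num N i + 2 * int m) \<epsilon>))\<^sup>2 / (2 * real P * real 1)) *
        of_real (gauss h (centre N i + shift \<epsilon> + real m)))) = C * Phi_sum n 1 (gauss h) (centre N i + shift \<epsilon>)"
    if "\<epsilon> \<in> signs" for i \<epsilon>
  proof -
    have "(\<lambda>m. C * (of_int (Phi_coeff n m) * 1 ^ m * of_real (gauss h (centre N i + shift \<epsilon> + real m)))) sums
        (C * Phi_sum n 1 (gauss h) (centre N i + shift \<epsilon>))"
      using assms by (intro sums_mult Phi_sum_sums_Phi_sum[of n h] n damped_scaled_gauss_deriv) auto
    then show ?thesis unfolding C[OF that] by (simp add: sums_iff mult_ac)
  qed
  note inner = this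
  have "Phi_series N 1 h = (\<Sum>i<N. \<Sum>\<epsilon>\<in>signs. of_int (\<Prod>j = 1..n. \<epsilon> j) *
      (C * Phi_sum n 1 (gauss h) (centre N i + shift \<epsilon>)))"
    unfolding Phi_series_def by (intro sum.cong refl arg_cong2[of _ _ _ _ "(*)"] inner)
  also have "\<dots> = C * (\<Sum>i<N. signed_sum N i h)"
    unfolding signed_sum_def sum_distrib_left by (simp only: mult_ac)
  finally show ?thesis unfolding C_def .
qed

text \<open>The Fourier coefficient in \<open>cis_square_eq_sum\<close> for the modulus 2 P
  K.\<close>

definition frequency_weight :: "nat \<Rightarrow> nat \<Rightarrow> complex" where
  "frequency_weight K k = cis (pi / 4) / of_real (sqrt (real (2 * P * K))) *
     cis (- pi * (real k)\<^sup>2 / real (2 * P * K))"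

definition frequency_sum :: "nat \<Rightarrow> nat \<Rightarrow> nat \<Rightarrow> real \<Rightarrow> complex" where
  "frequency_sum N K k h = (\<Sum>i<N. \<Sum>\<epsilon>\<in>signs. of_int (\<Prod>j = 1..n. \<epsilon> j) *
     (cis (2 * pi * real k * (centre N i + shift \<epsilon>) / real K) *
      Phi_sum n (cis (2 * pi * real k / real K)) (gauss h) (centre N i + shift \<epsilon>)))"

text \<open>By \<open>phase_num_eq\<close> the numerator is 2 P (y + m) with y =
  \<open>centre N i + shift \<epsilon>\<close>, so the character of frequency k contributes cis (2
  pi k y / K) times z^m with z = cis (2 pi k / K).\<close>

lemma Phi_series_frequencies:
  assumes "h > 0" "K > 0"
  shows "Phi_series N K h = (\<Sum>k<2 * P * K. frequency_weight K k * frequency_sum N K k h)"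
proof -
  define M where "M = 2 * P * K"
  have M: "even M" "M > 0" using assms P_pos by (auto simp: M_def)
  have inner: "(\<Sum>m. of_int (Phi_coeff n m) *
       (cis (pi * (of_int (phase_num (centre_num N i + 2 * int m) \<epsilon>))\<^sup>2 / (2 * real P * real K)) *
        of_real (gauss h (centre N i + shift \<epsilon> + real m)))) =
      (\<Sum>k<M. frequency_weight K k * (cis (2 * pi * real k * (centre N i + shift \<epsilon>) / real K) *
        Phi_sum n (cis (2 * pi * real k / real K)) (gauss h) (centre N i + shift \<epsilon>)))" for i \<epsilon>
  proof -
    define y where "y = centre N i + shift \<epsilon>"
    have ph: "cis (pi * (of_int (phase_num (centre_num N i + 2 * int m) \<epsilon>))\<^sup>2 / (2 * real P * real K)) =
        (\<Sum>k<M. frequency_weight K k * (cis (2 * pi * real k * y / real K) * cis (2 * pi * real k / real K) ^ m))" for m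
    proof -
      have e: "cis (2 * pi * real k * of_int (phase_num (centre_num N i + 2 * int m) \<epsilon>) / real M) =
          cis (2 * pi * real k * y / real K) * cis (2 * pi * real k / real K) ^ m" for k
      proof -
        have "2 * pi * real k * of_int (phase_num (centre_num N i + 2 * int m) \<epsilon>) / real M =
            2 * pi * real k * y / real K + real m * (2 * pi * real k / real K)"
          unfolding phase_num_eq y_def[symmetric] M_def using assms P_pos by (simp add: field_simps)
        then show ?thesis by (simp only: cis_mult Complex.DeMoivre)
      qed
      have "cis (pi * (of_int (phase_num (centre_num N i + 2 * int m) \<epsilon>))\<^sup>2 / real M) =
        (\<Sum>k<M. frequency_weight K k * (cis (2 * pi * real k * y / real K) * cis (2 * pi * real k / real K) ^ m))"
        unfolding cis_square_eq_sum[OF M] e sum_distrib_left frequency_weight_def M_def[symmetric]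
        by (intro sum.cong refl) (simp only: mult.assoc)
      then show ?thesis by (simp add: M_def)
    qed
    have "(\<lambda>m. \<Sum>k<M. frequency_weight K k * (cis (2 * pi * real k * y / real K) *
        (of_int (Phi_coeff n m) * cis (2 * pi * real k / real K) ^ m * of_real (gauss h (y + real m))))) sums
      (\<Sum>k<M. frequency_weight K k * (cis (2 * pi * real k * y / real K) *
        Phi_sum n (cis (2 * pi * real k / real K)) (gauss h) y))"
      using assms by (intro sums_sum sums_mult Phi_sum_sums_Phi_sum[of n h] n damped_scaled_gauss_deriv) auto
    moreover have "(\<Sum>k<M. frequency_weight K k * (cis (2 * pi * real k * y / real K) *
        (of_int (Phi_coeff n m) * cis (2 * pi * real k / real K) ^ m * of_real (gauss h (y + real m))))) =
       of_int (Phi_coeff n m) * ((\<Sum>k<M. frequency_weight K k * (cis (2 * pi * real k * y / real K) *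
        cis (2 * pi * real k / real K) ^ m)) * of_real (gauss h (y + real m)))" for m
      unfolding sum_distrib_left sum_distrib_right by (intro sum.cong refl) (simp only: mult_ac)
    ultimately show ?thesis unfolding ph y_def[symmetric] by (simp add: sums_iff)
  qed
  have "Phi_series N K h = (\<Sum>i<N. \<Sum>\<epsilon>\<in>signs. \<Sum>k<M. frequency_weight K k *
     (of_int (\<Prod>j = 1..n. \<epsilon> j) * (cis (2 * pi * real k * (centre N i + shift \<epsilon>) / real K) *
        Phi_sum n (cis (2 * pi * real k / real K)) (gauss h) (centre N i + shift \<epsilon>))))"
    unfolding Phi_series_def inner sum_distrib_left by (intro sum.cong refl) (simp only: mult_ac)
  also have "\<dots> = (\<Sum>i<N. \<Sum>k<M. \<Sum>\<epsilon>\<in>signs. frequency_weight K k *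
     (of_int (\<Prod>j = 1..n. \<epsilon> j) * (cis (2 * pi * real k * (centre N i + shift \<epsilon>) / real K) *
        Phi_sum n (cis (2 * pi * real k / real K)) (gauss h) (centre N i + shift \<epsilon>))))"
    by (intro sum.cong refl sum.swap)
  also have "\<dots> = (\<Sum>k<M. \<Sum>i<N. \<Sum>\<epsilon>\<in>signs. frequency_weight K k *
     (of_int (\<Prod>j = 1..n. \<epsilon> j) * (cis (2 * pi * real k * (centre N i + shift \<epsilon>) / real K) *
        Phi_sum n (cis (2 * pi * real k / real K)) (gauss h) (centre N i + shift \<epsilon>))))"
    by (rule sum.swap)
  finally show ?thesis unfolding frequency_sum_def M_def sum_distrib_left .
qed

text \<open>At k = K * r one has z = 1 for every r, so only the phases depend on r and they add up
  to \<open>resonant\<close>. This sum no longer depends on the signs, which leaves the pure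
  alternating sum \<open>signed_sum\<close>.\<close>

lemma resonant_part:
  assumes "K > 0"
  shows "(\<Sum>k | k < 2 * P * K \<and> K dvd k. frequency_weight K k * frequency_sum N K k h) =
    cis (pi / 4) / of_real (sqrt (real (2 * P * K))) *
      (\<Sum>i<N. resonant K (phase_num (centre_num N i) (\<lambda>j\<in>{1..n}. 1)) * signed_sum N i h)"
proof -
  define g where "g = cis (pi / 4) / of_real (sqrt (real (2 * P * K)))"
  have "(\<Sum>k | k < 2 * P * K \<and> K dvd k. frequency_weight K k * frequency_sum N K k h) =
      (\<Sum>r<2 * P. frequency_weight K (K * r) * frequency_sum N K (K * r) h)"
    using assms by (intro sum.reindex_bij_witness[of _ "\<lambda>r. K * r" "\<lambda>k. k div K"])
      (auto simp: less_mult_imp_div_less mult.commute)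
  also have "\<dots> = (\<Sum>r<2 * P. \<Sum>i<N. \<Sum>\<epsilon>\<in>signs. g * (of_int (\<Prod>j = 1..n. \<epsilon> j) *
      (cis (pi * (2 * real r * of_int (phase_num (centre_num N i) \<epsilon>) - real K * (real r)\<^sup>2) / (2 * real P)) *
       Phi_sum n 1 (gauss h) (centre N i + shift \<epsilon>))))"
  proof (intro sum.cong refl)
    fix r
    have z: "cis (2 * pi * real (K * r) / real K) = 1"
      using assms cis_2pi_int[of "int r"] by (simp add: field_simps)
    have w: "frequency_weight K (K * r) * (X * (cis (2 * pi * real (K * r) * (centre N i + shift \<epsilon>) / real K) * Y)) =
      g * (X * (cis (pi * (2 * real r * of_int (phase_num (centre_num N i) \<epsilon>) - real K * (real r)\<^sup>2) / (2 * real P)) * Y))"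
      for X Y i \<epsilon>
    proof -
      have "- pi * (real (K * r))\<^sup>2 / real (2 * P * K) + 2 * pi * real (K * r) * (centre N i + shift \<epsilon>) / real K =
        pi * (2 * real r * of_int (phase_num (centre_num N i + 2 * int 0) \<epsilon>) - real K * (real r)\<^sup>2) / (2 * real P)"
        unfolding phase_num_eq using assms P_pos by (simp add: power2_eq_square field_simps)
      then have c: "cis (- pi * (real (K * r))\<^sup>2 / real (2 * P * K)) * cis (2 * pi * real (K * r) * (centre N i + shift \<epsilon>) / real K)
         = cis (pi * (2 * real r * of_int (phase_num (centre_num N i) \<epsilon>) - real K * (real r)\<^sup>2) / (2 * real P))"
        by (simp add: cis_mult)
      have "(a * b) * (X * (c * Y)) = a * (X * ((b * c) * Y))" for a b c by (simp only: mult_ac)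
      then show ?thesis unfolding frequency_weight_def g_def[symmetric] by (simp only: c)
    qed
    show "frequency_weight K (K * r) * frequency_sum N K (K * r) h = (\<Sum>i<N. \<Sum>\<epsilon>\<in>signs. g * (of_int (\<Prod>j = 1..n. \<epsilon> j) *
      (cis (pi * (2 * real r * of_int (phase_num (centre_num N i) \<epsilon>) - real K * (real r)\<^sup>2) / (2 * real P)) *
       Phi_sum n 1 (gauss h) (centre N i + shift \<epsilon>))))"
      unfolding frequency_sum_def z sum_distrib_left w ..
  qed
  also have "\<dots> = (\<Sum>i<N. \<Sum>\<epsilon>\<in>signs. \<Sum>r<2 * P. g * (of_int (\<Prod>j = 1..n. \<epsilon> j) *
      (cis (pi * (2 * real r * of_int (phase_num (centre_num N i) \<epsilon>) - real K * (real r)\<^sup>2) / (2 * real P)) *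
       Phi_sum n 1 (gauss h) (centre N i + shift \<epsilon>))))"
    by (subst sum.swap, intro sum.cong refl sum.swap)
  also have "\<dots> = (\<Sum>i<N. \<Sum>\<epsilon>\<in>signs. g * (resonant K (phase_num (centre_num N i) \<epsilon>) *
      (of_int (\<Prod>j = 1..n. \<epsilon> j) * Phi_sum n 1 (gauss h) (centre N i + shift \<epsilon>))))"
    unfolding resonant_def sum_distrib_left sum_distrib_right by (intro sum.cong refl) (simp only: mult_ac)
  also have "\<dots> = (\<Sum>i<N. \<Sum>\<epsilon>\<in>signs. g * (resonant K (phase_num (centre_num N i) (\<lambda>j\<in>{1..n}. 1)) *
      (of_int (\<Prod>j = 1..n. \<epsilon> j) * Phi_sum n 1 (gauss h) (centre N i + shift \<epsilon>))))"
    by (intro sum.cong refl) (simp only: resonant_signs)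
  finally show ?thesis by (simp only: g_def[symmetric] signed_sum_def sum_distrib_left)
qed

definition frequency_limit :: "nat \<Rightarrow> nat \<Rightarrow> nat \<Rightarrow> complex" where
  "frequency_limit N K k = (\<Sum>i<N. \<Sum>\<epsilon>\<in>signs. of_int (\<Prod>j = 1..n. \<epsilon> j) *
     (cis (2 * pi * real k * (centre N i + shift \<epsilon>) / real K) *
      ((1 - cis (2 * pi * real k / real K)) / (1 - cis (2 * pi * real k / real K)) ^ (n - 1))))"

lemma cis_frequency_ne_1:
  assumes "K > 0" "\<not> K dvd k"
  shows "cis (2 * pi * real k / real K) \<noteq> 1"
proof
  assume 1: "cis (2 * pi * real k / real K) = 1"
  then have "(\<Sum>r<K. cis (2 * pi * real k * real r / real K)) = (\<Sum>r<K. 1)"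
  proof (intro sum.cong refl)
    fix r
    have "cis (2 * pi * real k * real r / real K) = cis (2 * pi * real k / real K) ^ r"
      by (simp add: Complex.DeMoivre mult_ac)
    then show "cis (2 * pi * real k * real r / real K) = 1" using 1 by simp
  qed
  then show False using sum_cis_multiples[OF assms(1), of k] assms by simp
qed

text \<open>The resonant part tends to 0 because \<open>signed_sum\<close> does. For K = 1 the limit
  is an empty sum; against a vanishing denominator this is not enough, and that case goes through
  \<open>Phi_series_1\<close> instead.\<close>

lemma Phi_series_tendsto:
  assumes "K > 0"
  shows "((\<lambda>h. Phi_series N K h) \<longlongrightarrow>
     (\<Sum>k | k < 2 * P * K \<and> \<not> K dvd k. frequency_weight K k * frequency_limit N K k)) (at_right 0)"
proof -
  define g where "g = cis (pi / 4) / of_real (sqrt (real (2 * P * K)))"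
  define R where "R = (\<lambda>i. resonant K (phase_num (centre_num N i) (\<lambda>j\<in>{1..n}. 1)))"
  have "((\<lambda>h. (\<Sum>k | k < 2 * P * K \<and> \<not> K dvd k. frequency_weight K k * frequency_sum N K k h)
        + g * (\<Sum>i<N. R i * signed_sum N i h)) \<longlongrightarrow>
     (\<Sum>k | k < 2 * P * K \<and> \<not> K dvd k. frequency_weight K k * frequency_limit N K k)
        + g * (\<Sum>i<N. R i * 0)) (at_right 0)"
    unfolding frequency_sum_def frequency_limit_def using cis_frequency_ne_1[OF assms]
    by (intro tendsto_intros signed_sum_tendsto_0 Phi_sum_gauss_tendsto n) auto
  then have lim: "((\<lambda>h. (\<Sum>k | k < 2 * P * K \<and> \<not> K dvd k. frequency_weight K k * frequency_sum N K k h)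
        + g * (\<Sum>i<N. R i * signed_sum N i h)) \<longlongrightarrow>
     (\<Sum>k | k < 2 * P * K \<and> \<not> K dvd k. frequency_weight K k * frequency_limit N K k)) (at_right 0)"
    by simp
  show ?thesis
  proof (rule Lim_transform_eventually[OF lim])
    show "eventually (\<lambda>h. (\<Sum>k | k < 2 * P * K \<and> \<not> K dvd k. frequency_weight K k * frequency_sum N K k h)
        + g * (\<Sum>i<N. R i * signed_sum N i h) = Phi_series N K h) (at_right 0)"
      using eventually_at_right_0_1
    proof eventually_elim
      case (elim h)
      have "{..<2 * P * K} = {k. k < 2 * P * K \<and> \<not> K dvd k} \<union> {k. k < 2 * P * K \<and> K dvd k}" by auto
      then have "Phi_series N K h =
          (\<Sum>k\<in>{k. k < 2 * P * K \<and> \<not> K dvd k} \<union> {k. k < 2 * P * K \<and> K dvd k}.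
            frequency_weight K k * frequency_sum N K k h)"
        using Phi_series_frequencies[of h K N] elim assms by simp
      also have "\<dots> = (\<Sum>k | k < 2 * P * K \<and> \<not> K dvd k. frequency_weight K k * frequency_sum N K k h)
          + (\<Sum>k | k < 2 * P * K \<and> K dvd k. frequency_weight K k * frequency_sum N K k h)"
        by (intro sum.union_disjoint) auto
      finally show ?case unfolding resonant_part[OF assms] g_def R_def ..
    qed
  qed
qed


section \<open>Identification with the terms of \<open>wrt_tau\<close>\<close>

lemma sum_signs_exp:
  "(\<Sum>\<epsilon>\<in>signs. of_int (\<Prod>j = 1..n. \<epsilon> j) * exp (2 * \<theta> * of_real (shift \<epsilon>))) =
    (\<Prod>j = 1..n. esinh (\<theta> / of_nat (p j)))"
proof -
  have "(\<Prod>j = 1..n. esinh (\<theta> / of_nat (p j))) =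
      (\<Prod>j = 1..n. \<Sum>e\<in>{- 1, 1 :: int}. of_int e * exp (of_int e * (\<theta> / of_nat (p j))))"
    by (simp add: esinh_def)
  also have "\<dots> = (\<Sum>\<epsilon>\<in>signs. \<Prod>j = 1..n. of_int (\<epsilon> j) * exp (of_int (\<epsilon> j) * (\<theta> / of_nat (p j))))"
    by (rule prod_sum_PiE) auto
  also have "\<dots> = (\<Sum>\<epsilon>\<in>signs. of_int (\<Prod>j = 1..n. \<epsilon> j) * exp (2 * \<theta> * of_real (shift \<epsilon>)))"
  proof (intro sum.cong refl)
    fix \<epsilon>
    have "2 * \<theta> * of_real (shift \<epsilon>) = (\<Sum>j = 1..n. of_int (\<epsilon> j) * (\<theta> / of_nat (p j)))"
      unfolding shift_def of_real_sum sum_distrib_left by (intro sum.cong refl) simp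
    then show "(\<Prod>j = 1..n. of_int (\<epsilon> j) * exp (of_int (\<epsilon> j) * (\<theta> / of_nat (p j)))) =
        of_int (\<Prod>j = 1..n. \<epsilon> j) * exp (2 * \<theta> * of_real (shift \<epsilon>))"
      by (simp add: exp_sum prod.distrib)
  qed
  finally show ?thesis ..
qed

text \<open>The sum is the quantum integer of N; multiplied by esinh \<theta> it telescopes.\<close>

lemma sum_exp_colours:
  "esinh \<theta> * (\<Sum>i<N. exp (2 * \<theta> * of_real (real i - (real N - 1) / 2))) = esinh (of_nat N * \<theta>)"
proof -
  have "esinh \<theta> * exp (2 * \<theta> * of_real (real i - (real N - 1) / 2)) =
      exp (\<theta> * (2 * of_nat (Suc i) - of_nat N)) - exp (\<theta> * (2 * of_nat i - of_nat N))" for i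
    unfolding esinh_def left_diff_distrib exp_add[symmetric]
    by (intro arg_cong2[of _ _ _ _ "(-)"] arg_cong[of _ _ exp]) (simp_all add: field_simps)
  then have "esinh \<theta> * (\<Sum>i<N. exp (2 * \<theta> * of_real (real i - (real N - 1) / 2))) =
      (\<Sum>i<N. exp (\<theta> * (2 * of_nat (Suc i) - of_nat N)) - exp (\<theta> * (2 * of_nat i - of_nat N)))"
    unfolding sum_distrib_left by (intro sum.cong refl)
  also have "\<dots> = exp (\<theta> * (2 * of_nat N - of_nat N)) - exp (\<theta> * (2 * of_nat 0 - of_nat N))"
    by (rule sum_lessThan_telescope)
  finally show ?thesis by (simp add: esinh_def algebra_simps)
qed

text \<open>Since 1 - z = - exp \<theta> * esinh \<theta>, the power (1 - z)^(2 - n) carries a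
  factor exp (- (n - 2) \<theta>). The offset (n - 2) / 2 in \<open>centre\<close> compensates
  exactly this factor, leaving the sign (-1)^n and a power of esinh \<theta>.\<close>

lemma frequency_limit_eq:
  assumes "K > 0" "\<not> K dvd k"
  defines "\<theta> \<equiv> pi * \<i> * of_nat k / of_nat K"
  shows "frequency_limit N K k = (- 1) ^ n * (esinh (of_nat N * \<theta>) / esinh \<theta>) *
      ((\<Prod>j = 1..n. esinh (\<theta> / of_nat (p j))) / esinh \<theta> powi (int n - 2))"
proof -
  define z where "z = cis (2 * pi * real k / real K)"
  have z: "z = exp (2 * \<theta>)" by (simp add: z_def \<theta>_def cis_conv_exp field_simps)
  have z1: "z \<noteq> 1" unfolding z_def by (rule cis_frequency_ne_1[OF assms(1,2)])
  have zs: "1 - z = - exp \<theta> * esinh \<theta>"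
    by (simp add: z esinh_def algebra_simps mult_2 flip: exp_add)
  then have s0: "esinh \<theta> \<noteq> 0" using z1 by auto
  have e: "cis (2 * pi * real k * (centre N i + s) / real K) =
      exp (2 * \<theta> * of_real (real i - (real N - 1) / 2)) * exp (\<theta> * (of_nat n - 2)) * exp (2 * \<theta> * of_real s)" for i s
  proof -
    define l where "l = real i - (real N - 1) / 2"
    have "\<i> * of_real (2 * pi * real k * (centre N i + s) / real K) = 2 * \<theta> * of_real (centre N i + s)"
      by (simp add: \<theta>_def)
    also have "\<dots> = 2 * \<theta> * of_real l + \<theta> * (of_nat n - 2) + 2 * \<theta> * of_real s"
    proof -
      define w where "w = (real n - 2) / 2"
      have "2 * \<theta> * of_real w = \<theta> * (of_nat n - 2)" by (simp add: w_def)
      then show ?thesis unfolding centre_def l_def[symmetric] w_def[symmetric]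
        by (simp only: of_real_add distrib_left)
    qed
    finally show ?thesis unfolding cis_conv_exp l_def[symmetric] exp_add[symmetric] by simp
  qed
  have "frequency_limit N K k = (\<Sum>i<N. \<Sum>\<epsilon>\<in>signs.
      exp (2 * \<theta> * of_real (real i - (real N - 1) / 2)) * (exp (\<theta> * (of_nat n - 2)) * ((1 - z) / (1 - z) ^ (n - 1))) *
      (of_int (\<Prod>j = 1..n. \<epsilon> j) * exp (2 * \<theta> * of_real (shift \<epsilon>))))"
    unfolding frequency_limit_def e z_def[symmetric] by (intro sum.cong refl) (simp only: mult_ac)
  also have "\<dots> = (\<Sum>i<N. exp (2 * \<theta> * of_real (real i - (real N - 1) / 2))) *
      (exp (\<theta> * (of_nat n - 2)) * ((1 - z) / (1 - z) ^ (n - 1))) * (\<Prod>j = 1..n. esinh (\<theta> / of_nat (p j)))"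
    unfolding sum_distrib_left[symmetric] sum_distrib_right[symmetric] sum_signs_exp ..
  also have "(\<Sum>i<N. exp (2 * \<theta> * of_real (real i - (real N - 1) / 2))) = esinh (of_nat N * \<theta>) / esinh \<theta>"
    using sum_exp_colours[of \<theta> N] s0 by (simp add: field_simps)
  also have "exp (\<theta> * (of_nat n - 2)) * ((1 - z) / (1 - z) ^ (n - 1)) = (- 1) ^ n / esinh \<theta> powi (int n - 2)"
  proof (cases "n = 1")
    case True
    then show ?thesis unfolding zs by (simp add: power_int_minus exp_minus field_simps)
  next
    case False
    then obtain m where m: "n = Suc (Suc m)" using n by (metis One_nat_def Suc_le_D not0_implies_Suc)
    have "(- exp \<theta> * esinh \<theta>) \<noteq> 0" using s0 by simp
    then have "(- exp \<theta> * esinh \<theta>) / (- exp \<theta> * esinh \<theta>) ^ (n - 1) = 1 / (- exp \<theta> * esinh \<theta>) ^ m"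
      using m by (simp add: field_simps)
    also have "(- exp \<theta> * esinh \<theta>) ^ m = (- 1) ^ m * (exp \<theta> ^ m * esinh \<theta> ^ m)"
      by (simp only: mult_minus_left power_minus[of "exp \<theta> * esinh \<theta>"] power_mult_distrib)
    finally have "(1 - z) / (1 - z) ^ (n - 1) = 1 / ((- 1) ^ m * (exp \<theta> ^ m * esinh \<theta> ^ m))"
      unfolding zs .
    moreover have "exp (\<theta> * (of_nat n - 2)) = exp \<theta> ^ m"
      using m by (simp add: mult.commute flip: exp_of_nat_mult)
    moreover have "int n - 2 = int m" "(- 1) ^ n = (- 1 :: complex) ^ m" using m by simp_all
    ultimately show ?thesis by (cases "even m") simp_all
  qed
  finally show ?thesis by simp
qed

lemma esinh_pi_i: "esinh (of_real x * \<i>) = 2 * \<i> * of_real (sin x)"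
  by (simp add: esinh_def complex_eq_iff Re_exp Im_exp)

lemma filterlim_sqrt_mult: "c > 0 \<Longrightarrow> filterlim (\<lambda>t. sqrt (c * t)) (at_right 0) (at_right (0::real))"
proof -
  assume c: "c > 0"
  have "((\<lambda>t. sqrt (c * t)) \<longlongrightarrow> sqrt (c * 0)) (at_right 0)" by (intro tendsto_intros)
  moreover have "eventually (\<lambda>t. sqrt (c * t) > 0) (at_right 0)"
    using eventually_at_right_0_1 by eventually_elim (use c in auto)
  ultimately show ?thesis by (auto simp: filterlim_at elim: eventually_mono)
qed


section \<open>The total phase at K = 1\<close>

lemma odd_sum_cofactor: "odd ((\<Sum>j = 1..n. A j) + (int n - 1) * int P)"
proof -
  have "odd ((\<Sum>j\<in>I. cofactor I (\<lambda>j. int (p j)) j) + (int (card I) - 1) * (\<Prod>j\<in>I. int (p j)))"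
    if "finite I" "I \<subseteq> {1..n}" for I
    using that
  proof (induction I rule: finite_induct)
    case (insert i I)
    define Q where "Q = (\<Prod>j\<in>I. int (p j))"
    define T where "T = (\<Sum>j\<in>I. cofactor I (\<lambda>j. int (p j)) j)"
    have "coprime (int (p i)) (int (p j))" if "j \<in> I" for j
      using that insert(2,4) by (auto intro!: cop)
    then have "coprime (int (p i)) Q" unfolding Q_def by (intro prod_coprime_right)
    \<comment> \<open>Modulo 2 the value for the enlarged set is Q + p Q + p = 1 + (1 + p) (1 + Q)
      with p = \<open>p i\<close>, which is odd as soon as p or Q is.\<close>
    then have "odd (int (p i)) \<or> odd Q" using coprime_common_divisor[of "int (p i)" Q 2] by auto
    moreover have "odd (T + (int (card I) - 1) * Q)" using insert by (simp add: T_def Q_def)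
    ultimately have "odd (Q + int (p i) * Q + int (p i) * (T + (int (card I) - 1) * Q))" by auto
    then show ?case
      unfolding sum_cofactor_insert[OF insert(1,2)] using insert(1,2)
      by (simp add: T_def Q_def algebra_simps)
  qed simp
  from this[of "{1..n}"] show ?thesis by (simp add: A_def P_eq_prod)
qed

text \<open>At K = 1 the phases of the prefactor and of the series combine to cis (- (pi / 2) x)
  with x the left-hand side, so x matters modulo 4. The case N = 0 is
  \<open>Theta_numerator_dvd\<close>; passing to N adds 2 N (\<nu> P + \<Sum> A j), where the
  bracket is odd, hence 2 N modulo 4.\<close>

lemma Theta0_cong:
  obtains z :: int where
    "Theta0 n p q + ((real N)\<^sup>2 - 1) * real P
      - (of_int (phase_num (centre_num N 0) (\<lambda>j\<in>{1..n}. 1)))\<^sup>2 / real P = 2 * real N + 4 * of_int z"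
proof -
  have "\<exists>S::int. 12 * real (p j) * dedekind_sum (q j) (p j) = of_int S \<and>
      4 * int (p j) dvd A j * S - (((A j)\<^sup>2 + 1) * ((int (p j) - 1) * (2 * int (p j) - 1))
        - 3 * int (p j) * (int (p j) - 1) * (2 * A j - 1)) \<and>
      (odd (int (p j)) \<longrightarrow> 4 dvd S - (int (p j) - 1))" if j: "j \<in> {1..n}" for j
  proof -
    obtain w where "q j * A j = 1 + int (p j) * w" using q_mult_A[OF j] .
    then have "[q j * A j = 1] (mod int (p j))" by (simp add: cong_iff_dvd_diff)
    moreover have "p j > 0" using p[OF j] by simp
    ultimately show ?thesis using dedekind_sum_cong[of "p j" "q j" "A j"]
      by (metis even_of_nat)
  qed
  then obtain S :: "nat \<Rightarrow> int" where S: "\<And>j. j \<in> {1..n} \<Longrightarrow> 12 * real (p j) * dedekind_sum (q j) (p j) = of_int (S j)"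
      "\<And>j. j \<in> {1..n} \<Longrightarrow> 4 * int (p j) dvd A j * S j - (((A j)\<^sup>2 + 1) * ((int (p j) - 1) * (2 * int (p j) - 1))
        - 3 * int (p j) * (int (p j) - 1) * (2 * A j - 1))"
      "\<And>j. j \<in> {1..n} \<Longrightarrow> odd (int (p j)) \<Longrightarrow> 4 dvd S j - (int (p j) - 1)"
    by metis
  define T where "T = (\<Sum>j = 1..n. A j)"
  define Z where "Z = (\<Sum>j = 1..n. A j * S j)"
  define \<nu> where "\<nu> = int n - 1"
  have "4 * int P dvd 3 * int P - 1 + Z - (int P)\<^sup>2 * (1 + \<nu>\<^sup>2) - 2 * \<nu> * int P * T - T\<^sup>2"
  proof -
    have \<nu>: "\<nu> = int (card {1..n}) - 1" by (simp add: \<nu>_def)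
    show ?thesis unfolding Z_def T_def \<nu> P_eq_prod A_def
    proof (rule Theta_numerator_dvd)
      fix j assume j: "j \<in> {1..n}"
      show "int (p j) > 0" using p[OF j] by simp
      show "4 dvd S j - (int (p j) - 1)" if "odd (int (p j))" using S(3)[OF j that] .
    qed (use cop S(2) in \<open>simp_all only: A_def coprime_int_iff finite_atLeastAtMost\<close>)
  qed
  then obtain y where y: "3 * int P - 1 + Z - (int P)\<^sup>2 * (1 + \<nu>\<^sup>2) - 2 * \<nu> * int P * T - T\<^sup>2 = 4 * int P * y"
    by (elim dvdE)
  obtain d where d: "T + \<nu> * int P = 2 * d + 1"
    using odd_sum_cofactor unfolding T_def[symmetric] \<nu>_def[symmetric] by (elim oddE)
  have e: "phase_num (centre_num N 0) (\<lambda>j\<in>{1..n}. 1) = int P * (\<nu> - int N) + T"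
  proof -
    have "(\<Sum>j = 1..n. (\<lambda>j\<in>{1..n}. 1) j * A j) = T" unfolding T_def by (intro sum.cong) auto
    then show ?thesis by (simp add: phase_num_def centre_num_def \<nu>_def)
  qed
  have Th: "real P * Theta0 n p q = of_int (3 * int P - 1 + Z)"
  proof -
    have "real P * (12 * dedekind_sum (q j) (p j)) = of_int (A j * S j)" if "j \<in> {1..n}" for j
    proof -
      have "real P = real (p j) * of_int (A j)" using of_int_A[OF that] p[OF that] by simp
      then have "real P * (12 * dedekind_sum (q j) (p j)) = of_int (A j) * (12 * real (p j) * dedekind_sum (q j) (p j))"
        by simp
      then show ?thesis unfolding S(1)[OF that] by simp
    qed
    then have "real P * (12 * (\<Sum>j = 1..n. dedekind_sum (q j) (p j))) = of_int Z"
      unfolding Z_def sum_distrib_left of_int_sum by (intro sum.cong refl)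
    then show ?thesis using P_pos by (simp add: Theta0_def algebra_simps)
  qed
  have "3 * int P - 1 + Z + ((int N)\<^sup>2 - 1) * (int P)\<^sup>2 - (int P * (\<nu> - int N) + T)\<^sup>2 =
      4 * int P * y + 2 * int P * int N * (T + \<nu> * int P)"
    unfolding y[symmetric] by (simp add: power2_eq_square algebra_simps)
  also have "\<dots> = int P * (2 * int N + 4 * (y + int N * d))"
    unfolding d by (simp add: algebra_simps)
  finally have "real_of_int (3 * int P - 1 + Z + ((int N)\<^sup>2 - 1) * (int P)\<^sup>2 - (int P * (\<nu> - int N) + T)\<^sup>2) =
      real_of_int (int P * (2 * int N + 4 * (y + int N * d)))" by (simp only:)
  moreover have "real P * (Theta0 n p q + c * real P - e / real P) = real P * Theta0 n p q + c * (real P)\<^sup>2 - e" for c e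
    using P_pos by (simp add: power2_eq_square right_diff_distrib distrib_left)
  ultimately have "real P * (Theta0 n p q + ((real N)\<^sup>2 - 1) * real P - (of_int (int P * (\<nu> - int N) + T))\<^sup>2 / real P) =
      real P * (2 * real N + 4 * of_int (y + int N * d))"
    unfolding Th by simp
  then have "Theta0 n p q + ((real N)\<^sup>2 - 1) * real P - (of_int (int P * (\<nu> - int N) + T))\<^sup>2 / real P =
      2 * real N + 4 * of_int (y + int N * d)" using P_pos by simp
  then show thesis unfolding e[symmetric] by (rule that)
qed

lemma wrt_Phi_tendsto_1:
  assumes "N \<ge> 1"
  shows "((\<lambda>t. wrt_Phi n p q N (2 * pi * \<i> / of_nat 1 - of_real t)) \<longlongrightarrow> wrt_tau n p q 1 N) (at_right 0)"
proof -
  define \<Theta> where "\<Theta> = Theta0 n p q + ((real N)\<^sup>2 - 1) * real P"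
  define E where "E = (\<lambda>t. exp (of_real (- (1 / 4) * \<Theta>) * (2 * pi * \<i> - of_real t)))"
  define C where "C = cis (pi * (of_int (phase_num (centre_num N 0) (\<lambda>j\<in>{1..n}. 1)))\<^sup>2 / (2 * real P))"
  define F where "F = (\<lambda>h. \<Sum>i<N. signed_sum N i h / of_real (h\<^sup>2))"
  \<comment> \<open>\<open>D\<close> is t divided by the denominator of \<open>wrt_Phi\<close>. For
    K = 1 both exponentials in it carry the factor exp (pi i) = exp (- pi i) = - 1, so the
    denominator is 2 (exp (t / 2) - exp (- (t / 2))), asymptotically 2 t.\<close>
  define D where "D = (\<lambda>t::real. t / (2 * (exp (t / 2) - exp (- (t / 2)))))"
  have F: "(F \<longlongrightarrow> (\<Sum>i<N. of_real (- 2 * (- 1) ^ n / real P))) (at_right 0)"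
    unfolding F_def by (intro tendsto_sum signed_sum_asymp)
  \<comment> \<open>The series is divided by h^2 = P t inside F; the t cancels the pole through D,
    and P remains as a factor.\<close>
  have "((\<lambda>t. (- 1) ^ n * E t * C * of_real (D t) * of_nat P * F (sqrt (real P * t))) \<longlongrightarrow>
      (- 1) ^ n * E 0 * C * of_real (1 / 2) * of_nat P * (\<Sum>i<N. of_real (- 2 * (- 1) ^ n / real P))) (at_right 0)"
  proof (intro tendsto_mult tendsto_const filterlim_compose[OF F] filterlim_sqrt_mult tendsto_of_real)
    show "(E \<longlongrightarrow> E 0) (at_right 0)" unfolding E_def by (intro tendsto_intros)
    show "(D \<longlongrightarrow> 1 / 2) (at_right 0)" unfolding D_def by real_asymp
  qed (use P_pos in simp)
  also have "(- 1) ^ n * E 0 * C * of_real (1 / 2) * of_nat P * (\<Sum>i<N. of_real (- 2 * (- 1) ^ n / real P)) =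
      - of_nat N * (E 0 * C)"
    using P_pos by (simp add: field_simps flip: power_mult_distrib)
  also have "E 0 * C = (- 1) ^ N"
  proof -
    obtain z where z: "\<Theta> - (of_int (phase_num (centre_num N 0) (\<lambda>j\<in>{1..n}. 1)))\<^sup>2 / real P = 2 * real N + 4 * of_int z"
      using Theta0_cong[of N] unfolding \<Theta>_def by blast
    have "E 0 = cis (- (pi / 2) * \<Theta>)" unfolding E_def cis_conv_exp by (intro arg_cong[of _ _ exp]) simp
    then have "E 0 * C = cis (- (pi / 2) * (\<Theta> - (of_int (phase_num (centre_num N 0) (\<lambda>j\<in>{1..n}. 1)))\<^sup>2 / real P))"
      unfolding C_def by (simp add: cis_mult algebra_simps)
    also have "\<dots> = cis (real N * pi + 2 * pi * of_int (- int N - z))"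
      unfolding z by (intro arg_cong[of _ _ cis]) (simp add: field_simps)
    also have "\<dots> = cis (real N * pi)" by (rule cis_add_2pi_int)
    also have "\<dots> = (- 1) ^ N" by (simp flip: Complex.DeMoivre)
    finally show ?thesis .
  qed
  also have "- of_nat N * (- 1) ^ N = wrt_tau n p q 1 N"
    using assms by (cases N) (auto simp: wrt_tau_def algebra_simps)
  finally have lim: "((\<lambda>t. (- 1) ^ n * E t * C * of_real (D t) * of_nat P * F (sqrt (real P * t))) \<longlongrightarrow>
      wrt_tau n p q 1 N) (at_right 0)" .
  show ?thesis
  proof (rule Lim_transform_eventually[OF lim])
    show "eventually (\<lambda>t. (- 1) ^ n * E t * C * of_real (D t) * of_nat P * F (sqrt (real P * t)) =
        wrt_Phi n p q N (2 * pi * \<i> / of_nat 1 - of_real t)) (at_right 0)"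
      using eventually_at_right_0_1
    proof eventually_elim
      case (elim t)
      define L where "L = 2 * pi * \<i> / of_nat 1 - of_real t"
      have "1 / 2 * L = of_real (- (t / 2)) + \<i> * of_real pi" by (simp add: L_def field_simps)
      then have e1: "exp (1 / 2 * L) = - of_real (exp (- (t / 2)))"
        by (simp only: exp_add exp_of_real cis_conv_exp[symmetric] cis_pi) simp
      have "- (1 / 2) * L = of_real (t / 2) - \<i> * of_real pi" by (simp add: L_def field_simps)
      then have e2: "exp (- (1 / 2) * L) = - of_real (exp (t / 2))"
        by (simp only: exp_diff exp_of_real cis_conv_exp[symmetric] cis_pi) simp
      have "2 * (exp (1 / 2 * L) - exp (- (1 / 2) * L)) = of_real (2 * (exp (t / 2) - exp (- (t / 2))))"
        unfolding e1 e2 by simp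
      then have den: "of_real (D t) = of_real t / (2 * (exp (1 / 2 * L) - exp (- (1 / 2) * L)))"
        by (simp only: D_def of_real_divide)
      have "0 < sqrt (real P * t)" using elim P_pos by simp
      then have S: "Phi_series N 1 (sqrt (real P * t)) = C * (of_nat P * of_real t * F (sqrt (real P * t)))"
        unfolding Phi_series_1[OF \<open>0 < sqrt (real P * t)\<close>] C_def[symmetric] F_def
        using elim P_pos by (simp add: sum_divide_distrib[symmetric])
      have L: "(2 * pi * \<i> - of_real t) = L" by (simp add: L_def)
      have w: "wrt_Phi n p q N L = (- 1) ^ n * exp (of_real (- (1 / 4) * \<Theta>) * L) /
          (2 * (exp (1 / 2 * L) - exp (- (1 / 2) * L))) * Phi_series N 1 (sqrt (real P * t))"
        unfolding \<Theta>_def L_def using elim by (intro wrt_Phi_eq) auto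
      show ?case
        unfolding L_def[symmetric] w S den E_def L by simp
    qed
  qed
qed

section \<open>The limit for K at least 2\<close>

lemma prefactor_eq:
  assumes "K \<ge> 2"
  shows "cis (pi / 4) / of_real (sqrt (real (2 * P * K))) / (2 * (2 * \<i> * of_real (sin (pi / real K)))) =
    B_const n p * of_real (G0 K) / of_nat K"
proof -
  have s: "sin (pi / real K) \<noteq> 0" using assms sin_gt_zero[of "pi / real K"] by (simp add: field_simps)
  \<comment> \<open>The 8th root of unity cis (pi / 4) of the Gauss sum, divided by the \<i> of exp
    (pi i / K) - exp (- pi i / K), gives - exp (3 pi i / 4), the phase of
    \<open>B_const\<close>.\<close>
  have "exp (3 * pi * \<i> / 4) = \<i> * cis (pi / 4)"
  proof -
    have "exp (3 * pi * \<i> / 4) = cis (pi / 2 + pi / 4)"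
      unfolding cis_conv_exp by (intro arg_cong[of _ _ exp]) (simp add: field_simps)
    then show ?thesis by (simp only: cis_mult[symmetric] cis_pi_half)
  qed
  moreover define a b c where "a = complex_of_real (sqrt (real P))"
    and "b = complex_of_real (sqrt (real K / 2))" and "c = complex_of_real (sin (pi / real K))"
  moreover have "complex_of_real (sqrt (real (2 * P * K))) = 2 * a * b"
  proof -
    have "real (2 * P * K) = 2\<^sup>2 * real P * (real K / 2)" by simp
    then have "sqrt (real (2 * P * K)) = 2 * sqrt (real P) * sqrt (real K / 2)"
      by (simp only: real_sqrt_mult real_sqrt_abs abs_numeral)
    then show ?thesis by (simp add: a_def b_def)
  qed
  moreover have "complex_of_nat K = 2 * b * b"
  proof -
    have "b * b = complex_of_real (sqrt (real K / 2) * sqrt (real K / 2))" by (simp only: b_def of_real_mult)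
    then have bb: "b * b = of_nat K / 2" by simp
    show ?thesis by (simp only: mult.assoc bb) simp
  qed
  moreover have "a \<noteq> 0" "b \<noteq> 0" "c \<noteq> 0" using s P_pos assms by (simp_all add: a_def b_def c_def)
  ultimately show ?thesis
    unfolding B_const_def G0_def by (simp add: field_simps)
qed

lemma wrt_Phi_tendsto:
  assumes K: "K \<ge> 2"
  shows "((\<lambda>t. wrt_Phi n p q N (2 * pi * \<i> / of_nat K - of_real t)) \<longlongrightarrow> wrt_tau n p q K N) (at_right 0)"
proof -
  define \<Theta> where "\<Theta> = Theta0 n p q + ((real N)\<^sup>2 - 1) * real P"
  define L where "L = (\<lambda>t. 2 * pi * \<i> / of_nat K - complex_of_real t)"
  define I where "I = {k. k < 2 * P * K \<and> \<not> K dvd k}"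
  define \<theta> where "\<theta> = (\<lambda>k. pi * \<i> * of_nat k / of_nat K)"
  have s: "sin (pi / real K) \<noteq> 0" using K sin_gt_zero[of "pi / real K"] by (simp add: field_simps)
  have d0: "exp (1 / 2 * L 0) - exp (- (1 / 2) * L 0) = 2 * \<i> * of_real (sin (pi / real K))"
    using esinh_pi_i[of "pi / real K"] by (simp add: esinh_def L_def mult.commute)
  have "((\<lambda>t. (- 1) ^ n * exp (of_real (- (1 / 4) * \<Theta>) * L t) / (2 * (exp (1 / 2 * L t) - exp (- (1 / 2) * L t))) *
      Phi_series N K (sqrt (real P * t))) \<longlongrightarrow>
      (- 1) ^ n * exp (of_real (- (1 / 4) * \<Theta>) * L 0) / (2 * (exp (1 / 2 * L 0) - exp (- (1 / 2) * L 0))) *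
      (\<Sum>k\<in>I. frequency_weight K k * frequency_limit N K k)) (at_right 0)"
  proof (intro tendsto_mult tendsto_divide)
    have L: "(L \<longlongrightarrow> L 0) (at_right 0)" unfolding L_def by (intro tendsto_intros)
    show "((\<lambda>t. exp (of_real (- (1 / 4) * \<Theta>) * L t)) \<longlongrightarrow> exp (of_real (- (1 / 4) * \<Theta>) * L 0)) (at_right 0)"
      "((\<lambda>t. exp (1 / 2 * L t) - exp (- (1 / 2) * L t)) \<longlongrightarrow> exp (1 / 2 * L 0) - exp (- (1 / 2) * L 0)) (at_right 0)"
      by (intro tendsto_intros L)+
    have "((\<lambda>h. Phi_series N K h) \<longlongrightarrow> (\<Sum>k\<in>I. frequency_weight K k * frequency_limit N K k)) (at_right 0)"
      unfolding I_def using K by (intro Phi_series_tendsto) simp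
    then show "((\<lambda>t. Phi_series N K (sqrt (real P * t))) \<longlongrightarrow>
        (\<Sum>k\<in>I. frequency_weight K k * frequency_limit N K k)) (at_right 0)"
      by (rule filterlim_compose) (use P_pos in \<open>auto intro: filterlim_sqrt_mult\<close>)
  qed (use d0 s in auto)
  also have "(- 1) ^ n * exp (of_real (- (1 / 4) * \<Theta>) * L 0) / (2 * (exp (1 / 2 * L 0) - exp (- (1 / 2) * L 0))) *
      (\<Sum>k\<in>I. frequency_weight K k * frequency_limit N K k) = wrt_tau n p q K N"
  proof -
    define E where "E = exp (of_real (- (1 / 4) * \<Theta>) * L 0)"
    have E: "exp (- (pi * \<i> / (2 * of_nat K)) * of_real \<Theta>) = E"
      unfolding E_def L_def using K by (intro arg_cong[of _ _ exp]) (simp add: field_simps)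
    have I: "{k \<in> {0..2 * P * K - 1}. \<not> K dvd k} = I"
    proof -
      have "0 < 2 * P * K" using K P_pos by simp
      then have "k \<le> 2 * P * K - 1 \<longleftrightarrow> k < 2 * P * K" for k by linarith
      then show ?thesis by (auto simp: I_def)
    qed
    define G where "G = (\<lambda>k. esinh (of_nat N * \<theta> k) / esinh (\<theta> k) *
        ((\<Prod>j = 1..n. esinh (\<theta> k / of_nat (p j))) / esinh (\<theta> k) powi (int n - 2)))"
    define W where "W = (\<lambda>k. cis (- pi * (real k)\<^sup>2 / real (2 * P * K)))"
    define g where "g = cis (pi / 4) / of_real (sqrt (real (2 * P * K)))"
    have fl: "frequency_weight K k * frequency_limit N K k = (- 1) ^ n * g * (W k * G k)" if "k \<in> I" for k
      using frequency_limit_eq[of K k N] that K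
      unfolding frequency_weight_def G_def W_def g_def \<theta>_def I_def by (simp add: mult.assoc)
    have W: "exp (- (pi * \<i> / (2 * of_nat K * of_nat P)) * (of_nat k)\<^sup>2) = W k" for k
      unfolding W_def cis_conv_exp by (intro arg_cong[of _ _ exp]) (simp add: field_simps)
    have G: "esinh (of_nat N * (pi * \<i> * of_nat k / of_nat K)) / esinh (pi * \<i> * of_nat k / of_nat K) *
        ((\<Prod>j = 1..n. esinh (pi * \<i> * of_nat k / (of_nat K * of_nat (p j)))) /
           esinh (pi * \<i> * of_nat k / of_nat K) powi (int n - 2)) = G k" for k
      by (simp add: G_def \<theta>_def)
    have "wrt_tau n p q K N = B_const n p * of_real (G0 K) / of_nat K * E * (\<Sum>k\<in>I. W k * G k)"
      using K unfolding wrt_tau_def \<Theta>_def[symmetric] E I W by (simp add: mult.assoc G[symmetric])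
    also have "\<dots> = (- 1) ^ n * E / (2 * (2 * \<i> * of_real (sin (pi / real K)))) *
        ((- 1) ^ n * g * (\<Sum>k\<in>I. W k * G k))"
      unfolding prefactor_eq[OF K, symmetric] g_def by (simp add: field_simps flip: power_mult_distrib)
    also have "(- 1) ^ n * g * (\<Sum>k\<in>I. W k * G k) = (\<Sum>k\<in>I. frequency_weight K k * frequency_limit N K k)"
      unfolding sum_distrib_left by (intro sum.cong refl) (simp add: fl)
    finally show ?thesis unfolding d0 E_def ..
  qed
  finally have lim: "((\<lambda>t. (- 1) ^ n * exp (of_real (- (1 / 4) * \<Theta>) * L t) /
      (2 * (exp (1 / 2 * L t) - exp (- (1 / 2) * L t))) * Phi_series N K (sqrt (real P * t))) \<longlongrightarrow>
      wrt_tau n p q K N) (at_right 0)" .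
  show ?thesis
  proof (rule Lim_transform_eventually[OF lim])
    show "eventually (\<lambda>t. (- 1) ^ n * exp (of_real (- (1 / 4) * \<Theta>) * L t) /
      (2 * (exp (1 / 2 * L t) - exp (- (1 / 2) * L t))) * Phi_series N K (sqrt (real P * t)) =
        wrt_Phi n p q N (2 * pi * \<i> / of_nat K - of_real t)) (at_right 0)"
      using eventually_at_right_0_1
    proof eventually_elim
      case (elim t)
      then show ?case using wrt_Phi_eq[of t K N] K unfolding L_def \<Theta>_def by simp
    qed
  qed
qed

end

theorem theorem2p2:
  fixes n N K :: nat and p :: "nat \<Rightarrow> nat" and q :: "nat \<Rightarrow> int"
  assumes "n \<ge> 1"
    and "\<And>j. j \<in> {1..n} \<Longrightarrow> p j \<ge> 2"
    and "\<And>i j. i \<in> {1..n} \<Longrightarrow> j \<in> {1..n} \<Longrightarrow> i \<noteq> j \<Longrightarrow> coprime (p i) (p j)"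
    and "real (prod_p n p) * (\<Sum>i = 1..n. real_of_int (q i) / real (p i)) = 1"
    and "N \<ge> 1"
    and "K \<ge> 1"
  shows "((\<lambda>t::real. wrt_Phi n p q N (2 * pi * \<i> / of_nat K - of_real t)) \<longlongrightarrow> wrt_tau n p q K N)
           (at_right 0)"
proof -
  interpret seifert n p q using assms(1-4) by unfold_locales
  show ?thesis
  proof (cases "K = 1")
    case True
    then show ?thesis using wrt_Phi_tendsto_1[OF assms(5)] by simp
  next
    case False
    then show ?thesis using assms(6) by (intro wrt_Phi_tendsto) simp
  qed
qed

end
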